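(* Let $\Omega\subset\mathbb{R}^n$ be an open set and let $V=v(M,\theta)$ be a rectifiable $d$-varifold with locally bounded first variation in $\Omega$, with generalized mean curvature $H$. Then for $\|V\|$-almost all $x\in\Omega$ one has \[ H^V_{\rho,\xi,\epsilon}(x)\longrightarrow H(x)\qquad\text{as }\epsilon\to0 . \]
   Context: Fix integers $1\le d<n$. $G_{d,n}$ is the Grassmannian of $d$-dimensional linear subspaces of $\mathbb{R}^n$; a subspace $S$ is identified with the orthogonal projection $\Pi_S$ onto it. A $d$-varifold in $\Omega$ is a non-negative Radon measure $V$ on $\Omega\times G_{d,n}$; its mass is $\|V\|(B)=V(B\times G_{d,n})$. The rectifiable $d$-varifold $V=v(M,\theta)$, with $M$ countably $d$-rectifiable and $\theta>0$ $\mathcal{H}^d$-a.e. on $M$, is the Radon measure given by $\int\varphi\,dV=\int_M\varphi(x,T_xM)\theta(x)\,d\mathcal{H}^d(x)$ for $\varphi\in C_c^0(\Omega\times G_{d,n})$, where $T_xM$ is the approximate tangent space. First variation: $\delta V(X)=\int\mathrm{div}_SX(x)\,dV(x,S)$ for $X\in C_c^1(\Omega,\mathbb{R}^n)$, with $\mathrm{div}_SX=\sum_{j=1}^n\langle\Pi_S(\nabla X_j),e_j\rangle$. $V$ has locally bounded first variation if for each compact $K\subset\Omega$ there is $c_K$ with $|\delta V(X)|\le c_K\sup|X|$ whenever $\mathrm{spt}\,X\subset K$; then $\delta V$ is an $\mathbb{R}^n$-valued Radon measure with Radon–Nikodym–Lebesgue decomposition $\delta V=-H\|V\|+\delta V_s$,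 $\delta V_s$ singular with respect to $\|V\|$, and $H\in L^1_{loc}(\Omega,\|V\|)^n$ is called the generalized mean curvature. Kernels: $\rho,\xi:\mathbb{R}\to[0,\infty)$ are even with support in $[-1,1]$, $\rho\in C^1$, $\xi\in C^0$; $\rho_1(x)=\rho(|x|)$ and $\xi_1(x)=\xi(|x|)$ on $\mathbb{R}^n$ have integral $1$; $\rho_\epsilon(x)=\epsilon^{-n}\rho_1(x/\epsilon)$, $\xi_\epsilon(x)=\epsilon^{-n}\xi_1(x/\epsilon)$. Set $C_\rho=d\,\omega_d\int_0^1\rho(r)r^{d-1}dr$ and $C_\xi=d\,\omega_d\int_0^1\xi(r)r^{d-1}dr$, where $\omega_d$ is the volume of the unit ball of $\mathbb{R}^d$. Define \[ \delta V\ast\rho_\epsilon(x)=\int_{\Omega\times G_{d,n}}\Pi_S\big(\nabla\rho_\epsilon(y-x)\big)\,dV(y,S),\qquad \|V\|\ast\xi_\epsilon(x)=\int_\Omega\xi_\epsilon(y-x)\,d\|V\|(y) \] (well defined whenever the closed ball $\overline{B_\epsilon(x)}$ is contained in $\Omega$). The approximate mean curvature of $V$ at $x$ is, whenever $\|V\|\ast\xi_\epsilon(x)>0$, \[ H^V_{\rho,\xi,\epsilon}(x)=-\frac{C_\xi}{C_\rho}\,\frac{\delta V\ast\rho_\epsilon(x)}{\|V\|\ast\xi_\epsilon(x)} . \] *)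

theory Defs
  imports "HOL-Analysis.Analysis"
begin

section \<open>Function classes\<close>

definition spt :: "('a::topological_space \<Rightarrow> 'b::zero) \<Rightarrow> 'a set" where
  "spt f = closure {x. f x \<noteq> 0}"

definition C1 :: "('a::real_normed_vector \<Rightarrow> 'b::real_normed_vector) \<Rightarrow> bool" where
  "C1 f \<longleftrightarrow> (\<exists>f'. (\<forall>x. (f has_derivative blinfun_apply (f' x)) (at x)) \<and> continuous_on UNIV f')"

text \<open>Compactly supported functions on \<open>W\<close> are total functions, extended by \<open>0\<close> outside \<open>W\<close>.
  In \<open>Cc0\<close> the set \<open>W\<close> need not be open: it is also used for the product of an open set and
  the Grassmannian, where continuity is required relative to \<open>W\<close> only.\<close>

definition Cc0 :: "'a::topological_space set \<Rightarrow> ('a \<Rightarrow> 'b::real_normed_vector) set" where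
  "Cc0 W = {f. continuous_on W f \<and> compact (spt f) \<and> spt f \<subseteq> W}"

definition Cc1 :: "'a::real_normed_vector set \<Rightarrow> ('a \<Rightarrow> 'b::real_normed_vector) set" where
  "Cc1 W = {f. C1 f \<and> compact (spt f) \<and> spt f \<subseteq> W}"

definition gradient :: "(real^'n \<Rightarrow> real) \<Rightarrow> real^'n \<Rightarrow> real^'n" where
  "gradient f x = (\<chi> i. frechet_derivative f (at x) (axis i 1))"


section \<open>Radon measures\<close>

text \<open>For a locally compact subset \<open>W\<close> of a Euclidean space, which is the only case used, every
  Borel measure on \<open>W\<close> that is finite on compact sets is regular.\<close>

definition radon_measure_on :: "'a::topological_space set \<Rightarrow> 'a measure \<Rightarrow> bool" where
  "radon_measure_on W \<mu> \<longleftrightarrow>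
     sets \<mu> = sets (restrict_space borel W) \<and>
     (\<forall>K. compact K \<and> K \<subseteq> W \<longrightarrow> emeasure \<mu> K < \<infinity>)"

definition L1_loc ::
  "'a::topological_space set \<Rightarrow> 'a measure \<Rightarrow> ('a \<Rightarrow> 'b::{banach, second_countable_topology}) \<Rightarrow> bool" where
  "L1_loc W \<mu> f \<longleftrightarrow> (\<forall>K. compact K \<and> K \<subseteq> W \<longrightarrow> set_integrable \<mu> K f)"

definition mutually_singular :: "'a measure \<Rightarrow> 'a measure \<Rightarrow> bool" where
  "mutually_singular \<mu> \<nu> \<longleftrightarrow>
     (\<exists>N \<in> sets \<mu> \<inter> sets \<nu>. emeasure \<mu> N = 0 \<and> emeasure \<nu> (space \<nu> - N) = 0)"

text \<open>An \<open>\<real>\<^sup>n\<close>-valued Radon measure on an open set is given by its polar decomposition \<open>\<sigma> \<nu>\<close>, with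
  \<open>\<nu>\<close> (its total variation) a non-negative Radon measure and \<open>\<sigma>\<close> a Borel field of unit vectors.
  The following says that the functional \<open>L\<close> on test fields is integration against \<open>\<sigma> \<nu>\<close>.\<close>

definition vector_radon_rep ::
  "(real^'n) set \<Rightarrow> ((real^'n \<Rightarrow> real^'n) \<Rightarrow> real) \<Rightarrow> (real^'n) measure \<Rightarrow> (real^'n \<Rightarrow> real^'n) \<Rightarrow> bool" where
  "vector_radon_rep \<Omega> L \<nu> \<sigma> \<longleftrightarrow>
     radon_measure_on \<Omega> \<nu> \<and>
     \<sigma> \<in> borel_measurable \<nu> \<and> (AE x in \<nu>. norm (\<sigma> x) = 1) \<and>
     (\<forall>X \<in> Cc1 \<Omega>. L X = (LINT x|\<nu>. X x \<bullet> \<sigma> x))"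


section \<open>Hausdorff measure and rectifiable sets\<close>

text \<open>These are meant for \<open>d \<ge> 1\<close>, so that the empty set contributes \<open>0\<close> to a covering.\<close>

definition hausdorff_pre :: "nat \<Rightarrow> real \<Rightarrow> 'a::metric_space set \<Rightarrow> ennreal" where
  "hausdorff_pre d \<delta> A =
     (INF C \<in> {C :: nat \<Rightarrow> 'a set. A \<subseteq> (\<Union>i. C i) \<and> (\<forall>i. bounded (C i) \<and> diameter (C i) \<le> \<delta>)}.
        (\<Sum>i. ennreal (unit_ball_vol (real d) * (diameter (C i) / 2) ^ d)))"

definition hausdorff_outer :: "nat \<Rightarrow> 'a::metric_space set \<Rightarrow> ennreal" where
  "hausdorff_outer d A = (SUP \<delta> \<in> {0<..}. hausdorff_pre d \<delta> A)"

text \<open>The measurable sets are all Caratheodory-measurable sets of the outer measure.\<close>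

definition hausdorff_measure :: "nat \<Rightarrow> 'a::metric_space measure" where
  "hausdorff_measure d =
     measure_of UNIV (lambda_system UNIV UNIV (hausdorff_outer d)) (hausdorff_outer d)"

text \<open>The dimension is the cardinality of the index type \<open>'d\<close>.\<close>

definition countably_rectifiable :: "'d::finite itself \<Rightarrow> (real^'n) set \<Rightarrow> bool" where
  "countably_rectifiable _ M \<longleftrightarrow>
     (\<exists>(N :: (real^'n) set) (f :: nat \<Rightarrow> real^'d \<Rightarrow> real^'n).
        hausdorff_outer CARD('d) N = 0 \<and>
        (\<forall>j. \<exists>L. L-lipschitz_on UNIV (f j)) \<and>
        M \<subseteq> N \<union> (\<Union>j. range (f j)))"

text \<open>\<open>P\<close> is the approximate tangent space of \<open>M\<close> at \<open>x\<close>, with respect to the density \<open>\<theta>\<close>: the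
  blow-ups at \<open>x\<close> of the restriction of \<open>\<theta> H\<^sup>d\<close> to \<open>M\<close> converge weakly to the restriction of
  \<open>\<theta>(x) H\<^sup>d\<close> to \<open>P\<close>. Where \<open>\<theta>(x) > 0\<close> there is at most one such \<open>P\<close>.\<close>

definition is_approx_tangent_space ::
  "nat \<Rightarrow> (real^'n) set \<Rightarrow> (real^'n \<Rightarrow> real) \<Rightarrow> real^'n \<Rightarrow> (real^'n) set \<Rightarrow> bool" where
  "is_approx_tangent_space d M \<theta> x P \<longleftrightarrow>
     subspace P \<and> dim P = d \<and>
     (\<forall>\<phi> \<in> Cc0 (UNIV :: (real^'n) set).
        ((\<lambda>r. (LINT y:M|hausdorff_measure d. \<phi> ((1 / r) *\<^sub>R (y - x)) * \<theta> y) / r ^ d)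
           \<longlongrightarrow> \<theta> x * (LINT y:P|hausdorff_measure d. \<phi> y)) (at_right 0))"

definition approx_tangent_space ::
  "nat \<Rightarrow> (real^'n) set \<Rightarrow> (real^'n \<Rightarrow> real) \<Rightarrow> real^'n \<Rightarrow> (real^'n) set" where
  "approx_tangent_space d M \<theta> x = (THE P. is_approx_tangent_space d M \<theta> x P)"


section \<open>Varifolds\<close>

definition orth_proj :: "(real^'n) set \<Rightarrow> real^'n^'n" where
  "orth_proj S = matrix (closest_point S)"

definition grassmannian :: "nat \<Rightarrow> (real^'n^'n) set" where
  "grassmannian d = orth_proj ` {S. subspace S \<and> dim S = d}"

definition varifold :: "nat \<Rightarrow> (real^'n) set \<Rightarrow> ((real^'n) \<times> (real^'n^'n)) measure \<Rightarrow> bool" where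
  "varifold d \<Omega> V \<longleftrightarrow> radon_measure_on (\<Omega> \<times> grassmannian d) V"

definition mass :: "(real^'n) set \<Rightarrow> ((real^'n) \<times> (real^'n^'n)) measure \<Rightarrow> (real^'n) measure" where
  "mass \<Omega> V = distr V (restrict_space borel \<Omega>) fst"

text \<open>\<open>V = v(M, \<theta>)\<close>. The local integrability of \<open>\<theta>\<close> is part of \<open>V\<close> being Radon; it is stated
  separately because the Bochner integral of a non-integrable function is \<open>0\<close>.\<close>

definition rectifiable_varifold ::
  "'d::finite itself \<Rightarrow> (real^'n) set \<Rightarrow> (real^'n) set \<Rightarrow> (real^'n \<Rightarrow> real) \<Rightarrow>
     ((real^'n) \<times> (real^'n^'n)) measure \<Rightarrow> bool" where
  "rectifiable_varifold D \<Omega> M \<theta> V \<longleftrightarrow>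
     varifold CARD('d) \<Omega> V \<and>
     countably_rectifiable D M \<and>
     M \<in> sets (hausdorff_measure CARD('d)) \<and>
     set_borel_measurable (hausdorff_measure CARD('d)) M \<theta> \<and>
     (AE x in hausdorff_measure CARD('d). x \<in> M \<longrightarrow> \<theta> x > 0) \<and>
     L1_loc \<Omega> (hausdorff_measure CARD('d)) (\<lambda>x. indicator M x * \<theta> x) \<and>
     (\<forall>\<phi> \<in> Cc0 (\<Omega> \<times> grassmannian CARD('d)).
        (LINT p|V. \<phi> p) =
        (LINT x:M|hausdorff_measure CARD('d).
           \<phi> (x, orth_proj (approx_tangent_space CARD('d) M \<theta> x)) * \<theta> x))"


section \<open>First variation and generalized mean curvature\<close>

definition tangential_div :: "real^'n^'n \<Rightarrow> (real^'n \<Rightarrow> real^'n) \<Rightarrow> real^'n \<Rightarrow> real" where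
  "tangential_div P X x = (\<Sum>j\<in>UNIV. (P *v gradient (\<lambda>y. X y $ j) x) \<bullet> axis j 1)"

definition first_variation ::
  "((real^'n) \<times> (real^'n^'n)) measure \<Rightarrow> (real^'n \<Rightarrow> real^'n) \<Rightarrow> real" where
  "first_variation V X = (LINT (x, P)|V. tangential_div P X x)"

definition locally_bounded_first_variation ::
  "(real^'n) set \<Rightarrow> ((real^'n) \<times> (real^'n^'n)) measure \<Rightarrow> bool" where
  "locally_bounded_first_variation \<Omega> V \<longleftrightarrow>
     (\<forall>K. compact K \<and> K \<subseteq> \<Omega> \<longrightarrow>
        (\<exists>c. \<forall>X \<in> Cc1 \<Omega>. spt X \<subseteq> K \<longrightarrow> \<bar>first_variation V X\<bar> \<le> c * (SUP x. norm (X x))))"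

text \<open>\<open>\<delta>V = - H \<parallel>V\<parallel> + \<delta>V\<^sub>s\<close>, where \<open>\<delta>V\<^sub>s = \<sigma> \<nu>\<close> is singular with respect to \<open>\<parallel>V\<parallel>\<close>. This
  determines \<open>H\<close> up to \<open>\<parallel>V\<parallel>\<close>-null sets.\<close>

definition generalized_mean_curvature ::
  "(real^'n) set \<Rightarrow> ((real^'n) \<times> (real^'n^'n)) measure \<Rightarrow> (real^'n \<Rightarrow> real^'n) \<Rightarrow> bool" where
  "generalized_mean_curvature \<Omega> V H \<longleftrightarrow>
     L1_loc \<Omega> (mass \<Omega> V) H \<and>
     (\<exists>\<nu> \<sigma>. mutually_singular (mass \<Omega> V) \<nu> \<and>
        vector_radon_rep \<Omega> (\<lambda>X. first_variation V X + (LINT x|mass \<Omega> V. X x \<bullet> H x)) \<nu> \<sigma>)"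


section \<open>Approximate mean curvature\<close>

definition kernel_profile :: "(real \<Rightarrow> real) \<Rightarrow> bool" where
  "kernel_profile \<rho> \<longleftrightarrow> (\<forall>r. \<rho> r \<ge> 0) \<and> (\<forall>r. \<rho> (- r) = \<rho> r) \<and> spt \<rho> \<subseteq> {-1..1}"

definition kernel_const :: "nat \<Rightarrow> (real \<Rightarrow> real) \<Rightarrow> real" where
  "kernel_const d \<rho> = real d * unit_ball_vol (real d) * (LBINT r:{0..1}. \<rho> r * r ^ (d - 1))"

definition radial :: "(real \<Rightarrow> real) \<Rightarrow> real^'n \<Rightarrow> real" where
  "radial \<rho> x = \<rho> (norm x)"

definition scaled :: "real \<Rightarrow> (real^'n \<Rightarrow> real) \<Rightarrow> real^'n \<Rightarrow> real" where
  "scaled \<epsilon> f x = f ((1 / \<epsilon>) *\<^sub>R x) / \<epsilon> ^ CARD('n)"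

definition first_variation_conv ::
  "(real \<Rightarrow> real) \<Rightarrow> real \<Rightarrow> ((real^'n) \<times> (real^'n^'n)) measure \<Rightarrow> real^'n \<Rightarrow> real^'n" where
  "first_variation_conv \<rho> \<epsilon> V x =
     (LINT (y, P)|V. P *v gradient (scaled \<epsilon> (radial \<rho>)) (y - x))"

definition mass_conv ::
  "(real \<Rightarrow> real) \<Rightarrow> real \<Rightarrow> (real^'n) set \<Rightarrow> ((real^'n) \<times> (real^'n^'n)) measure \<Rightarrow> real^'n \<Rightarrow> real" where
  "mass_conv \<xi> \<epsilon> \<Omega> V x = (LINT y|mass \<Omega> V. scaled \<epsilon> (radial \<xi>) (y - x))"

text \<open>Meaningful only if the closed ball of radius \<open>\<epsilon>\<close> around \<open>x\<close> lies in \<open>\<Omega>\<close> and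
  \<open>mass_conv \<xi> \<epsilon> \<Omega> V x > 0\<close>.\<close>

definition approx_mean_curvature ::
  "nat \<Rightarrow> (real \<Rightarrow> real) \<Rightarrow> (real \<Rightarrow> real) \<Rightarrow> real \<Rightarrow> (real^'n) set \<Rightarrow>
     ((real^'n) \<times> (real^'n^'n)) measure \<Rightarrow> real^'n \<Rightarrow> real^'n" where
  "approx_mean_curvature d \<rho> \<xi> \<epsilon> \<Omega> V x =
     - (kernel_const d \<xi> / kernel_const d \<rho>) *\<^sub>R
        (first_variation_conv \<rho> \<epsilon> V x /\<^sub>R mass_conv \<xi> \<epsilon> \<Omega> V x)"

end

theory Submission
  imports Defs "HOL-Probability.Weak_Convergence"
begin

text \<open>
  Testing the first variation with \<open>\<rho>\<^sub>\<epsilon>(y - x) e\<^sub>j\<close> gives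
  \<open>\<delta>V * \<rho>\<^sub>\<epsilon>(x) = - \<integral> \<rho>\<^sub>\<epsilon>(y - x) H(y) d\<parallel>V\<parallel> + \<integral> \<rho>\<^sub>\<epsilon>(y - x) \<sigma>(y) d\<nu>\<close>. At a point \<open>x\<close> where the
  density \<open>\<Theta> = lim \<parallel>V\<parallel>(B\<^sub>r(x)) / r\<^sup>d\<close> exists and is positive, \<open>\<parallel>V\<parallel> * \<rho>\<^sub>\<epsilon>(x)\<close> and \<open>\<parallel>V\<parallel> * \<xi>\<^sub>\<epsilon>(x)\<close> are in the
  asymptotic ratio \<open>C\<^sub>\<rho> / C\<^sub>\<xi>\<close>, so it remains to see that almost every \<open>x\<close> is a Lebesgue point of \<open>H\<close>
  at which \<open>\<nu>\<close> is negligible.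

  Neither the Besicovitch covering theorem nor the existence of approximate tangent spaces is
  needed. Vitali's covering lemma controls \<open>\<nu>(B\<^sub>r(x))\<close> and \<open>\<integral>\<^bsub>B\<^sub>r(x)\<^esub> |H - H(x)| d\<parallel>V\<parallel>\<close> by small multiples of
  \<open>\<parallel>V\<parallel>(B\<^bsub>5r\<^esub>(x))\<close>. This suffices to run the monotonicity formula: it gives \<open>F'(r) \<ge> - K F(10 r)\<close> for a
  smoothed density ratio \<open>F\<close>, which forces \<open>F\<close> to be bounded and hence to converge. Once the density
  exists, the balls of radii \<open>r\<close> and \<open>5r\<close> have comparable mass wherever it is positive. Rectifiability
  enters only through \<open>\<parallel>V\<parallel> \<le> \<theta> H\<^sup>d\<close>, which makes the set of vanishing density negligible.
\<close>

section \<open>Differentiation of Borel measures\<close>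

text \<open>The radius 5r is the price of the covering lemma and threatens a circle: the error
  bounds help only if m(5r) is comparable with m(r), comparability comes from the density, and the
  density comes from a monotonicity formula whose error already lives on the larger ball. The circle
  breaks because the test field on a ball of radius r has size of order r. In F' this factor cancels
  the 1/r produced by differentiating the ratio, so the error is a constant times F at a dilated
  radius, with no singular factor, and a short interval absorbs it. The dilation is 10 = 2 * 5: at
  most 2 from the width of the cutoff, 5 from Vitali. Cutoffs replace balls because the test field
  must be C1; a family of them with a tending to 1 recovers the balls. Monotonicity itself rests on
  two facts about projections: trace P = d and <Pz, z> \<le> |z|^2. The differentiation lemmas are
  stated for finite Borel measures on the whole space, hence the restriction of everything to a
  closed ball and the passage to countably many balls at the end.\<close>

lemma emeasure_UN_le_nn_integral:
  assumes "countable I" "\<And>i. i \<in> I \<Longrightarrow> X i \<in> sets M"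
  shows "emeasure M (\<Union>i\<in>I. X i) \<le> (\<integral>\<^sup>+i. emeasure M (X i) \<partial>count_space I)"
proof -
  have "emeasure M (\<Union>i\<in>I. X i) = (\<integral>\<^sup>+x. indicator (\<Union>i\<in>I. X i) x \<partial>M)"
    using assms by (intro nn_integral_indicator[symmetric] sets.countable_UN') auto
  also have "\<dots> \<le> (\<integral>\<^sup>+x. \<integral>\<^sup>+i. indicator (X i) x \<partial>count_space I \<partial>M)"
  proof (rule nn_integral_mono)
    fix x
    show "indicator (\<Union>i\<in>I. X i) x \<le> (\<integral>\<^sup>+i. indicator (X i) x \<partial>count_space I)"
    proof (cases "x \<in> (\<Union>i\<in>I. X i)")
      case True
      then obtain i where "i \<in> I" "x \<in> X i" by auto
      moreover from True have "indicator (\<Union>i\<in>I. X i) x = (1::ennreal)" by simp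
      ultimately show ?thesis using nn_integral_ge_point[of i I "\<lambda>i. indicator (X i) x"] by simp
    qed auto
  qed
  also have "\<dots> = (\<integral>\<^sup>+i. \<integral>\<^sup>+x. indicator (X i) x \<partial>M \<partial>count_space I)"
    using assms by (intro nn_integral_count_space_nn_integral) auto
  also have "\<dots> = (\<integral>\<^sup>+i. emeasure M (X i) \<partial>count_space I)"
    using assms by (intro nn_integral_cong) auto
  finally show ?thesis .
qed

text \<open>Enlarging the ball on the right-hand side makes Vitali's covering lemma sufficient for an arbitrary
  Borel measure \<open>\<mu>\<close>, without a doubling hypothesis.\<close>

lemma AE_Vitali_differentiation:
  fixes \<mu> \<nu> :: "'a::euclidean_space measure"
  assumes \<mu>: "finite_measure \<mu>" "sets \<mu> = sets borel"
    and \<nu>: "finite_measure \<nu>" "sets \<nu> = sets borel"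
    and E: "E \<in> sets borel" "emeasure \<nu> E = 0" and c: "c > 0"
  shows "AE x in \<mu>. x \<in> E \<longrightarrow>
    (\<forall>\<^sub>F r in at_right 0. measure \<nu> (cball x r) \<le> c * measure \<mu> (cball x (5 * r)))"
proof -
  interpret \<mu>: finite_measure \<mu> by fact
  interpret \<nu>: finite_measure \<nu> by fact
  let ?m = "\<lambda>x r. measure \<mu> (cball x r)" and ?n = "\<lambda>x r. measure \<nu> (cball x r)"
  \<comment> \<open>The bad set \<open>A\<close> is not known to be measurable, so it is enclosed in
    Borel sets of arbitrarily small \<open>\<mu>\<close>-measure.\<close>
  define A where "A = {x \<in> E. \<not> (\<forall>\<^sub>F r in at_right 0. ?n x r \<le> c * ?m x (5 * r))}"
  have cover: "\<exists>D\<in>sets borel. A \<subseteq> D \<and> measure \<mu> D \<le> \<eta>" if \<eta>: "\<eta> > 0" for \<eta>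
  proof -
    have fin: "emeasure \<nu> (space \<nu>) \<noteq> \<infinity>" by simp
    have "(INF U\<in>{U. E \<subseteq> U \<and> open U}. emeasure \<nu> U) = 0"
      using outer_regular[OF \<nu>(2) fin E(1)] E(2) by simp
    then have "(INF U\<in>{U. E \<subseteq> U \<and> open U}. emeasure \<nu> U) < ennreal (c * \<eta>)"
      using c \<eta> by (simp add: ennreal_zero_less_mult_iff)
    then obtain U where U: "E \<subseteq> U" "open U" "emeasure \<nu> U < ennreal (c * \<eta>)"
      unfolding INF_less_iff by auto
    have U': "measure \<nu> U \<le> c * \<eta>"
      using U(3) c \<eta> by (simp add: \<nu>.emeasure_eq_measure ennreal_less_iff)
    \<comment> \<open>Radii at most 1 make the covering lemma applicable. Since the balls stay
      inside \<open>U\<close>, the disjoint ones among them have total \<open>\<nu>\<close>-measure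
      at most \<open>c * \<eta>\<close>, and this pays for the enlarged balls one by one.\<close>
    have "\<exists>r. 0 < r \<and> r \<le> 1 \<and> cball x r \<subseteq> U \<and> ?n x r > c * ?m x (5 * r)"
      if "x \<in> A" for x
    proof -
      from that have x: "x \<in> U" and nev: "\<not> (\<forall>\<^sub>F r in at_right 0. ?n x r \<le> c * ?m x (5 * r))"
        using U(1) by (auto simp: A_def)
      obtain e where e: "e > 0" "cball x e \<subseteq> U" using U(2) x open_contains_cball by blast
      from nev obtain r where "0 < r" "r < min e 1" "\<not> ?n x r \<le> c * ?m x (5 * r)"
        unfolding eventually_at_right_field by (metis e(1) min_less_iff_conj zero_less_one)
      then show ?thesis using e by (intro exI[of _ r]) (auto simp: subset_iff)
    qed
    then obtain R where R: "\<And>x. x \<in> A \<Longrightarrow> 0 < R x \<and> R x \<le> 1 \<and> cball x (R x) \<subseteq> U \<and>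
        ?n x (R x) > c * ?m x (5 * R x)"
      by metis
    have "A \<subseteq> (\<Union>x\<in>A. cball x (R x))" using R by force
    then obtain C where C: "countable C" "C \<subseteq> A"
        "pairwise (\<lambda>i j. disjnt (cball i (R i)) (cball j (R j))) C"
        "A \<subseteq> (\<Union>i\<in>C. cball i (5 * R i))"
      using Vitali_covering_lemma_cballs[where S=A and K=A and a="\<lambda>x. x" and r=R and B=1] R by blast
    let ?D = "\<Union>i\<in>C. cball i (5 * R i)"
    have D: "?D \<in> sets borel" using C(1) by (intro sets.countable_UN') auto
    have disj: "disjoint_family_on (\<lambda>i. cball i (R i)) C"
      using C(3) by (auto simp: disjoint_family_on_def pairwise_def disjnt_def)
    have "emeasure \<mu> ?D \<le> (\<integral>\<^sup>+i. emeasure \<mu> (cball i (5 * R i)) \<partial>count_space C)"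
      using C(1) \<mu>(2) by (intro emeasure_UN_le_nn_integral) auto
    also have "\<dots> \<le> (\<integral>\<^sup>+i. ennreal (1/c) * emeasure \<nu> (cball i (R i)) \<partial>count_space C)"
    proof (rule nn_integral_mono)
      fix i assume "i \<in> space (count_space C)"
      then have "c * ?m i (5 * R i) \<le> ?n i (R i)"
        using R[of i] C(2) by auto
      then have "?m i (5 * R i) \<le> 1/c * ?n i (R i)"
        using c by (simp add: field_simps)
      then show "emeasure \<mu> (cball i (5 * R i)) \<le> ennreal (1/c) * emeasure \<nu> (cball i (R i))"
        using c by (simp add: \<mu>.emeasure_eq_measure \<nu>.emeasure_eq_measure flip: ennreal_mult')
    qed
    also have "\<dots> = ennreal (1/c) * (\<integral>\<^sup>+i. emeasure \<nu> (cball i (R i)) \<partial>count_space C)"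
      by (simp add: nn_integral_cmult)
    also have "(\<integral>\<^sup>+i. emeasure \<nu> (cball i (R i)) \<partial>count_space C) = emeasure \<nu> (\<Union>i\<in>C. cball i (R i))"
      using C(1) \<nu>(2) disj by (intro emeasure_UN_countable[symmetric]) auto
    also have "\<dots> \<le> emeasure \<nu> U"
      using R C(2) U(2) \<nu>(2) by (intro emeasure_mono) auto
    also have "ennreal (1/c) * emeasure \<nu> U \<le> ennreal (1/c) * ennreal (c * \<eta>)"
      unfolding \<nu>.emeasure_eq_measure by (intro mult_left_mono ennreal_leI U') simp
    also have "\<dots> = ennreal \<eta>" using c \<eta> by (simp flip: ennreal_mult')
    finally have "emeasure \<mu> ?D \<le> ennreal \<eta>" by (simp add: mult_left_mono)
    then have "measure \<mu> ?D \<le> \<eta>" using \<eta> by (simp add: \<mu>.emeasure_eq_measure)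
    then show ?thesis using C(4) D by blast
  qed
  have "\<forall>k. \<exists>D\<in>sets borel. A \<subseteq> D \<and> measure \<mu> D \<le> 1 / Suc k" using cover by simp
  then obtain D where D: "\<And>k. D k \<in> sets borel" "\<And>k. A \<subseteq> D k" "\<And>k::nat. measure \<mu> (D k) \<le> 1 / Suc k"
    by metis
  have DM: "(\<Inter>k. D k) \<in> sets \<mu>" using D(1) \<mu>(2) by auto
  have "measure \<mu> (\<Inter>k. D k) \<le> 1 / Suc k" for k
    using D \<mu>(2) DM by (intro order_trans[OF \<mu>.finite_measure_mono D(3)]) auto
  then have "measure \<mu> (\<Inter>k. D k) \<le> 0"
    using LIMSEQ_inverse_real_of_nat by (intro LIMSEQ_le_const) (auto simp: inverse_eq_divide)
  then have "(\<Inter>k. D k) \<in> null_sets \<mu>"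
    using DM by (auto simp: null_sets_def \<mu>.emeasure_eq_measure ennreal_eq_0_iff)
  then show ?thesis
    by (rule AE_I') (use D(2) in \<open>auto simp: A_def\<close>)
qed

text \<open>For q in a countable dense set, the measure |H - q| \<open>\<mu>\<close> truncated to
  {|H - q| \<ge> \<delta>} vanishes on {|H - q| < \<delta>}, so the covering estimate applies there.
  At a given x one picks q within \<delta> of H x; the truncation and the triangle inequality each
  cost a further \<delta>.\<close>

lemma AE_Lebesgue_point:
  fixes \<mu> :: "'a::euclidean_space measure" and H :: "'a \<Rightarrow> 'b::euclidean_space"
  assumes \<mu>: "finite_measure \<mu>" "sets \<mu> = sets borel" and H: "integrable \<mu> H"
  shows "AE x in \<mu>. \<forall>c>0. \<forall>\<^sub>F r in at_right 0.
    (LINT y:cball x r|\<mu>. norm (H y - H x)) \<le> c * measure \<mu> (cball x (5 * r))"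
proof -
  interpret \<mu>: finite_measure \<mu> by fact
  note [measurable_cong] = \<mu>(2)
  let ?F = "\<lambda>q \<delta> y. indicator {y. norm (H y - q) \<ge> \<delta>} y * norm (H y - q)"
  let ?m = "\<lambda>x r. measure \<mu> (cball x r)"
  let ?I = "\<lambda>x r. LINT y:cball x r|\<mu>. norm (H y - H x)"
  have [measurable]: "H \<in> borel_measurable borel"
    using H \<mu>(2) by (metis borel_measurable_integrable measurable_cong_sets)
  obtain D :: "'b set" where D: "countable D" "\<And>X. open X \<Longrightarrow> X \<noteq> {} \<Longrightarrow> \<exists>d\<in>D. d \<in> X"
    using countable_dense_setE by metis
  define \<nu> where "\<nu> q \<delta> = density \<mu> (\<lambda>y. ennreal (?F q \<delta> y))" for q \<delta>
  define E where "E q \<delta> = {y. norm (H y - q) < \<delta>}" for q and \<delta> :: real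
  have int: "integrable \<mu> (\<lambda>y. norm (H y - q))" for q
    using H by (intro integrable_norm Bochner_Integration.integrable_diff) auto
  have int': "integrable \<mu> (\<lambda>y. ?F q \<delta> y)" for q \<delta>
    by (rule Bochner_Integration.integrable_bound[OF int]) (auto split: split_indicator)
  have em: "emeasure (\<nu> q \<delta>) A = ennreal (LINT y:A|\<mu>. ?F q \<delta> y)"
    if "A \<in> sets borel" for A q \<delta>
  proof -
    have "emeasure (\<nu> q \<delta>) A = (\<integral>\<^sup>+y. ennreal (indicator A y *\<^sub>R (?F q \<delta> y)) \<partial>\<mu>)"
      unfolding \<nu>_def using that \<mu>(2)
      by (subst emeasure_density) (auto intro!: nn_integral_cong split: split_indicator)
    also have "\<dots> = ennreal (LINT y:A|\<mu>. ?F q \<delta> y)"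
      unfolding set_lebesgue_integral_def using that int' \<mu>(2)
      by (intro nn_integral_eq_integral integrable_mult_indicator) auto
    finally show ?thesis .
  qed
  have fin: "finite_measure (\<nu> q \<delta>)" for q \<delta>
    using em[of UNIV q \<delta>] by (intro finite_measureI) (auto simp: \<nu>_def sets_eq_imp_space_eq[OF \<mu>(2)])
  have meas: "measure (\<nu> q \<delta>) A = (LINT y:A|\<mu>. ?F q \<delta> y)"
    if "A \<in> sets borel" for A q \<delta>
    using em[OF that, of q \<delta>] unfolding measure_def
    by (subst enn2real_ennreal[symmetric]) (auto simp: set_lebesgue_integral_def intro!: Bochner_Integration.integral_nonneg)
  have sets: "sets (\<nu> q \<delta>) = sets borel" for q \<delta> using \<mu>(2) by (simp add: \<nu>_def)
  have E0: "E q \<delta> \<in> sets borel" for q \<delta> unfolding E_def by measurable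
  have z: "emeasure (\<nu> q \<delta>) (E q \<delta>) = 0" for q \<delta>
    unfolding em[OF E0] by (auto simp: E_def set_lebesgue_integral_def intro!: Bochner_Integration.integral_eq_zero_AE split: split_indicator)
  have "AE x in \<mu>. \<forall>q\<in>D. \<forall>k::nat. x \<in> E q (1 / Suc k) \<longrightarrow>
    (\<forall>\<^sub>F r in at_right 0. measure (\<nu> q (1/Suc k)) (cball x r) \<le> (1 / Suc k) * ?m x (5 * r))"
    using D(1)
    by (intro AE_ball_countable' AE_all_countable[THEN iffD2] allI AE_Vitali_differentiation \<mu> fin sets E0 z) auto
  then show ?thesis
  proof (rule AE_mp, intro AE_I2 impI allI)
    fix x and c :: real
    assume "c > 0" and *: "\<forall>q\<in>D. \<forall>k::nat. x \<in> E q (1 / Suc k) \<longrightarrow>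
      (\<forall>\<^sub>F r in at_right 0. measure (\<nu> q (1/Suc k)) (cball x r) \<le> (1 / Suc k) * ?m x (5 * r))"
    \<comment> \<open>The 3 counts one \<delta> from the truncated measure and two from
      \<open>norm (H y - H x) \<le> ?F q \<delta> y + 2 * \<delta>\<close>.\<close>
    obtain k :: nat where k: "3 / Suc k < c"
    proof -
      obtain k where "3 / c < real k" using reals_Archimedean2 by blast
      then have "3 / Suc k < c" using \<open>c > 0\<close> by (simp add: field_simps) 
      then show ?thesis using that by blast
    qed
    define \<delta> :: real where "\<delta> = 1 / Suc k"
    have \<delta>: "\<delta> > 0" by (simp add: \<delta>_def)
    obtain q where q: "q \<in> D" "q \<in> ball (H x) \<delta>" using D(2)[of "ball (H x) \<delta>"] \<delta> by auto
    then have qx: "norm (H x - q) < \<delta>" by (simp add: dist_norm)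
    then have "x \<in> E q (1 / Suc k)" by (simp add: E_def \<delta>_def)
    with * q have "\<forall>\<^sub>F r in at_right 0. measure (\<nu> q \<delta>) (cball x r) \<le> \<delta> * ?m x (5 * r)"
      by (auto simp: \<delta>_def)
    then show "\<forall>\<^sub>F r in at_right 0. ?I x r \<le> c * ?m x (5 * r)"
      using eventually_at_right_less[of "0::real"]
    proof eventually_elim
      fix r :: real assume r: "measure (\<nu> q \<delta>) (cball x r) \<le> \<delta> * ?m x (5 * r)" "0 < r"
      let ?f = "\<lambda>y. ?F q \<delta> y"
      have mm: "?m x r \<le> ?m x (5 * r)"
        using r(2) \<mu>(2) by (intro \<mu>.finite_measure_mono) auto
      have s1: "set_integrable \<mu> (cball x r) ?f"
        unfolding set_integrable_def using int' \<mu>(2) by (intro integrable_mult_indicator) auto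
      have s2: "set_integrable \<mu> (cball x r) (\<lambda>y. 2 * \<delta>)"
        unfolding set_integrable_def using \<mu>(2) by (intro integrable_mult_indicator) auto
      have "?I x r \<le> (LINT y:cball x r|\<mu>. ?f y + 2 * \<delta>)"
      proof (rule set_integral_mono)
        show "set_integrable \<mu> (cball x r) (\<lambda>y. norm (H y - H x))"
          unfolding set_integrable_def using int \<mu>(2) by (intro integrable_mult_indicator) auto
        show "set_integrable \<mu> (cball x r) (\<lambda>y. ?f y + 2 * \<delta>)"
          unfolding set_integrable_def using int' \<mu>(2) by (intro integrable_mult_indicator Bochner_Integration.integrable_add) auto
        fix y
        have "norm (H y - H x) \<le> norm (H y - q) + norm (H x - q)" by norm
        then show "norm (H y - H x) \<le> ?f y + 2 * \<delta>" using qx \<delta> by (auto split: split_indicator)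
      qed
      also have "\<dots> = (LINT y:cball x r|\<mu>. ?f y) + (LINT y:cball x r|\<mu>. 2 * \<delta>)"
        using s1 s2 by (rule set_integral_add)
      also have "(LINT y:cball x r|\<mu>. 2 * \<delta>) = 2 * \<delta> * ?m x r"
        using \<mu>(2) by (subst set_integral_const) (auto simp: less_top)
      also have "(LINT y:cball x r|\<mu>. ?f y) \<le> \<delta> * ?m x (5 * r)"
        using r(1) by (simp add: meas)
      also have "2 * \<delta> * ?m x r \<le> 2 * \<delta> * ?m x (5 * r)"
        using mm \<delta> by simp
      finally have "?I x r \<le> (3 * \<delta>) * ?m x (5 * r)" by (simp add: algebra_simps)
      also have "\<dots> \<le> c * ?m x (5 * r)"
        using k by (intro mult_right_mono) (auto simp: \<delta>_def)
      finally show "?I x r \<le> c * ?m x (5 * r)" .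
    qed
  qed
qed

section \<open>Existence of the density from a monotonicity inequality\<close>

text \<open>On [0, 1] this is 1 - (1 - u^2)^2. Since the square of a positive part is C1, composing
  two of them gives a C1 step without any gluing.\<close>

definition smooth_step :: "real \<Rightarrow> real" where
  "smooth_step u = 1 - (max 0 (1 - (max 0 u)\<^sup>2))\<^sup>2"

lemma has_real_derivative_max0_square:
  "((\<lambda>u::real. (max 0 u)\<^sup>2) has_real_derivative 2 * max 0 u) (at u)"
proof (cases u "0::real" rule: linorder_cases)
  case less
  have "((\<lambda>u::real. 0) has_real_derivative 0) (at u)" by simp
  then have "((\<lambda>u::real. (max 0 u)\<^sup>2) has_real_derivative 0) (at u)"
    by (rule has_field_derivative_transform_within_open[of _ _ _ "{..<0}"]) (use less in auto)
  then show ?thesis using less by simp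
next
  case equal
  have "((\<lambda>h::real. (max 0 h)\<^sup>2 / h) \<longlongrightarrow> 0) (at 0)"
  proof (rule Lim_null_comparison)
    show "\<forall>\<^sub>F h in at 0. norm ((max 0 h)\<^sup>2 / h) \<le> \<bar>h::real\<bar>"
      by (intro always_eventually) (auto simp: max_def power2_eq_square)
    show "((\<lambda>h::real. \<bar>h\<bar>) \<longlongrightarrow> 0) (at 0)" by (rule tendsto_rabs_zero) simp
  qed
  then show ?thesis using equal by (simp add: DERIV_def)
next
  case greater
  have "((\<lambda>u::real. u\<^sup>2) has_real_derivative 2 * u) (at u)" by (auto intro!: derivative_eq_intros)
  then have "((\<lambda>u::real. (max 0 u)\<^sup>2) has_real_derivative 2 * u) (at u)"
    by (rule has_field_derivative_transform_within_open[of _ _ _ "{0<..}"]) (use greater in auto)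
  then show ?thesis using greater by simp
qed

lemma has_real_derivative_smooth_step:
  "(smooth_step has_real_derivative 4 * max 0 (1 - (max 0 u)\<^sup>2) * max 0 u) (at u)"
  unfolding smooth_step_def[abs_def]
  by (rule derivative_eq_intros refl DERIV_chain2[OF has_real_derivative_max0_square] has_real_derivative_max0_square)+ simp

lemma smooth_step_bounds: "0 \<le> smooth_step u" "smooth_step u \<le> 1"
proof -
  have "(max 0 (1 - (max 0 u)\<^sup>2))\<^sup>2 \<le> 1\<^sup>2" by (rule power_mono) auto
  then show "0 \<le> smooth_step u" "smooth_step u \<le> 1" by (simp_all add: smooth_step_def)
qed

lemma smooth_step_eq_0: "u \<le> 0 \<Longrightarrow> smooth_step u = 0"
  by (simp add: smooth_step_def)

lemma smooth_step_eq_1: "u \<ge> 1 \<Longrightarrow> smooth_step u = 1"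
  by (simp add: smooth_step_def)

text \<open>Meant for the squared scaled distance t = |y - x|^2 / r^2: with
  \<open>T = a\<^sup>2\<close> the transition takes place between the radii r and a r.\<close>

definition cutoff :: "real \<Rightarrow> real \<Rightarrow> real" where
  "cutoff T t = smooth_step ((T - t) / (T - 1))"

definition cutoff' :: "real \<Rightarrow> real \<Rightarrow> real" where
  "cutoff' T t = - (4 * max 0 (1 - (max 0 ((T - t) / (T - 1)))\<^sup>2) * max 0 ((T - t) / (T - 1))) / (T - 1)"

context
  fixes T :: real assumes T: "T > 1"
begin

lemma has_real_derivative_cutoff: "(cutoff T has_real_derivative cutoff' T t) (at t)"
proof -
  have "((\<lambda>t. (T - t) / (T - 1)) has_real_derivative - 1 / (T - 1)) (at t)"
    by (rule DERIV_cdivide) (auto intro!: derivative_eq_intros)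
  from DERIV_chain2[OF has_real_derivative_smooth_step this] show ?thesis
    unfolding cutoff_def[abs_def] cutoff'_def by simp
qed

lemma continuous_cutoff': "continuous_on UNIV (cutoff' T)"
  unfolding cutoff'_def[abs_def] using T by (intro continuous_intros) auto

lemma borel_measurable_cutoff: "cutoff T \<in> borel_measurable borel" "cutoff' T \<in> borel_measurable borel"
  using has_real_derivative_cutoff continuous_cutoff'
  by (auto intro!: borel_measurable_continuous_onI continuous_at_imp_continuous_on intro: DERIV_isCont)

lemma cutoff_bounds: "0 \<le> cutoff T t" "cutoff T t \<le> 1"
  by (simp_all add: cutoff_def smooth_step_bounds)

lemma cutoff_eq_0: "t \<ge> T \<Longrightarrow> cutoff T t = 0"
  using T by (auto simp: cutoff_def divide_le_0_iff intro!: smooth_step_eq_0)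

lemma cutoff_eq_1: "t \<le> 1 \<Longrightarrow> cutoff T t = 1"
  using T by (auto simp: cutoff_def intro!: smooth_step_eq_1)

lemma cutoff'_nonpos: "cutoff' T t \<le> 0"
  using T by (auto simp: cutoff'_def intro!: mult_nonneg_nonneg)

lemma cutoff'_eq_0: "t \<ge> T \<Longrightarrow> cutoff' T t = 0"
  using T by (simp add: cutoff'_def max_absorb1 divide_le_0_iff)

text \<open>Supplies the dominating constant when the smoothed mass is differentiated under the
  integral sign.\<close>

lemma cutoff'_bound: "t \<ge> 0 \<Longrightarrow> \<bar>cutoff' T t\<bar> \<le> 4 * T / (T - 1)\<^sup>2"
proof -
  assume t: "t \<ge> 0"
  have "(T - t) / (T - 1) \<le> T / (T - 1)" using T t by (intro divide_right_mono) auto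
  then have m: "max 0 ((T - t) / (T - 1)) \<le> T / (T - 1)" using T by simp
  have "\<bar>cutoff' T t\<bar> = 4 * (max 0 (1 - (max 0 ((T - t) / (T - 1)))\<^sup>2) * max 0 ((T - t) / (T - 1))) / (T - 1)"
    using T by (simp add: cutoff'_def abs_mult)
  also have "\<dots> \<le> 4 * (1 * (T / (T - 1))) / (T - 1)"
    using T t by (intro divide_right_mono mult_left_mono mult_mono m) auto
  finally show ?thesis using T by (simp add: power2_eq_square)
qed

end

text \<open>By the mean value theorem on the convex set \<open>S\<close> the difference quotients
  are dominated by the constant \<open>B\<close>, which is integrable because the measure is
  finite.\<close>

lemma has_real_derivative_integral:
  fixes f f' :: "real \<Rightarrow> 'a \<Rightarrow> real"
  assumes fin: "finite_measure M" and int: "\<And>s. s \<in> S \<Longrightarrow> integrable M (f s)"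
    and S: "open S" "convex S" "r \<in> S"
    and der: "\<And>s y. s \<in> S \<Longrightarrow> y \<in> space M \<Longrightarrow> ((\<lambda>s. f s y) has_real_derivative f' s y) (at s)"
    and meas: "f' r \<in> borel_measurable M"
    and bound: "\<And>s y. s \<in> S \<Longrightarrow> y \<in> space M \<Longrightarrow> \<bar>f' s y\<bar> \<le> B"
  shows "((\<lambda>s. LINT y|M. f s y) has_real_derivative (LINT y|M. f' r y)) (at r)"
proof -
  interpret finite_measure M by fact
  let ?I = "\<lambda>s. LINT y|M. f s y"
  let ?q = "\<lambda>s y. (f s y - f r y) / (s - r)"
  have "((\<lambda>s. (?I s - ?I r) / (s - r)) \<longlongrightarrow> (LINT y|M. f' r y)) (at r)"
  proof (rule sequentially_imp_eventually_within[unfolded comp_def, of UNIV, simplified]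
      | rule tendsto_at_iff_sequentially[THEN iffD2] allI impI)+
    fix X :: "nat \<Rightarrow> real" assume X0: "\<forall>i. X i \<in> UNIV - {r}" and X: "X \<longlonglongrightarrow> r"
    have evS: "\<forall>\<^sub>F i in sequentially. X i \<in> S" using X S topological_tendstoD by blast
    then obtain N where N: "\<And>i. i \<ge> N \<Longrightarrow> X i \<in> S" by (auto simp: eventually_sequentially)
    \<comment> \<open>Dropping finitely many terms puts the whole sequence inside \<open>S\<close>,
      so that the domination holds for every index.\<close>
    define Y where "Y i = X (i + N)" for i
    have Y: "Y i \<in> S" "Y i \<noteq> r" for i using N X0 by (auto simp: Y_def)
    have YL: "Y \<longlonglongrightarrow> r" using X unfolding Y_def by (rule LIMSEQ_ignore_initial_segment)
    have "(\<lambda>i. LINT y|M. ?q (Y i) y) \<longlonglongrightarrow> (LINT y|M. f' r y)"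
    proof (rule integral_dominated_convergence[where w="\<lambda>_. B"])
      show "f' r \<in> borel_measurable M" by fact
      show "(\<lambda>y. ?q (Y i) y) \<in> borel_measurable M" for i
        using int[OF Y(1), of i] int[OF S(3)] by (intro borel_measurable_divide borel_measurable_diff) auto
      show "AE y in M. (\<lambda>i. ?q (Y i) y) \<longlonglongrightarrow> f' r y"
      proof (rule AE_I2)
        fix y assume "y \<in> space M"
        from der[OF S(3) this] have "((\<lambda>s. ?q s y) \<longlongrightarrow> f' r y) (at r)"
          by (simp add: has_field_derivative_iff)
        then show "(\<lambda>i. ?q (Y i) y) \<longlonglongrightarrow> f' r y"
          using Y YL by (auto simp: tendsto_at_iff_sequentially comp_def)
      qed
      show "AE y in M. norm (?q (Y i) y) \<le> B" for i
      proof (rule AE_I2)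
        fix y assume y: "y \<in> space M"
        have "norm (f (Y i) y - f r y) \<le> B * norm (Y i - r)"
          using S(2) Y(1) S(3) der bound y
          by (intro field_differentiable_bound[of S "\<lambda>s. f s y" "\<lambda>s. f' s y"]) (auto intro: has_field_derivative_at_within)
        then show "norm (?q (Y i) y) \<le> B"
          using Y(2) by (simp add: field_simps abs_divide)
      qed
    qed simp
    also have "(\<lambda>i. LINT y|M. ?q (Y i) y) = (\<lambda>i. ((LINT y|M. f (Y i) y) - ?I r) / (Y i - r))"
      using int Y S by (intro ext) simp
    finally have "(\<lambda>i. ((LINT y|M. f (X (i + N)) y) - ?I r) / (X (i + N) - r)) \<longlonglongrightarrow> (LINT y|M. f' r y)"
      unfolding Y_def .
    then show "((\<lambda>s. (?I s - ?I r) / (s - r)) \<circ> X) \<longlonglongrightarrow> (LINT y|M. f' r y)"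
      unfolding comp_def by (rule LIMSEQ_offset)
  qed
  then show ?thesis by (simp add: has_field_derivative_iff)
qed

text \<open>On an interval \<open>[r, s]\<close> with \<open>s K \<le> 1/2\<close> the mean value theorem at a maximum point of \<open>F\<close> absorbs the
  dilated term, up to the values of \<open>F\<close> on \<open>[s, a s]\<close>.\<close>

lemma bounded_of_derivative_lower_bound_dilated:
  fixes F F' :: "real \<Rightarrow> real"
  assumes R: "R > 0" and a: "a \<ge> 1" and K: "K \<ge> 0"
    and der: "\<And>r. 0 < r \<Longrightarrow> r < R \<Longrightarrow> (F has_real_derivative F' r) (at r)"
    and nonneg: "\<And>r. 0 < r \<Longrightarrow> r < R \<Longrightarrow> F r \<ge> 0"
    and low: "\<And>r. 0 < r \<Longrightarrow> a * r < R \<Longrightarrow> F' r \<ge> - K * F (a * r)"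
  obtains B where "\<forall>\<^sub>F r in at_right 0. F r \<le> B"
proof -
  \<comment> \<open>The first bound keeps \<open>a * s\<close> below \<open>R\<close>, the second
    gives \<open>s * K \<le> 1/2\<close>; the added 1 covers K = 0.\<close>
  define s where "s = min (R / (2 * a)) (1 / (2 * K + 1))"
  have s: "0 < s" "a * s < R" "s * K \<le> 1/2"
  proof -
    show "0 < s" using R a K by (auto simp: s_def)
    have "a * s \<le> a * (R / (2 * a))" using a by (intro mult_left_mono) (auto simp: s_def)
    then show "a * s < R" using a R by auto
    have "s * K \<le> 1 / (2 * K + 1) * K" using K by (intro mult_right_mono) (auto simp: s_def)
    also have "\<dots> \<le> 1/2" using K by (simp add: field_simps)
    finally show "s * K \<le> 1/2" .
  qed
  have cont: "continuous_on {b..c} F" if "0 < b" "c < R" for b c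
    by (rule continuous_at_imp_continuous_on) (use that in \<open>auto intro!: DERIV_isCont der\<close>)
  have as: "s \<le> a * s" using a s by simp
  have "\<exists>t\<in>{s..a * s}. \<forall>u\<in>{s..a * s}. F u \<le> F t"
    using s as by (intro continuous_attains_sup cont) auto
  then obtain K1 where K1: "\<And>t. t \<in> {s..a * s} \<Longrightarrow> F t \<le> K1" by blast
  have K1': "K1 \<ge> 0" using K1[of s] nonneg[of s] s as by auto
  \<comment> \<open>The value \<open>3 * K1\<close> is what F t \<le> K1 + (F t + K1) / 2 yields at
    a maximum point t of [r, s]. It does not depend on r, which is the whole point.\<close>
  have "F r \<le> 3 * K1" if r: "0 < r" "r < s" for r
  proof -
    obtain t where t: "t \<in> {r..s}" "\<And>u. u \<in> {r..s} \<Longrightarrow> F u \<le> F t"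
      using continuous_attains_sup[of "{r..s}" F] cont[of r s] r s as by auto
    have "F t \<le> 3 * K1"
    proof (cases "t = s")
      case True
      then show ?thesis using K1[of s] as K1' by auto
    next
      case False
      with t have ts: "t < s" by auto
      have t0: "0 < t" using t r by auto
      obtain c where c: "t < c" "c < s" "F s - F t = (s - t) * F' c"
        using MVT2[OF ts, of F F'] der t0 s as by (metis le_less_trans less_le_trans order_le_less_trans)
      have ac: "c \<le> a * c" "a * c \<le> a * s" using a c t0 by auto
      \<comment> \<open>The dilated point \<open>a * c\<close> lies either in [r, s], where F is at
        most F t, or in \<open>{s..a * s}\<close>, where it is at most \<open>K1\<close>.\<close>
      have "F (a * c) \<le> F t + K1"
      proof (cases "a * c \<le> s")
        case True
        then have "F (a * c) \<le> F t" using t(1) c ac by (intro t(2)) auto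
        then show ?thesis using K1' by simp
      next
        case False
        then have "F (a * c) \<le> K1" using ac by (intro K1) auto
        then show ?thesis using nonneg[of t] t0 ts s as by auto
      qed
      then have "- K * (F t + K1) \<le> - K * F (a * c)" using K by (intro mult_left_mono_neg) auto
      also have "\<dots> \<le> F' c" using c t0 ac s by (intro low; linarith)
      finally have "(s - t) * (- K * (F t + K1)) \<le> F s - F t"
        unfolding c(3) using ts by (intro mult_left_mono) auto
      moreover have "((s - t) * K) * (F t + K1) \<le> 1/2 * (F t + K1)"
      proof (rule mult_right_mono)
        have "(s - t) * K \<le> s * K" using t0 K by (intro mult_right_mono) auto
        then show "(s - t) * K \<le> 1/2" using s by simp
        show "0 \<le> F t + K1" using nonneg[of t] t0 ts s as K1' by auto
      qed
      moreover have "(s - t) * (- K * (F t + K1)) = - ((s - t) * K * (F t + K1))" by simp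
      ultimately have "F t \<le> F s + 1/2 * (F t + K1)" by linarith
      moreover have "F s \<le> K1" using as by (intro K1) auto
      ultimately have "F t \<le> K1 + 1/2 * (F t + K1)" by linarith
      then show ?thesis using K1' by (simp add: field_simps)
    qed
    then show ?thesis using t(2)[of r] r by auto
  qed
  then have "\<forall>\<^sub>F r in at_right 0. F r \<le> 3 * K1"
    unfolding eventually_at_right_field using s(1) by blast
  then show ?thesis using that by blast
qed

text \<open>Adding |K| r makes F nondecreasing; as it is bounded below, it tends at 0 to its
  infimum.\<close>

lemma tendsto_at_right_of_derivative_lower_bound:
  fixes F F' :: "real \<Rightarrow> real"
  assumes R: "R > 0"
    and der: "\<And>r. 0 < r \<Longrightarrow> r < R \<Longrightarrow> (F has_real_derivative F' r) (at r)"
    and nonneg: "\<And>r. 0 < r \<Longrightarrow> r < R \<Longrightarrow> F r \<ge> 0"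
    and low: "\<And>r. 0 < r \<Longrightarrow> r < R \<Longrightarrow> F' r \<ge> - K"
  obtains L where "(F \<longlongrightarrow> L) (at_right 0)" 
proof -
  define G where "G r = F r + \<bar>K\<bar> * r" for r
  have mono: "G r \<le> G s" if "0 < r" "r \<le> s" "s < R" for r s
  proof (rule DERIV_nonneg_imp_nondecreasing[OF that(2)])
    fix x assume "r \<le> x" "x \<le> s"
    then have x: "0 < x" "x < R" using that by auto
    have "(G has_real_derivative F' x + \<bar>K\<bar>) (at x)"
      unfolding G_def[abs_def] by (auto intro!: derivative_eq_intros der x)
    moreover have "F' x + \<bar>K\<bar> \<ge> 0" using low[OF x] by simp
    ultimately show "\<exists>y. (G has_real_derivative y) (at x) \<and> 0 \<le> y" by blast
  qed
  have G0: "G r \<ge> 0" if "0 < r" "r < R" for r using nonneg[OF that] that by (simp add: G_def)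
  define L where "L = Inf (G ` {0<..<R})"
  have bdd: "bdd_below (G ` {0<..<R})" using G0 by (intro bdd_belowI2[where m=0]) auto
  have GL: "(G \<longlongrightarrow> L) (at_right 0)"
  proof (rule order_tendstoI)
    fix a assume "a < L"
    moreover have "L \<le> G r" if "0 < r" "r < R" for r
      unfolding L_def using bdd that by (intro cInf_lower) auto
    ultimately show "\<forall>\<^sub>F r in at_right 0. a < G r"
      unfolding eventually_at_right_field using R by (metis less_le_trans)
  next
    fix a assume "L < a"
    then obtain s where s: "0 < s" "s < R" "G s < a"
      unfolding L_def using R by (subst (asm) cInf_less_iff) (auto intro: bdd)
    then have "G r < a" if "0 < r" "r < s" for r using mono[of r s] that by auto
    then show "\<forall>\<^sub>F r in at_right 0. G r < a"
      unfolding eventually_at_right_field using s by blast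
  qed
  have "((\<lambda>r. G r - \<bar>K\<bar> * r) \<longlongrightarrow> L - \<bar>K\<bar> * 0) (at_right 0)"
    by (intro tendsto_intros GL)
  then have "(F \<longlongrightarrow> L) (at_right 0)" by (simp add: G_def)
  then show ?thesis using that by blast
qed

text \<open>The derivative of the smoothed ratio \<open>F a\<close> is -(d I + 2 J) / (r r^d), so
  the hypothesis is a lower bound for it. For a = 2 this bound has the dilated form that forces
  boundedness; then every \<open>F a\<close> has a derivative bounded below and converges; finally a
  tends to 1.\<close>

lemma ball_density_converges:
  fixes \<mu> :: "'a::euclidean_space measure"
  assumes \<mu>: "finite_measure \<mu>" "sets \<mu> = sets borel"
    and R: "R > 0" and C: "C \<ge> 0"
    and monotonicity: "\<And>a r. 1 < a \<Longrightarrow> a \<le> 2 \<Longrightarrow> 0 < r \<Longrightarrow> a * r < R \<Longrightarrow>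
      real d * (LINT y|\<mu>. cutoff (a\<^sup>2) ((norm (y - x) / r)\<^sup>2))
        + 2 * (LINT y|\<mu>. cutoff' (a\<^sup>2) ((norm (y - x) / r)\<^sup>2) * (norm (y - x) / r)\<^sup>2)
      \<le> a * r * C * measure \<mu> (cball x (5 * (a * r)))"
  obtains \<Theta> where "((\<lambda>r. measure \<mu> (cball x r) / r ^ d) \<longlongrightarrow> \<Theta>) (at_right 0)"
proof -
  interpret \<mu>: finite_measure \<mu> by fact
  note [measurable_cong] = \<mu>(2)
  define m where "m r = measure \<mu> (cball x r)" for r
  define \<tau> where "\<tau> r y = (norm (y - x) / r)\<^sup>2" for r and y
  define I where "I a r = (LINT y|\<mu>. cutoff (a\<^sup>2) (\<tau> r y))" for a r
  define J where "J a r = (LINT y|\<mu>. cutoff' (a\<^sup>2) (\<tau> r y) * \<tau> r y)" for a r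
  define F where "F a r = I a r / r ^ d" for a r
  define F' where "F' a r = - (real d * I a r + 2 * J a r) / (r * r ^ d)" for a r
  have a2: "a\<^sup>2 > 1" if "a > 1" for a :: real using that by simp
  note [measurable] = borel_measurable_cutoff[OF a2]
  have [measurable]: "\<tau> r \<in> borel_measurable borel" for r unfolding \<tau>_def by measurable
  have m_mono: "m r \<le> m s" if "r \<le> s" for r s
    unfolding m_def using that \<mu>(2) by (intro \<mu>.finite_measure_mono) auto
  have int: "integrable \<mu> (\<lambda>y. cutoff (a\<^sup>2) (\<tau> r y))" if "a > 1" for a r
    using that by (intro \<mu>.integrable_const_bound[where B=1]) (auto simp: cutoff_bounds a2)
  have mball: "m r = (LINT y|\<mu>. indicator (cball x r) y)" for r
    unfolding m_def using \<mu>(2) by (simp add: sets_eq_imp_space_eq)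
  have intb: "integrable \<mu> (\<lambda>y. indicator (cball x r) y :: real)" for r
    using \<mu>(2) by (intro integrable_real_indicator) (auto simp: \<mu>.emeasure_eq_measure)
  have mI: "m r \<le> I a r" if "a > 1" "r > 0" for a r
    unfolding mball I_def
  proof (rule integral_mono[OF intb int[OF that(1)]])
    fix y
    show "indicator (cball x r) y \<le> cutoff (a\<^sup>2) (\<tau> r y)"
    proof (cases "y \<in> cball x r")
      case True
      then have "norm (y - x) / r \<le> 1" using that by (simp add: dist_norm norm_minus_commute)
      then have "\<tau> r y \<le> 1" unfolding \<tau>_def using that by (intro power_le_one) auto
      then show ?thesis using a2[OF that(1)] by (simp add: cutoff_eq_1)
    qed (use cutoff_bounds a2 that in auto)
  qed
  have Im: "I a r \<le> m (a * r)" if "a > 1" "r > 0" for a r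
    unfolding mball I_def
  proof (rule integral_mono[OF int[OF that(1)] intb])
    fix y
    show "cutoff (a\<^sup>2) (\<tau> r y) \<le> indicator (cball x (a * r)) y"
    proof (cases "y \<in> cball x (a * r)")
      case False
      then have "norm (y - x) / r \<ge> a" using that by (simp add: dist_norm norm_minus_commute field_simps)
      then have "\<tau> r y \<ge> a\<^sup>2" unfolding \<tau>_def using that by (intro power_mono) auto
      then show ?thesis using a2[OF that(1)] by (simp add: cutoff_eq_0)
    qed (use cutoff_bounds a2 that in auto)
  qed
  have derI: "(I a has_real_derivative - (2 / r) * J a r) (at r)" if a: "a > 1" and r: "r > 0" for a r
  proof -
    define f' where "f' s y = - (2 / s) * (cutoff' (a\<^sup>2) (\<tau> s y) * \<tau> s y)" for s y
    have bd: "\<bar>cutoff' (a\<^sup>2) (\<tau> s y) * \<tau> s y\<bar> \<le> 4 * a\<^sup>2 / (a\<^sup>2 - 1)\<^sup>2 * a\<^sup>2" for s y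
    proof (cases "\<tau> s y \<ge> a\<^sup>2")
      case True
      then show ?thesis using a2[OF a] by (simp add: cutoff'_eq_0)
    next
      case False
      then show ?thesis unfolding abs_mult using a2[OF a]
        by (intro mult_mono cutoff'_bound) (auto simp: \<tau>_def)
    qed
    \<comment> \<open>For s in (r/2, 2r) one has 2 / s \<le> 4 / r, and \<open>cutoff'\<close>
      vanishes once \<open>\<tau>\<close> reaches \<open>a\<^sup>2\<close>; these two facts give the
      dominating constant.\<close>
    have "((\<lambda>s. LINT y|\<mu>. cutoff (a\<^sup>2) (\<tau> s y)) has_real_derivative (LINT y|\<mu>. f' r y)) (at r)"
    proof (rule has_real_derivative_integral[where S="{r/2<..<2*r}" and B="4 / r * (4 * a\<^sup>2 / (a\<^sup>2 - 1)\<^sup>2 * a\<^sup>2)"])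
      show "((\<lambda>s. cutoff (a\<^sup>2) (\<tau> s y)) has_real_derivative f' s y) (at s)" if "s \<in> {r/2<..<2*r}" for s y
      proof -
        have s: "s > 0" using that r by auto
        then have "((\<lambda>s. \<tau> s y) has_real_derivative - (2 / s) * \<tau> s y) (at s)"
          unfolding \<tau>_def by (auto intro!: derivative_eq_intros simp: power2_eq_square)
        from DERIV_chain2[OF has_real_derivative_cutoff[OF a2[OF a]] this]
        show ?thesis by (simp add: f'_def mult_ac)
      qed
      show "\<bar>f' s y\<bar> \<le> 4 / r * (4 * a\<^sup>2 / (a\<^sup>2 - 1)\<^sup>2 * a\<^sup>2)" if "s \<in> {r/2<..<2*r}" for s y
      proof -
        have "2 / s \<le> 4 / r" using that r by (auto simp: field_simps)
        moreover have "s > 0" using that r by auto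
        ultimately show ?thesis unfolding f'_def abs_mult[of "- (2 / s)"] using r
          by (intro mult_mono bd) (auto simp: abs_mult)
      qed
      show "f' r \<in> borel_measurable \<mu>" unfolding f'_def using a by measurable
    qed (use r in \<open>auto intro!: int a \<mu>\<close>)
    then show ?thesis unfolding f'_def by (simp add: I_def[abs_def] J_def)
  qed
  have derF: "(F a has_real_derivative F' a r) (at r)" if "a > 1" "r > 0" for a r
  proof -
    have "((\<lambda>r. I a r / r ^ d) has_real_derivative
        (- (2 / r) * J a r * r ^ d - I a r * (real d * r ^ (d - 1))) / (r ^ d * r ^ d)) (at r)"
      using that by (intro DERIV_divide derI DERIV_pow[where s=UNIV, simplified]) auto
    also have "(- (2 / r) * J a r * r ^ d - I a r * (real d * r ^ (d - 1))) / (r ^ d * r ^ d) = F' a r"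
      using that unfolding F'_def by (cases d) (auto simp: field_simps)
    finally show ?thesis unfolding F_def[abs_def] .
  qed
  have F0: "F a r \<ge> 0" if "a > 1" "r > 0" for a r
    using that order_trans[OF measure_nonneg mI[OF that, unfolded m_def]] by (auto simp: F_def intro!: divide_nonneg_nonneg)
  \<comment> \<open>The restriction a \<le> 2 turns the ball of radius 5 a r into one of radius at
    most 10 r, uniformly in a.\<close>
  have F'low: "F' a r \<ge> - (2 * C * m (10 * r) / r ^ d)" if a: "1 < a" "a \<le> 2" and r: "0 < r" "2 * r < R" for a r
  proof -
    have "a * r \<le> 2 * r" using a r by auto
    then have "a * r < R" using r by linarith
    then have "real d * I a r + 2 * J a r \<le> a * r * C * m (5 * (a * r))"
      unfolding I_def J_def \<tau>_def m_def using a r by (intro monotonicity)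
    also have "\<dots> \<le> (2 * r * C) * m (10 * r)"
      using \<open>a * r \<le> 2 * r\<close> r C by (intro mult_mono[OF mult_right_mono m_mono]) (auto simp: m_def)
    finally have "(real d * I a r + 2 * J a r) / (r * r ^ d) \<le> (2 * r * C) * m (10 * r) / (r * r ^ d)"
      using r by (intro divide_right_mono) auto
    also have "\<dots> = 2 * C * m (10 * r) / r ^ d" using r by simp
    finally show ?thesis unfolding F'_def minus_divide_left[symmetric] by simp
  qed
  \<comment> \<open>The ball mass \<open>m (10 * r)\<close> is at most \<open>I 2 (10 * r)\<close>,
    so for a = 2 the error closes up as a multiple of \<open>F 2\<close> at 10 r; the factor 10^d
    renormalizes the power of the radius.\<close>
  obtain B where B: "\<forall>\<^sub>F r in at_right 0. F 2 r \<le> B"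
  proof (rule bounded_of_derivative_lower_bound_dilated[where R=R and a=10 and K="2 * C * 10 ^ d" and F="F 2" and F'="F' 2"])
    show "F' 2 r \<ge> - (2 * C * 10 ^ d) * F 2 (10 * r)" if r: "0 < r" "10 * r < R" for r
    proof -
      have "m (10 * r) / r ^ d = 10 ^ d * (m (10 * r) / (10 * r) ^ d)" using r by (simp add: power_mult_distrib)
      also have "\<dots> \<le> 10 ^ d * F 2 (10 * r)"
        unfolding F_def using r by (intro mult_left_mono divide_right_mono mI) auto
      finally have "2 * C * (m (10 * r) / r ^ d) \<le> 2 * C * (10 ^ d * F 2 (10 * r))"
        using C by (intro mult_left_mono) auto
      moreover have "F' 2 r \<ge> - (2 * C * m (10 * r) / r ^ d)" using r by (intro F'low) auto
      ultimately show ?thesis by simp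
    qed
  qed (use R C derF F0 in auto)
  then obtain R1 where R1: "R1 > 0" "\<And>r. 0 < r \<Longrightarrow> r < R1 \<Longrightarrow> F 2 r \<le> B"
    unfolding eventually_at_right_field by blast
  have "\<exists>L. (F a \<longlongrightarrow> L) (at_right 0)" if a: "1 < a" "a \<le> 2" for a
  proof -
    obtain L where "(F a \<longlongrightarrow> L) (at_right 0)"
    proof (rule tendsto_at_right_of_derivative_lower_bound[where R="min (R / 2) (R1 / 10)" and F="F a" and F'="F' a" and K="2 * C * 10 ^ d * B"])
      show "F' a r \<ge> - (2 * C * 10 ^ d * B)" if r: "0 < r" "r < min (R / 2) (R1 / 10)" for r
      proof -
        have "m (10 * r) / r ^ d = 10 ^ d * (m (10 * r) / (10 * r) ^ d)" using r by (simp add: power_mult_distrib)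
        also have "\<dots> \<le> 10 ^ d * F 2 (10 * r)"
          unfolding F_def using r by (intro mult_left_mono divide_right_mono mI) auto
        also have "\<dots> \<le> 10 ^ d * B" using r by (intro mult_left_mono R1) auto
        finally have "2 * C * (m (10 * r) / r ^ d) \<le> 2 * C * (10 ^ d * B)"
          using C by (intro mult_left_mono) auto
        moreover have "F' a r \<ge> - (2 * C * m (10 * r) / r ^ d)" using a r by (intro F'low) auto
        ultimately show ?thesis by simp
      qed
    qed (use R R1 a derF F0 in auto)
    then show ?thesis by blast
  qed
  then obtain L where L: "\<And>a. 1 < a \<Longrightarrow> a \<le> 2 \<Longrightarrow> (F a \<longlongrightarrow> L a) (at_right 0)" by metis
  have L0: "L a \<ge> 0" if "1 < a" "a \<le> 2" for a
    using L[OF that] F0 that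
    by (intro tendsto_lowerbound[of "F a" "L a" "at_right 0" 0])
      (auto intro!: eventually_mono[OF eventually_at_right_less])
  \<comment> \<open>The sandwich \<open>m r \<le> I a r \<le> m (a * r)\<close> shows that
    \<open>L a\<close> is at least the upper limit of the ball ratios and at most a^d times their
    lower limit. Since \<Theta> \<le> \<open>L a\<close> for every a, choosing a close to the
    infimum gives the upper bound and a close to 1 the lower one.\<close>
  define \<Theta> where "\<Theta> = Inf (L ` {1<..2})"
  have bdd: "bdd_below (L ` {1<..2})" using L0 by (intro bdd_belowI2[where m=0]) auto
  have D0: "m r / r ^ d \<ge> 0" if "r > 0" for r using that by (auto simp: m_def)
  have "((\<lambda>r. m r / r ^ d) \<longlongrightarrow> \<Theta>) (at_right 0)"
  proof (rule order_tendstoI)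
    fix u assume "\<Theta> < u"
    then obtain a where a: "1 < a" "a \<le> 2" "L a < u"
      unfolding \<Theta>_def by (subst (asm) cInf_less_iff) (auto intro: bdd)
    have "\<forall>\<^sub>F r in at_right 0. F a r < u" using L[OF a(1,2)] a(3) by (rule order_tendstoD)
    then show "\<forall>\<^sub>F r in at_right 0. m r / r ^ d < u"
      using eventually_at_right_less[of 0]
    proof eventually_elim
      case (elim r)
      have "m r / r ^ d \<le> F a r" unfolding F_def using elim a by (intro divide_right_mono mI) auto
      then show ?case using elim by simp
    qed
  next
    fix l assume l: "l < \<Theta>"
    show "\<forall>\<^sub>F r in at_right 0. l < m r / r ^ d"
    proof (cases "l < 0")
      case True
      then show ?thesis using D0 by (intro eventually_mono[OF eventually_at_right_less[of 0]]) (auto intro: less_le_trans)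
    next
      case False
      \<comment> \<open>The loss a^d from comparing radii r / a and r is absorbed by the gap between
        l and \<Theta>.\<close>
      have "((\<lambda>a. a ^ d * l) \<longlongrightarrow> 1 ^ d * l) (at_right (1::real))" by (intro tendsto_intros)
      then have "\<forall>\<^sub>F a in at_right (1::real). a ^ d * l < \<Theta>" using l by (intro order_tendstoD) auto
      then obtain b where b: "b > 1" "\<And>a. 1 < a \<Longrightarrow> a < b \<Longrightarrow> a ^ d * l < \<Theta>"
        unfolding eventually_at_right_field by blast
      obtain a where a: "1 < a" "a \<le> 2" "a ^ d * l < \<Theta>"
      proof
        show "1 < min 2 ((1 + b) / 2)" "min 2 ((1 + b) / 2) \<le> 2" using b(1) by auto
        then show "min 2 ((1 + b) / 2) ^ d * l < \<Theta>" using b(1) by (intro b(2)) (auto simp: min_less_iff_disj)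
      qed
      have "\<Theta> \<le> L a" unfolding \<Theta>_def using a bdd by (intro cInf_lower) auto
      then have "\<forall>\<^sub>F r in at_right 0. a ^ d * l < F a r" using a(3) by (intro order_tendstoD(1)[OF L[OF a(1,2)]]) auto
      then obtain R2 where R2: "R2 > 0" "\<And>r. 0 < r \<Longrightarrow> r < R2 \<Longrightarrow> a ^ d * l < F a r"
        unfolding eventually_at_right_field by blast
      have "l < m r / r ^ d" if r: "0 < r" "r < a * R2" for r
      proof -
        have ra: "0 < r / a" "r / a < R2" using r a by (auto simp: field_simps)
        have "a ^ d * l < F a (r / a)" using R2(2)[OF ra] .
        also have "\<dots> \<le> m (a * (r / a)) / (r / a) ^ d"
          unfolding F_def using a ra by (intro divide_right_mono Im) auto
        also have "\<dots> = a ^ d * (m r / r ^ d)" using a by (simp add: power_divide)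
        finally have "a ^ d * l < a ^ d * (m r / r ^ d)" .
        moreover have "a ^ d > 0" using a by simp
        ultimately show ?thesis using mult_less_cancel_left_pos by blast
      qed
      then show ?thesis unfolding eventually_at_right_field using R2(1) a by (intro exI[of _ "a * R2"]) auto
    qed
  qed
  then show ?thesis using that unfolding m_def by blast
qed

section \<open>Radial averages\<close>

text \<open>The limit law of \<open>|y - x| / e\<close> for \<open>y\<close> distributed according to the normalized restriction of \<open>\<mu>\<close> to the
  ball of radius \<open>e\<close> around \<open>x\<close>.\<close>

definition radial_law :: "nat \<Rightarrow> real measure" where
  "radial_law d = density lborel (\<lambda>t. ennreal (indicator {0..1} t * (real d * t ^ (d - 1))))"

lemma emeasure_radial_law_Icc:
  assumes d: "d \<ge> 1" and u: "0 \<le> u" "u \<le> 1"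
  shows "emeasure (radial_law d) {0..u} = ennreal (u ^ d)"
proof -
  have "emeasure (radial_law d) {0..u} = (\<integral>\<^sup>+t. ennreal (real d * t ^ (d - 1)) * indicator {0..u} t \<partial>lborel)"
    unfolding radial_law_def using u
    by (subst emeasure_density) (auto intro!: nn_integral_cong split: split_indicator)
  also have "\<dots> = ennreal (u ^ d - 0 ^ d)"
    by (rule nn_integral_FTC_Icc) (use u d in \<open>auto intro!: derivative_eq_intros\<close>)
  finally show ?thesis using d by (simp add: zero_power)
qed

lemma radial_law_null:
  assumes A: "A \<in> sets borel" "A \<inter> {0..1} = {}"
  shows "emeasure (radial_law d) A = 0"
proof -
  have "emeasure (radial_law d) A = (\<integral>\<^sup>+t. ennreal (indicator {0..1} t * (real d * t ^ (d - 1))) * indicator A t \<partial>lborel)"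
    unfolding radial_law_def using A by (intro emeasure_density) auto
  also have "\<dots> = (\<integral>\<^sup>+t. 0 \<partial>(lborel :: real measure))"
    by (rule nn_integral_cong) (use A in \<open>auto split: split_indicator\<close>)
  finally show ?thesis by simp
qed

lemma real_distribution_radial_law:
  assumes d: "d \<ge> 1"
  shows "real_distribution (radial_law d)"
proof -
  have "emeasure (radial_law d) UNIV = emeasure (radial_law d) ({0..1} \<union> - {0..1})"
    by (simp add: Un_commute)
  also have "\<dots> = emeasure (radial_law d) {0..1} + emeasure (radial_law d) (- {0..1})"
    by (rule plus_emeasure[symmetric]) (auto simp: radial_law_def)
  also have "\<dots> = 1" using emeasure_radial_law_Icc[OF d, of 1] by (simp add: radial_law_null)
  finally have "prob_space (radial_law d)"
    by (intro prob_spaceI) (simp add: radial_law_def)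
  then show ?thesis
    by (simp add: real_distribution_def real_distribution_axioms_def radial_law_def)
qed

lemma cdf_radial_law:
  assumes d: "d \<ge> 1"
  shows "cdf (radial_law d) u = (if u < 0 then 0 else (min u 1) ^ d)"
proof (cases "u < 0")
  case True
  then show ?thesis by (simp add: cdf_def measure_def radial_law_null)
next
  case False
  have "emeasure (radial_law d) {..u} = emeasure (radial_law d) ({0..min u 1} \<union> ({..<0} \<union> {1<..u}))"
    using False by (intro arg_cong[where f="emeasure (radial_law d)"]) auto
  also have "\<dots> = emeasure (radial_law d) {0..min u 1} + emeasure (radial_law d) ({..<0} \<union> {1<..u})"
    by (rule plus_emeasure[symmetric]) (auto simp: radial_law_def)
  also have "\<dots> = ennreal ((min u 1) ^ d)"
    using emeasure_radial_law_Icc[OF d, of "min u 1"] False by (subst radial_law_null) auto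
  finally show ?thesis using False by (simp add: cdf_def measure_def)
qed

lemma integral_radial_law:
  fixes \<phi> :: "real \<Rightarrow> real"
  assumes [measurable]: "\<phi> \<in> borel_measurable borel"
  shows "(LINT t|radial_law d. \<phi> t) = real d * (LBINT r:{0..1}. \<phi> r * r ^ (d - 1))"
proof -
  have "(LINT t|radial_law d. \<phi> t) = (LINT t|lborel. (indicator {0..1} t * (real d * t ^ (d - 1))) *\<^sub>R \<phi> t)"
    unfolding radial_law_def by (intro integral_density) (auto split: split_indicator)
  also have "\<dots> = (LINT t|lborel. real d * (indicator {0..1} t *\<^sub>R (\<phi> t * t ^ (d - 1))))"
    by (intro Bochner_Integration.integral_cong) auto
  finally show ?thesis by (simp add: set_lebesgue_integral_def)
qed

text \<open>The scaled distance under the normalized measure on the ball has distribution function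
  m(u e) / m(e) on [0, 1], which tends to u^d by the density assumption. Weak convergence to
  \<open>radial_law d\<close> then allows any continuous radial profile, without integration by
  parts.\<close>

lemma radial_integral_asymptotics:
  fixes \<mu> :: "'a::euclidean_space measure" and \<phi> :: "real \<Rightarrow> real"
  assumes \<mu>: "finite_measure \<mu>" "sets \<mu> = sets borel" and d: "d \<ge> 1"
    and dens: "((\<lambda>r. measure \<mu> (cball x r) / r ^ d) \<longlongrightarrow> \<Theta>) (at_right 0)" "\<Theta> > 0"
    and \<phi>: "continuous_on UNIV \<phi>" "\<And>t. t > 1 \<Longrightarrow> \<phi> t = 0"
  shows "((\<lambda>e. (LINT y|\<mu>. \<phi> (norm (y - x) / e)) / measure \<mu> (cball x e))
     \<longlongrightarrow> real d * (LBINT r:{0..1}. \<phi> r * r ^ (d - 1))) (at_right 0)"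
proof -
  interpret \<mu>: finite_measure \<mu> by fact
  note [measurable_cong] = \<mu>(2)
  have [measurable]: "\<phi> \<in> borel_measurable borel" using \<phi>(1) by (rule borel_measurable_continuous_onI)
  define m where "m r = measure \<mu> (cball x r)" for r
  have m_mono: "m r \<le> m s" if "r \<le> s" for r s
    unfolding m_def using that \<mu>(2) by (intro \<mu>.finite_measure_mono) auto
  have "\<forall>\<^sub>F r in at_right 0. m r / r ^ d > 0"
    unfolding m_def using dens by (rule order_tendstoD)
  then obtain R where R: "R > 0" "\<And>r. 0 < r \<Longrightarrow> r < R \<Longrightarrow> m r / r ^ d > 0"
    unfolding eventually_at_right_field by blast
  then have mpos: "m r > 0" if "0 < r" "r < R" for r
    using R(2)[OF that] that by (simp add: zero_less_divide_iff)
  \<comment> \<open>On the negative axis \<open>\<phi>\<close> may be unbounded. Composing with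
    \<open>max 0\<close> gives a bounded continuous function that agrees with \<open>\<phi>\<close>
    at every value of the scaled distance.\<close>
  have bounded: "\<exists>B. \<forall>t. norm (\<phi> (max 0 t)) \<le> B"
  proof -
    have "compact (\<phi> ` {0..1})" using \<phi>(1) by (intro compact_continuous_image) (auto intro: continuous_on_subset)
    then obtain B where B: "\<And>t. t \<in> {0..1} \<Longrightarrow> norm (\<phi> t) \<le> B" by (meson bounded_iff compact_imp_bounded imageI)
    have "norm (\<phi> (max 0 t)) \<le> B" for t
      using B[of "max 0 t"] B[of 0] \<phi>(2)[of "max 0 t"] norm_ge_zero[of "\<phi> 0"] by (cases "t \<le> 1") auto
    then show ?thesis by blast
  qed
  then obtain B where B: "\<And>t. norm (\<phi> (max 0 t)) \<le> B" by blast
  show ?thesis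
  proof (rule tendsto_at_right_sequentially[where b=R])
    show "0 < R" by fact
    fix e :: "nat \<Rightarrow> real"
    assume e: "\<And>n. 0 < e n" "\<And>n. e n < R" "decseq e" "e \<longlonglongrightarrow> 0"
  let ?B = "\<lambda>n. cball x (e n)" and ?f = "\<lambda>n y. \<phi> (norm (y - x) / e n)"
    define N where "N n = distr (uniform_measure \<mu> (?B n)) borel (\<lambda>y. norm (y - x) / e n)" for n
    have em: "emeasure \<mu> (?B n) \<noteq> 0" "emeasure \<mu> (?B n) \<noteq> \<infinity>" for n
      using mpos[OF e(1,2), of n] by (auto simp: \<mu>.emeasure_eq_measure m_def)
    have real_N: "real_distribution (N n)" for n
    proof -
      interpret prob_space "uniform_measure \<mu> (?B n)"
        using em by (rule prob_space_uniform_measure)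
      have "prob_space (N n)" unfolding N_def by (rule prob_space_distr) measurable
      then show ?thesis by (simp add: real_distribution_def real_distribution_axioms_def N_def)
    qed
    have cdf_N: "cdf (N n) u = (if u < 0 then 0 else m (min u 1 * e n) / m (e n))" for n u
    proof -
      have "cdf (N n) u = measure (uniform_measure \<mu> (?B n)) ((\<lambda>y. norm (y - x) / e n) -` {..u} \<inter> space \<mu>)"
        unfolding cdf_def N_def by (subst measure_distr) auto
      also have "(\<lambda>y. norm (y - x) / e n) -` {..u} \<inter> space \<mu> = {y. norm (y - x) \<le> u * e n}"
        using e(1)[of n] by (auto simp: sets_eq_imp_space_eq[OF \<mu>(2)] field_simps)
      also have "measure (uniform_measure \<mu> (?B n)) \<dots> = measure \<mu> (?B n \<inter> {y. norm (y - x) \<le> u * e n}) / m (e n)"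
        unfolding m_def using em[of n] \<mu>(2)
        by (intro measure_uniform_measure) auto
      also have "?B n \<inter> {y. norm (y - x) \<le> u * e n} = (if u < 0 then {} else cball x (min u 1 * e n))"
      proof (cases "u < 0")
        case True
        then have "u * e n < 0" using e(1)[of n] by (simp add: mult_neg_pos)
        then have "\<not> norm (y - x) \<le> u * e n" for y using norm_ge_zero[of "y - x"] by linarith
        then show ?thesis using True by auto
      next
        case False
        have "min u 1 * e n = min (u * e n) (e n)" using e(1)[of n] by (simp add: min_mult_distrib_right)
        then show ?thesis using False by (auto simp: dist_norm norm_minus_commute)
      qed
      finally show ?thesis by (auto simp: m_def)
    qed
    have "weak_conv_m N (radial_law d)"
      unfolding weak_conv_m_def weak_conv_def
    proof (intro allI impI)
      fix u :: real
      show "(\<lambda>n. cdf (N n) u) \<longlonglongrightarrow> cdf (radial_law d) u"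
      proof (cases "u \<le> 0")
        case True
        show ?thesis
        proof (cases "u = 0")
          \<comment> \<open>At u = 0 convergence says that x is not an atom:
            \<open>m 0 \<le> m r\<close>, and m r tends to 0 like \<Theta> r^d with d \<ge>
            1.\<close>
          case 0: True
          have "((\<lambda>r. m r / r ^ d * r ^ d) \<longlongrightarrow> \<Theta> * 0 ^ d) (at_right 0)"
            unfolding m_def by (intro tendsto_intros dens)
          then have "m 0 \<le> \<Theta> * 0 ^ d"
            by (rule tendsto_lowerbound)
              (auto intro!: eventually_mono[OF eventually_at_right_less] m_mono)
          then have "m 0 = 0" using d by (simp add: m_def zero_power measure_le_0_iff)
          then show ?thesis using d 0 by (simp add: cdf_N cdf_radial_law[OF d] zero_power)
        qed (use True in \<open>auto simp: cdf_N cdf_radial_law[OF d]\<close>)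
      next
        case False
        define v where "v = min u 1"
        have v: "v > 0" using False by (auto simp: v_def)
        have ne: "e n \<noteq> 0" for n using e(1)[of n] by simp
        have lim0: "filterlim e (at_right 0) sequentially"
          using e ne by (auto simp: filterlim_at)
        have limv: "filterlim (\<lambda>n. v * e n) (at_right 0) sequentially"
          using e ne v by (auto simp: filterlim_at intro!: tendsto_mult_right_zero)
        have "(\<lambda>n. (m (v * e n) / (v * e n) ^ d) / (m (e n) / e n ^ d) * v ^ d) \<longlonglongrightarrow> \<Theta> / \<Theta> * v ^ d"
          using dens(2) filterlim_compose[OF dens(1) limv] filterlim_compose[OF dens(1) lim0]
          unfolding m_def by (intro tendsto_intros) auto
        also have "(\<lambda>n. (m (v * e n) / (v * e n) ^ d) / (m (e n) / e n ^ d) * v ^ d) = (\<lambda>n. m (v * e n) / m (e n))"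
          using ne v by (intro ext) (simp add: power_mult_distrib)
        finally show ?thesis using False dens(2) by (simp add: cdf_N cdf_radial_law[OF d] v_def)
      qed
    qed
    interpret real_distribution "radial_law d" by (rule real_distribution_radial_law[OF d])
    have "continuous_on UNIV (\<lambda>t. \<phi> (max 0 t))"
      by (rule continuous_on_compose2[OF \<phi>(1)]) (auto intro!: continuous_intros)
    then have "isCont (\<lambda>t. \<phi> (max 0 t)) t" for t
      by (simp add: continuous_on_eq_continuous_at)
    then have "(\<lambda>n. LINT t|N n. \<phi> (max 0 t)) \<longlonglongrightarrow> (LINT t|radial_law d. \<phi> (max 0 t))"
      using B by (intro weak_conv_imp_integral_bdd_continuous_conv[where B=B] real_N real_distribution_radial_law[OF d]
        \<open>weak_conv_m N (radial_law d)\<close>)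
    also have "(LINT t|radial_law d. \<phi> (max 0 t)) = real d * (LBINT r:{0..1}. \<phi> r * r ^ (d - 1))"
      by (subst integral_radial_law) (auto intro!: set_lebesgue_integral_cong)
    also have "(\<lambda>n. LINT t|N n. \<phi> (max 0 t)) = (\<lambda>n. (LINT y|\<mu>. ?f n y) / measure \<mu> (?B n))"
    proof
      fix n
      have "(LINT t|N n. \<phi> (max 0 t)) = (LINT y|uniform_measure \<mu> (?B n). ?f n y)"
        unfolding N_def using e(1)[of n] by (subst integral_distr) auto
      also have "\<dots> = (LINT y|density \<mu> (\<lambda>y. ennreal (indicator (?B n) y / m (e n))). ?f n y)"
        unfolding uniform_measure_def \<mu>.emeasure_eq_measure m_def[symmetric] using mpos[OF e(1,2), of n]
        by (simp add: divide_ennreal[symmetric] ennreal_indicator)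
      also have "\<dots> = (LINT y|\<mu>. (indicator (?B n) y / m (e n)) *\<^sub>R ?f n y)"
      proof (rule integral_density)
        show "(\<lambda>y. indicator (?B n) y / m (e n)) \<in> borel_measurable \<mu>"
          using \<mu>(2) by (intro borel_measurable_divide borel_measurable_indicator) auto
        show "AE y in \<mu>. 0 \<le> indicator (?B n) y / m (e n)" using mpos[OF e(1,2), of n] by simp
      qed measurable
      also have "\<dots> = (LINT y|\<mu>. ?f n y / m (e n))"
      proof (intro Bochner_Integration.integral_cong refl)
        fix y
        show "(indicator (?B n) y / m (e n)) *\<^sub>R ?f n y = ?f n y / m (e n)"
        proof (cases "y \<in> ?B n")
          case False
          then have "norm (y - x) / e n > 1" using e(1)[of n] by (simp add: dist_norm norm_minus_commute)
          then show ?thesis using False by (simp add: \<phi>(2))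
        qed simp
      qed
      finally show "(LINT t|N n. \<phi> (max 0 t)) = (LINT y|\<mu>. ?f n y) / measure \<mu> (?B n)"
        by (simp add: m_def)
    qed
    finally show "(\<lambda>n. (LINT y|\<mu>. ?f n y) / measure \<mu> (?B n))
      \<longlonglongrightarrow> real d * (LBINT r:{0..1}. \<phi> r * r ^ (d - 1))" .
  qed
qed

section \<open>The Grassmannian\<close>

text \<open>The Stiefel manifold: the rows of the matrix, indexed by \<open>'d\<close>, form an
  orthonormal system.\<close>

definition orthonormal_frames :: "(real^'n^'d) set" where
  "orthonormal_frames = {A. \<forall>i j. A $ i \<bullet> A $ j = (if i = j then 1 else 0)}"

text \<open>This is the product of the transpose of A with A; for an orthonormal frame it is the
  projection onto the row space.\<close>

definition frame_proj :: "real^'n^'d \<Rightarrow> real^'n^'n" where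
  "frame_proj A = (\<chi> k l. \<Sum>i\<in>UNIV. A $ i $ l * A $ i $ k)"

lemma frame_proj_mult: "frame_proj A *v z = (\<Sum>i\<in>UNIV. (A $ i \<bullet> z) *\<^sub>R A $ i)"
proof -
  have "(\<Sum>l\<in>UNIV. (\<Sum>i\<in>UNIV. A $ i $ l * A $ i $ k) * z $ l)
      = (\<Sum>i\<in>UNIV. (\<Sum>l\<in>UNIV. A $ i $ l * z $ l) * A $ i $ k)" for k
    unfolding sum_distrib_right by (subst sum.swap) (simp add: mult_ac)
  then show ?thesis
    by (simp add: vec_eq_iff frame_proj_def matrix_vector_mult_def inner_vec_def)
qed

lemma closest_point_span_frame:
  fixes A :: "real^'n^'d"
  assumes A: "A \<in> orthonormal_frames"
  shows "closest_point (span (range (($) A))) z = (\<Sum>i\<in>UNIV. (A $ i \<bullet> z) *\<^sub>R A $ i)"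
proof (rule closest_point_unique[symmetric])
  let ?S = "span (range (($) A))" and ?x = "\<Sum>i\<in>UNIV. (A $ i \<bullet> z) *\<^sub>R A $ i"
  have on: "A $ i \<bullet> A $ j = (if i = j then 1 else 0)" for i j using A by (simp add: orthonormal_frames_def)
  show "convex ?S" "closed ?S" by (simp_all add: subspace_imp_convex closed_subspace)
  show x: "?x \<in> ?S" by (intro span_sum span_mul span_base) auto
  have orth: "orthogonal (z - ?x) b" if "b \<in> ?S" for b
  proof (rule orthogonal_to_span[OF that])
    fix a assume "a \<in> range (($) A)"
    then obtain j where j: "a = A $ j" by auto
    have "?x \<bullet> A $ j = (\<Sum>i\<in>UNIV. (A $ i \<bullet> z) * (if i = j then 1 else 0))"
      by (simp add: inner_sum_left on)
    then have "?x \<bullet> A $ j = z \<bullet> A $ j" by (simp add: if_distrib inner_commute cong: if_cong)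
    then show "orthogonal (z - ?x) a" by (simp add: j orthogonal_def inner_diff_left)
  qed
  show "\<forall>y\<in>?S. dist z ?x \<le> dist z y"
  proof
    fix y assume "y \<in> ?S"
    then have "?x - y \<in> ?S" using x by (intro span_diff)
    from norm_add_Pythagorean[OF orth[OF this]]
    have "(norm (z - y))\<^sup>2 = (norm (z - ?x))\<^sup>2 + (norm (?x - y))\<^sup>2" by simp
    then have "(norm (z - ?x))\<^sup>2 \<le> (norm (z - y))\<^sup>2" by simp
    then show "dist z ?x \<le> dist z y" unfolding dist_norm by (rule power2_le_imp_le) simp
  qed
qed

lemma orth_proj_span_frame:
  fixes A :: "real^'n^'d"
  assumes "A \<in> orthonormal_frames"
  shows "orth_proj (span (range (($) A))) = frame_proj A"
  by (simp add: orth_proj_def matrix_def closest_point_span_frame[OF assms] frame_proj_def inner_axis vec_eq_iff)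

text \<open>An orthonormal basis of the subspace, enumerated by \<open>'d\<close>, is the frame.
  This presents the Grassmannian as a continuous image of a compact set and makes traces and norms
  of projections computable.\<close>

lemma grassmannian_eq:
  "grassmannian CARD('d) = frame_proj ` (orthonormal_frames :: (real^'n^'d::finite) set)"
proof (intro subset_antisym subsetI)
  fix P :: "real^'n^'n" assume "P \<in> grassmannian CARD('d)"
  then obtain S where S: "subspace S" "dim S = CARD('d)" "P = orth_proj S" by (auto simp: grassmannian_def)
  obtain B where B: "B \<subseteq> S" "pairwise orthogonal B" "\<And>x. x \<in> B \<Longrightarrow> norm x = 1"
     "independent B" "card B = dim S" "span B = S"
    using orthonormal_basis_subspace[OF S(1)] by metis
  have "finite B" using B(4) independent_imp_finite by blast
  then obtain h where h: "bij_betw h (UNIV :: 'd set) B"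
    using B(5) S(2) finite_same_card_bij[of "UNIV :: 'd set" B] by auto
  define A :: "real^'n^'d" where "A = (\<chi> i. h i)"
  have hB: "h i \<in> B" for i using h by (auto simp: bij_betw_def)
  have "A \<in> orthonormal_frames"
    unfolding orthonormal_frames_def
  proof (intro CollectI allI)
    fix i j
    show "A $ i \<bullet> A $ j = (if i = j then 1 else 0)"
    proof (cases "i = j")
      case True
      then show ?thesis using B(3)[OF hB] by (simp add: A_def norm_eq_1)
    next
      case False
      then have "h i \<noteq> h j" using h by (auto simp: bij_betw_def inj_on_def)
      then show ?thesis using False B(2) hB by (auto simp: pairwise_def orthogonal_def A_def)
    qed
  qed
  moreover have "range (($) A) = B" using h by (auto simp: A_def bij_betw_def)
  ultimately show "P \<in> frame_proj ` (orthonormal_frames :: (real^'n^'d) set)"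
    using orth_proj_span_frame[of A] S B by auto
next
  fix P :: "real^'n^'n" assume "P \<in> frame_proj ` (orthonormal_frames :: (real^'n^'d) set)"
  then obtain A :: "real^'n^'d" where A: "A \<in> orthonormal_frames" "P = frame_proj A" by auto
  have on: "A $ i \<bullet> A $ j = (if i = j then 1 else 0)" for i j using A by (simp add: orthonormal_frames_def)
  have inj: "inj (($) A)"
  proof (rule injI)
    fix i j assume "A $ i = A $ j"
    then have "A $ i \<bullet> A $ j = 1" using on[of i i] by simp
    then show "i = j" using on[of i j] by (auto split: if_splits)
  qed
  have "independent (range (($) A))"
  proof (rule pairwise_orthogonal_independent)
    show "pairwise orthogonal (range (($) A))" by (auto simp: pairwise_def orthogonal_def on)
    show "0 \<notin> range (($) A)"
    proof
      assume "0 \<in> range (($) A)"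
      then obtain i where "A $ i = 0" by (metis rangeE)
      then show False using on[of i i] by simp
    qed
  qed
  then have "dim (span (range (($) A))) = CARD('d)"
    using inj by (simp add: dim_eq_card_independent card_image)
  then show "P \<in> grassmannian CARD('d)"
    using A orth_proj_span_frame[OF A(1)] unfolding grassmannian_def
    by (intro image_eqI[of _ _ "span (range (($) A))"]) auto
qed

text \<open>Makes \<open>V\<close> finite on cylinders C \<times> G with C compact, so that support
  conditions on integrands concern the space variable only.\<close>

lemma compact_grassmannian: "compact (grassmannian CARD('d::finite) :: (real^'n^'n) set)"
  unfolding grassmannian_eq
proof (rule compact_continuous_image)
  show "continuous_on orthonormal_frames (frame_proj :: real^'n^'d \<Rightarrow> _)"
    unfolding frame_proj_def[abs_def] by (intro continuous_intros)
  have "closed (orthonormal_frames :: (real^'n^'d) set)"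
    unfolding orthonormal_frames_def
    by (intro closed_Collect_all closed_Collect_eq continuous_intros)
  moreover have "bounded (orthonormal_frames :: (real^'n^'d) set)"
    unfolding bounded_iff
  proof (intro exI ballI)
    fix A :: "real^'n^'d" assume A: "A \<in> orthonormal_frames"
    then have "norm (A $ i) = 1" for i by (simp add: orthonormal_frames_def norm_eq_1)
    then show "norm A \<le> real CARD('d)"
      using L2_set_le_sum[of UNIV "\<lambda>i. norm (A $ i)"] by (simp add: norm_vec_def)
  qed
  ultimately show "compact (orthonormal_frames :: (real^'n^'d) set)" by (simp add: compact_eq_bounded_closed)
qed

text \<open>Trace and quadratic form are what the divergence of a radial field sees. The
  inequalities follow from |Pz|^2 = <Pz, z> and Cauchy-Schwarz.\<close>

lemma grassmannianD:
  fixes P :: "real^'n^'n"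
  assumes P: "P \<in> grassmannian CARD('d::finite)"
  shows "(\<Sum>k\<in>UNIV. P $ k $ k) = real CARD('d)"
    and "(P *v z) \<bullet> z \<le> (norm z)\<^sup>2"
    and "norm (P *v z) \<le> norm z"
proof -
  obtain A :: "real^'n^'d" where A: "A \<in> orthonormal_frames" "P = frame_proj A"
    using P unfolding grassmannian_eq by auto
  have on: "A $ i \<bullet> A $ j = (if i = j then 1 else 0)" for i j using A by (simp add: orthonormal_frames_def)
  have "(\<Sum>k\<in>UNIV. P $ k $ k) = (\<Sum>i\<in>UNIV. A $ i \<bullet> A $ i)"
    unfolding A(2) frame_proj_def inner_vec_def by (simp add: sum.swap[of _ "UNIV :: 'n set"])
  then show "(\<Sum>k\<in>UNIV. P $ k $ k) = real CARD('d)" by (simp add: on)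
  let ?w = "P *v z"
  have "?w \<bullet> ?w = (\<Sum>i\<in>UNIV. (A $ i \<bullet> z) * (\<Sum>j\<in>UNIV. (A $ j \<bullet> z) * (if j = i then 1 else 0)))"
    unfolding A(2) frame_proj_mult inner_sum_left inner_scaleR_left inner_sum_right inner_scaleR_right on ..
  also have "\<dots> = ?w \<bullet> z"
    unfolding A(2) frame_proj_mult by (simp add: inner_sum_left if_distrib cong: if_cong)
  finally have w: "(norm ?w)\<^sup>2 = ?w \<bullet> z" by (simp add: power2_norm_eq_inner)
  then have "norm ?w * norm ?w \<le> norm ?w * norm z"
    using norm_cauchy_schwarz[of ?w z] by (simp add: power2_eq_square)
  then show le: "norm ?w \<le> norm z"
    using norm_ge_zero[of z] by (cases "norm ?w = 0") (auto simp: mult_le_cancel_left)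
  then show "?w \<bullet> z \<le> (norm z)\<^sup>2" unfolding w[symmetric] by (intro power_mono) auto
qed

section \<open>Hausdorff measure and positivity of the density\<close>

lemma hausdorff_pre_empty:
  assumes "d \<ge> 1" "\<delta> > 0"
  shows "hausdorff_pre d \<delta> {} = 0"
proof -
  have "hausdorff_pre d \<delta> {} \<le> (\<Sum>i. ennreal (unit_ball_vol (real d) * (diameter ({} :: 'a set) / 2) ^ d))"
    unfolding hausdorff_pre_def by (rule INF_lower2[where i="\<lambda>_. {}"]) (use assms in auto)
  also have "\<dots> = 0" using assms by (simp add: zero_power)
  finally show ?thesis by simp
qed

lemma hausdorff_pre_mono: "A \<subseteq> B \<Longrightarrow> hausdorff_pre d \<delta> A \<le> hausdorff_pre d \<delta> B"
  unfolding hausdorff_pre_def by (rule INF_superset_mono) auto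

lemma hausdorff_pre_le_outer: "\<delta> > 0 \<Longrightarrow> hausdorff_pre d \<delta> A \<le> hausdorff_outer d A"
  unfolding hausdorff_outer_def by (rule SUP_upper) auto

lemma hausdorff_pre_lessE:
  assumes "hausdorff_pre d \<delta> A < u"
  obtains C :: "nat \<Rightarrow> 'a::metric_space set" where "A \<subseteq> (\<Union>i. C i)" "\<And>i. bounded (C i)" "\<And>i. diameter (C i) \<le> \<delta>"
    "(\<Sum>i. ennreal (unit_ball_vol (real d) * (diameter (C i) / 2) ^ d)) < u"
  using assms unfolding hausdorff_pre_def INF_less_iff by auto

lemma hausdorff_outer_countably_subadditive:
  "hausdorff_outer d (\<Union>i. A i) \<le> (\<Sum>i. hausdorff_outer d (A i :: 'a::metric_space set))"
proof (cases "(\<Sum>i. hausdorff_outer d (A i)) < top")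
  case True
  let ?w = "\<lambda>C :: 'a set. ennreal (unit_ball_vol (real d) * (diameter C / 2) ^ d)"
  show ?thesis
    unfolding hausdorff_outer_def[of d "\<Union>i. A i"]
  proof (rule SUP_least)
    fix \<delta> :: real assume "\<delta> \<in> {0<..}"
    then have \<delta>: "\<delta> > 0" by simp
    show "hausdorff_pre d \<delta> (\<Union>i. A i) \<le> (\<Sum>i. hausdorff_outer d (A i))"
    proof (rule ennreal_le_epsilon)
      fix e :: real assume e: "0 < e"
      have "\<exists>C. A n \<subseteq> (\<Union>i. C i) \<and> (\<forall>i. bounded (C i) \<and> diameter (C i) \<le> \<delta>) \<and>
          (\<Sum>i. ?w (C i)) \<le> hausdorff_outer d (A n) + e * (1/2)^Suc n" for n
      proof -
        have "hausdorff_outer d (A n) < top" using True by (auto simp: less_top dest!: ennreal_suminf_lessD)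
        then have "hausdorff_outer d (A n) < hausdorff_outer d (A n) + e * (1/2)^Suc n" using e by auto
        then have "hausdorff_pre d \<delta> (A n) < hausdorff_outer d (A n) + e * (1/2)^Suc n"
          using hausdorff_pre_le_outer[OF \<delta>] by (rule le_less_trans[rotated])
        then show ?thesis by (elim hausdorff_pre_lessE) (meson less_imp_le)
      qed
      then obtain B where B: "\<And>n. A n \<subseteq> (\<Union>i. B n i)" "\<And>n i. bounded (B n i)" "\<And>n i. diameter (B n i) \<le> \<delta>"
          "\<And>n. (\<Sum>i. ?w (B n i)) \<le> hausdorff_outer d (A n) + e * (1/2)^Suc n"
        by metis
      define C where "C n = (case prod_decode n of (i, j) \<Rightarrow> B i j)" for n
      have "(\<Union>i. A i) \<subseteq> (\<Union>i. C i)"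
      proof
        fix x assume "x \<in> (\<Union>i. A i)"
        then obtain i j where "x \<in> B i j" using B(1) by blast
        then have "x \<in> C (prod_encode (i, j))" by (simp add: C_def)
        then show "x \<in> (\<Union>i. C i)" by blast
      qed
      then have "hausdorff_pre d \<delta> (\<Union>i. A i) \<le> (\<Sum>i. ?w (C i))"
        unfolding hausdorff_pre_def using B(2,3) by (intro INF_lower) (auto simp: C_def split: prod.split)
      also have "\<dots> = (\<Sum>i. (case_prod (\<lambda>i j. ?w (B i j))) (prod_decode i))"
        by (intro suminf_cong) (auto simp: C_def split: prod.split)
      also have "\<dots> = (\<Sum>n. \<Sum>i. ?w (B n i))"
        by (intro suminf_ennreal_2dimen) auto
      also have "\<dots> \<le> (\<Sum>n. hausdorff_outer d (A n) + e * (1/2) ^ Suc n)"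
        by (intro suminf_le allI B(4)) auto
      also have "\<dots> = (\<Sum>n. hausdorff_outer d (A n)) + (\<Sum>n. ennreal e * ennreal ((1/2) ^ Suc n))"
        using \<open>0 < e\<close> by (subst suminf_add[symmetric])
          (auto simp del: ennreal_suminf_cmult simp add: ennreal_mult[symmetric])
      also have "\<dots> = (\<Sum>n. hausdorff_outer d (A n)) + e"
        unfolding ennreal_suminf_cmult
        by (subst suminf_ennreal_eq[OF zero_le_power power_half_series]) auto
      finally show "hausdorff_pre d \<delta> (\<Union>i. A i) \<le> (\<Sum>n. hausdorff_outer d (A n)) + e" .
    qed
  qed
qed (simp add: not_less top_unique)

lemma outer_measure_space_hausdorff:
  assumes "d \<ge> 1"
  shows "outer_measure_space UNIV (hausdorff_outer d :: 'a::metric_space set \<Rightarrow> ennreal)"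
proof -
  have "hausdorff_outer d ({} :: 'a set) = 0"
    unfolding hausdorff_outer_def using assms by (auto simp: hausdorff_pre_empty cong: SUP_cong_simp)
  moreover have "increasing UNIV (hausdorff_outer d :: 'a set \<Rightarrow> ennreal)"
    unfolding increasing_def hausdorff_outer_def by (intro ballI impI SUP_subset_mono hausdorff_pre_mono subset_refl)
  ultimately show ?thesis
    using hausdorff_outer_countably_subadditive
    by (auto simp: outer_measure_space_def positive_def countably_subadditive_def)
qed

text \<open>\<open>measure_of\<close> falls back to the value 0 when its data do not form a measure
  space; Caratheodory's theorem certifies that they do.\<close>

lemma emeasure_hausdorff_measure:
  assumes d: "d \<ge> 1" and A: "A \<in> sets (hausdorff_measure d :: 'a::metric_space measure)"
  shows "emeasure (hausdorff_measure d) A = hausdorff_outer d A"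
proof -
  let ?L = "lambda_system UNIV UNIV (hausdorff_outer d :: 'a set \<Rightarrow> ennreal)"
  have "sigma_algebra UNIV (UNIV :: 'a set set)" using sigma_algebra_Pow[of "UNIV :: 'a set"] by simp
  from sigma_algebra.caratheodory_lemma[OF this outer_measure_space_hausdorff[OF d]]
  have L: "sigma_algebra UNIV ?L" "positive ?L (hausdorff_outer d)" "countably_additive ?L (hausdorff_outer d)"
    unfolding measure_space_def by blast+
  have sets: "sets (hausdorff_measure d :: 'a measure) = ?L"
    unfolding hausdorff_measure_def using L(1) by (rule sigma_algebra.sets_measure_of_eq)
  show ?thesis
    using emeasure_measure_of_sigma[OF L A[unfolded sets]] unfolding hausdorff_measure_def .
qed

text \<open>The factor 2^d / \<omega>_d undoes the normalization of the covering weights, and the 1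
  added to h is the slack that turns an infimum into an actual cover.\<close>

lemma hausdorff_cover:
  fixes E :: "'a::metric_space set"
  assumes d: "d \<ge> 1" and E: "E \<in> sets (hausdorff_measure d)" "emeasure (hausdorff_measure d) E \<le> ennreal h"
    and h: "h \<ge> 0" and \<delta>: "\<delta> > 0"
  obtains C :: "nat \<Rightarrow> 'a set" where "E \<subseteq> (\<Union>i. C i)" "\<And>i. bounded (C i)" "\<And>i. diameter (C i) \<le> \<delta>"
    "(\<Sum>i. ennreal (diameter (C i) ^ d)) \<le> ennreal (2 ^ d / unit_ball_vol (real d) * (h + 1))"
proof -
  have "hausdorff_pre d \<delta> E \<le> ennreal h"
    using hausdorff_pre_le_outer[OF \<delta>, of d E] E emeasure_hausdorff_measure[OF d E(1)] by simp
  also have "\<dots> < ennreal (h + 1)" using h by (simp add: ennreal_less_iff)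
  finally obtain C where C: "E \<subseteq> (\<Union>i. C i)" "\<And>i. bounded (C i)" "\<And>i. diameter (C i) \<le> \<delta>"
      "(\<Sum>i. ennreal (unit_ball_vol (real d) * (diameter (C i) / 2) ^ d)) < ennreal (h + 1)"
    by (elim hausdorff_pre_lessE) metis
  have w: "unit_ball_vol (real d) > 0" by simp
  then have w0: "unit_ball_vol (real d) \<noteq> 0" by linarith
  have "(\<Sum>i. ennreal (diameter (C i) ^ d))
      = (\<Sum>i. ennreal (2 ^ d / unit_ball_vol (real d)) * ennreal (unit_ball_vol (real d) * (diameter (C i) / 2) ^ d))"
    using w diameter_ge_0[OF C(2)] by (intro suminf_cong) (simp add: w0 power_divide flip: ennreal_mult)
  also have "\<dots> = ennreal (2 ^ d / unit_ball_vol (real d)) * (\<Sum>i. ennreal (unit_ball_vol (real d) * (diameter (C i) / 2) ^ d))"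
    by (rule ennreal_suminf_cmult)
  also have "\<dots> \<le> ennreal (2 ^ d / unit_ball_vol (real d)) * ennreal (h + 1)"
    using C(4) by (intro mult_left_mono) auto
  also have "\<dots> = ennreal (2 ^ d / unit_ball_vol (real d) * (h + 1))"
    by (rule ennreal_mult[symmetric]) (use w h in auto)
  finally show ?thesis by (rule that[OF C(1-3)])
qed

text \<open>By the Lindelof property countably many such balls cover \<Omega>, so almost everywhere
  statements may be proved on one ball at a time.\<close>

lemma AE_of_AE_balls:
  fixes \<Omega> :: "'a::euclidean_space set"
  assumes "open \<Omega>" and "space M = \<Omega>"
    and "\<And>a R. R > 0 \<Longrightarrow> cball a R \<subseteq> \<Omega> \<Longrightarrow> AE x in M. x \<in> ball a R \<longrightarrow> P x"
  shows "AE x in M. P x"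
proof -
  define \<F> where "\<F> = {ball a R |a R. R > 0 \<and> cball a R \<subseteq> \<Omega>}"
  obtain \<F>' where \<F>': "\<F>' \<subseteq> \<F>" "countable \<F>'" "\<Union>\<F>' = \<Union>\<F>"
    using Lindelof[of \<F>] by (auto simp: \<F>_def)
  have ae: "AE x in M. \<forall>S\<in>\<F>'. x \<in> S \<longrightarrow> P x"
    using \<F>' assms(3) by (intro AE_ball_countable[THEN iffD2]) (auto simp: \<F>_def)
  have cover: "\<Omega> \<subseteq> \<Union>\<F>'"
  proof
    fix x assume "x \<in> \<Omega>"
    then obtain R where "R > 0" "cball x R \<subseteq> \<Omega>" using assms(1) open_contains_cball by blast
    then have "ball x R \<in> \<F>" by (auto simp: \<F>_def)
    moreover have "x \<in> ball x R" using \<open>R > 0\<close> by simp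
    ultimately show "x \<in> \<Union>\<F>'" unfolding \<F>'(3) by blast
  qed
  show ?thesis
  proof (rule AE_mp[OF ae], intro AE_I2 impI)
    fix x assume "x \<in> space M" "\<forall>S\<in>\<F>'. x \<in> S \<longrightarrow> P x"
    then show "P x" using cover unfolding assms(2) by blast
  qed
qed

section \<open>The set of vanishing density\<close>

lemma borel_subset_in_sets:
  assumes "open \<Omega>" "sets \<mu> = sets (restrict_space borel \<Omega>)" "A \<in> sets borel" "A \<subseteq> \<Omega>"
  shows "A \<in> sets \<mu>"
  unfolding assms(2) using assms(1,3,4) by (auto simp: sets_restrict_space image_iff intro!: bexI[of _ A])

context
  fixes \<Omega> :: "'a::euclidean_space set" and \<mu> :: "'a measure" and g :: "'a \<Rightarrow> real" and d :: nat
  assumes open_\<Omega>: "open \<Omega>" and sets_\<mu>: "sets \<mu> = sets (restrict_space borel \<Omega>)"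
    and fin_\<mu>: "\<And>K. compact K \<Longrightarrow> K \<subseteq> \<Omega> \<Longrightarrow> emeasure \<mu> K < \<infinity>"
    and d: "d \<ge> 1"
    and int_g: "\<And>K. compact K \<Longrightarrow> K \<subseteq> \<Omega> \<Longrightarrow> integrable (hausdorff_measure d) (\<lambda>x. indicator K x * g x)"
    and g_nonneg: "AE x in hausdorff_measure d. g x \<ge> 0"
    and dom: "\<And>B. compact B \<Longrightarrow> B \<subseteq> \<Omega> \<Longrightarrow>
      emeasure \<mu> B \<le> ennreal (LINT x|hausdorff_measure d. indicator B x * g x)"
begin


lemma AE_indicator_mult_nonneg: "AE x in hausdorff_measure d. 0 \<le> indicator B x * g x"
  using g_nonneg by eventually_elim (rule mult_nonneg_nonneg, auto)

text \<open>Where \<open>g > 1/k\<close> the set \<open>A\<close> has finite Hausdorff measure, hence an efficient cover by small balls on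
  which \<open>\<mu>\<close> is at most \<open>t r\<^sup>d\<close>; on the compact rest \<open>\<mu>\<close> is bounded by the integral of \<open>g\<close> over \<open>g \<le> 1/k\<close>.\<close>

lemma small_density_set_bound:
  assumes K: "compact K" "K \<subseteq> \<Omega>" and \<delta>: "\<delta> > 0" "\<And>x. x \<in> K \<Longrightarrow> cball x \<delta> \<subseteq> \<Omega>" and t: "t \<ge> 0" and k: "k > 0"
    and A: "compact A" "A \<subseteq> K" "\<And>x r. x \<in> A \<Longrightarrow> 0 < r \<Longrightarrow> r < \<delta> \<Longrightarrow> measure \<mu> (cball x r) \<le> t * r ^ d"
  shows "emeasure \<mu> A \<le> ennreal (t * (2 ^ d / unit_ball_vol (real d) *
      (k * (LINT x|hausdorff_measure d. indicator K x * g x) + 1) + 1)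
      + (LINT x|hausdorff_measure d. indicator {x. g x \<le> 1 / k} x * (indicator K x * g x)))"
proof -
  let ?H = "hausdorff_measure d :: 'a measure"
  define c where "c = (LINT x|?H. indicator K x * g x)"
  have c0: "c \<ge> 0" unfolding c_def by (rule integral_nonneg_AE[OF AE_indicator_mult_nonneg])
  define f where "f x = indicator A x * g x" for x
  have intA: "integrable ?H f" unfolding f_def by (rule int_g[OF A(1) order_trans[OF A(2) K(2)]])
  have [measurable]: "f \<in> borel_measurable ?H" using intA by (rule borel_measurable_integrable)
  \<comment> \<open>Cut out through \<open>f\<close>, whose measurability for the Hausdorff measure
    is part of its integrability; Markov's inequality then bounds the measure of \<open>E\<close> by
    k c.\<close>
  define E where "E = {x \<in> space ?H. f x > 1 / k}"
  have E: "E \<in> sets ?H" unfolding E_def by measurable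
  have fE: "x \<in> E \<longleftrightarrow> f x > 1 / k" for x
    unfolding E_def hausdorff_measure_def by (simp add: space_measure_of_conv)
  have "emeasure ?H E \<le> emeasure ?H {x \<in> space ?H. 1 \<le> ennreal k * ennreal (f x)}"
  proof (rule emeasure_mono)
    show "E \<subseteq> {x \<in> space ?H. 1 \<le> ennreal k * ennreal (f x)}"
    proof
      fix x assume x: "x \<in> E"
      then have lt: "1 / k < f x" using fE by blast
      have f0: "f x \<ge> 0" using k lt by (intro less_imp_le[OF less_trans[OF _ lt]]) simp
      have "1 \<le> k * f x" using lt unfolding pos_divide_less_eq[OF k] by (simp add: mult.commute)
      then have "ennreal 1 \<le> ennreal (k * f x)" by (rule ennreal_leI)
      also have "\<dots> = ennreal k * ennreal (f x)" using k f0 by (intro ennreal_mult) auto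
      finally show "x \<in> {x \<in> space ?H. 1 \<le> ennreal k * ennreal (f x)}"
        using x unfolding E_def by simp
    qed
    show "{x \<in> space ?H. 1 \<le> ennreal k * ennreal (f x)} \<in> sets ?H" by measurable
  qed
  also have "\<dots> \<le> ennreal k * (\<integral>\<^sup>+x. ennreal (f x) * indicator (space ?H) x \<partial>?H)"
    by (rule nn_integral_Markov_inequality) measurable
  also have "(\<integral>\<^sup>+x. ennreal (f x) * indicator (space ?H) x \<partial>?H) = (\<integral>\<^sup>+x. ennreal (f x) \<partial>?H)"
    by (intro nn_integral_cong) auto
  also have "\<dots> = ennreal (LINT x|?H. f x)"
    by (rule nn_integral_eq_integral[OF intA]) (use AE_indicator_mult_nonneg in \<open>simp add: f_def\<close>)
  also have "ennreal k * \<dots> \<le> ennreal k * ennreal c"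
  proof (intro mult_left_mono ennreal_leI)
    show "(LINT x|?H. f x) \<le> c"
      unfolding c_def
    proof (rule integral_mono_AE[OF intA int_g[OF K]])
      show "AE x in ?H. f x \<le> indicator K x * g x"
        using g_nonneg
      proof eventually_elim
        case (elim x)
        have "indicator A x \<le> (indicator K x :: real)" using A(2) by (simp add: indicator_def subset_iff)
        then show ?case unfolding f_def using elim by (rule mult_right_mono)
      qed
    qed
  qed simp
  also have "\<dots> = ennreal (k * c)" using k c0 by (simp add: ennreal_mult)
  finally have EH: "emeasure ?H E \<le> ennreal (k * c)" .
  have kc: "k * c \<ge> 0" using k c0 by simp
  obtain C :: "nat \<Rightarrow> 'a set" where C: "E \<subseteq> (\<Union>i. C i)" "\<And>i. bounded (C i)" "\<And>i. diameter (C i) \<le> \<delta> / 2"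
     "(\<Sum>i. ennreal (diameter (C i) ^ d)) \<le> ennreal (2 ^ d / unit_ball_vol (real d) * (k * c + 1))"
    using hausdorff_cover[OF d E EH kc half_gt_zero[OF \<delta>(1)]] by blast
  have D0: "diameter (C i) \<ge> 0" for i using diameter_ge_0[OF C(2)] .
  let ?D = "\<lambda>i. diameter (C i)"
  \<comment> \<open>A radius strictly above the diameter lets an open ball about any point of
    \<open>C i\<close> contain \<open>C i\<close>, even when the diameter is 0. The total excess of
    the r^d is at most 1, which is the last summand 1 in the factor of t.\<close>
  have "\<exists>r. ?D i < r \<and> r < \<delta> \<and> r ^ d < ?D i ^ d + (1/2) ^ Suc i" for i
  proof -
    have "((\<lambda>r. r ^ d) \<longlongrightarrow> ?D i ^ d) (at_right (?D i))" by (intro tendsto_intros)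
    then have "\<forall>\<^sub>F r in at_right (?D i). r ^ d < ?D i ^ d + (1/2) ^ Suc i"
      by (rule order_tendstoD) auto
    then obtain b where b: "b > ?D i"
        "\<And>r. ?D i < r \<Longrightarrow> r < b \<Longrightarrow> r ^ d < ?D i ^ d + (1/2) ^ Suc i"
      unfolding eventually_at_right_field by blast
    have "?D i < min b \<delta>" using b(1) C(3)[of i] \<delta>(1) by simp
    then obtain r where "?D i < r" "r < min b \<delta>" using dense by blast
    then show ?thesis using b(2)[of r] by auto
  qed
  then obtain r where r: "\<And>i. ?D i < r i" "\<And>i. r i < \<delta>" "\<And>i. r i ^ d < ?D i ^ d + (1/2) ^ Suc i"
    by metis
  \<comment> \<open>Centres are taken in \<open>A\<close>, because the bound t r^d is available only
    there; pieces of the cover that miss \<open>A\<close> are dropped.\<close>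
  define p where "p i = (SOME x. x \<in> C i \<inter> A)" for i
  have p: "p i \<in> C i \<inter> A" if "C i \<inter> A \<noteq> {}" for i
    using that some_in_eq[of "C i \<inter> A"] by (simp add: p_def)
  define U where "U i = (if C i \<inter> A = {} then {} else ball (p i) (r i))" for i
  let ?U = "\<Union>i. U i"
  have r0: "r i > 0" for i using r(1)[of i] D0[of i] by linarith
  have sub: "cball (p i) (r i) \<subseteq> \<Omega>" if "C i \<inter> A \<noteq> {}" for i
  proof -
    have "p i \<in> K" using p[OF that] A(2) by auto
    moreover have "cball (p i) (r i) \<subseteq> cball (p i) \<delta>" using r(2)[of i] by (intro subset_cball) simp
    ultimately show ?thesis using \<delta>(2) by blast
  qed
  have U\<Omega>: "U i \<subseteq> \<Omega>" for i
    using order_trans[OF ball_subset_cball sub] by (simp add: U_def)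
  have Uo: "open (U i)" for i by (simp add: U_def)
  have Us: "U i \<in> sets \<mu>" for i using Uo U\<Omega> by (intro borel_subset_in_sets[OF open_\<Omega> sets_\<mu>]) auto
  have \<mu>U: "emeasure \<mu> (U i) \<le> ennreal t * (ennreal (?D i ^ d) + ennreal ((1/2) ^ Suc i))" for i
  proof (cases "C i \<inter> A = {}")
    case False
    have pA: "p i \<in> A" using p False by auto
    note sub = sub[OF False]
    have "emeasure \<mu> (U i) \<le> emeasure \<mu> (cball (p i) (r i))"
      using False sub by (intro emeasure_mono borel_subset_in_sets[OF open_\<Omega> sets_\<mu>]) (auto simp: U_def)
    also have "\<dots> = ennreal (measure \<mu> (cball (p i) (r i)))"
      using fin_\<mu>[OF _ sub] by (intro emeasure_eq_ennreal_measure) auto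
    also have "\<dots> \<le> ennreal (t * r i ^ d)"
      using A(3)[OF pA r0 r(2)] by (rule ennreal_leI)
    also have "\<dots> \<le> ennreal (t * (?D i ^ d + (1/2) ^ Suc i))"
      using t r(3)[of i] by (intro ennreal_leI mult_left_mono) auto
    also have "\<dots> = ennreal t * (ennreal (?D i ^ d) + ennreal ((1/2) ^ Suc i))"
      using t D0 by (subst ennreal_mult) (auto simp: ennreal_plus)
    finally show ?thesis .
  qed (simp add: U_def)
  define Q where "Q = 2 ^ d / unit_ball_vol (real d) * (k * c + 1)"
  have Q0: "Q \<ge> 0" unfolding Q_def using k c0 by (intro mult_nonneg_nonneg divide_nonneg_pos) auto
  have "emeasure \<mu> ?U \<le> (\<Sum>i. emeasure \<mu> (U i))"
    using Us by (intro emeasure_subadditive_countably) auto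
  also have "\<dots> \<le> (\<Sum>i. ennreal t * (ennreal (?D i ^ d) + ennreal ((1/2) ^ Suc i)))"
    by (intro suminf_le \<mu>U) auto
  also have "\<dots> = ennreal t * ((\<Sum>i. ennreal (?D i ^ d)) + (\<Sum>i. ennreal ((1/2) ^ Suc i)))"
    by (simp add: suminf_add)
  also have "(\<Sum>i. ennreal ((1/2) ^ Suc i)) = 1"
    by (subst suminf_ennreal_eq[OF zero_le_power power_half_series]) auto
  also have "ennreal t * ((\<Sum>i. ennreal (?D i ^ d)) + 1) \<le> ennreal t * (ennreal Q + 1)"
    using C(4) unfolding Q_def by (intro mult_left_mono add_right_mono) auto
  also have "\<dots> = ennreal (t * (Q + 1))" using t Q0 by (simp add: ennreal_mult ennreal_plus)
  finally have \<mu>UU: "emeasure \<mu> ?U \<le> ennreal (t * (Q + 1))" .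
  \<comment> \<open>Openness of \<open>?U\<close> keeps the remainder compact, which is the class of
    sets to which \<open>dom\<close> applies.\<close>
  have "open ?U" using Uo by blast
  then have B: "compact (A - ?U)" "A - ?U \<subseteq> \<Omega>"
    using A(1,2) K(2) by (auto simp: compact_diff)
  let ?\<eta> = "LINT x|?H. indicator {x. g x \<le> 1 / k} x * (indicator K x * g x)"
  have intK: "integrable ?H (\<lambda>x. indicator K x * g x)" using K by (rule int_g)
  have small: "g x \<le> 1 / k" if "x \<in> A - ?U" for x
  proof (rule ccontr)
    assume "\<not> g x \<le> 1 / k"
    then have "x \<in> E" using that by (auto simp: fE f_def)
    then obtain i where i: "x \<in> C i" using C(1) by auto
    then have ne: "C i \<inter> A \<noteq> {}" using that by auto
    have "dist (p i) x \<le> ?D i"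
      using p[OF ne] i C(2) by (intro diameter_bounded_bound) auto
    then have "x \<in> U i" using ne r(1)[of i] by (auto simp: U_def)
    then show False using that by auto
  qed
  have "emeasure \<mu> (A - ?U) \<le> ennreal (LINT x|?H. indicator (A - ?U) x * g x)"
    by (rule dom[OF B])
  also have "\<dots> \<le> ennreal ?\<eta>"
  proof (intro ennreal_leI integral_mono_AE)
    show "integrable ?H (\<lambda>x. indicator (A - ?U) x * g x)" by (rule int_g[OF B])
    define q where "q x = indicator K x * g x" for x
    have [measurable]: "q \<in> borel_measurable ?H" using intK unfolding q_def by (rule borel_measurable_integrable)
    have "indicator {x. g x \<le> 1 / k} x * (indicator K x * g x) = indicator {..1/k} (q x) * q x" for x
      by (cases "x \<in> K") (auto simp: q_def split: split_indicator)
    moreover have "integrable ?H (\<lambda>x. indicator {..1/k} (q x) * q x)"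
    proof (rule Bochner_Integration.integrable_bound)
      show "integrable ?H q" using intK unfolding q_def .
      show "(\<lambda>x. indicator {..1/k} (q x) * q x) \<in> borel_measurable ?H" by measurable
    qed (simp split: split_indicator)
    ultimately show "integrable ?H (\<lambda>x. indicator {x. g x \<le> 1 / k} x * (indicator K x * g x))" by simp
    show "AE x in ?H. indicator (A - ?U) x * g x \<le> indicator {x. g x \<le> 1 / k} x * (indicator K x * g x)"
      using g_nonneg
    proof eventually_elim
      case (elim x)
      show ?case
      proof (cases "x \<in> A - ?U")
        case True
        have "x \<in> K" using DiffD1[OF True] A(2) by (rule subsetD[rotated])
        then have 1: "indicator K x = (1::real)" by simp
        have 2: "indicator {x. g x \<le> 1 / k} x = (1::real)" using small[OF True] by simp
        show ?thesis unfolding indicator_simps(1)[OF True] 1 2 by simp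
      next
        case False
        have "0 \<le> indicator {x. g x \<le> 1 / k} x * (indicator K x * g x)"
          using elim by (intro mult_nonneg_nonneg) auto
        then show ?thesis unfolding indicator_simps(2)[OF False] mult_zero_left .
      qed
    qed
  qed
  finally have \<mu>B: "emeasure \<mu> (A - ?U) \<le> ennreal ?\<eta>" .
  have S1: "?U \<in> sets \<mu>" using Us by blast
  have S2: "A - ?U \<in> sets \<mu>"
    using B(2) borel_closed[OF compact_imp_closed[OF B(1)]] by (intro borel_subset_in_sets[OF open_\<Omega> sets_\<mu>])
  have \<eta>0: "?\<eta> \<ge> 0"
    by (rule integral_nonneg_AE, rule AE_mp[OF AE_indicator_mult_nonneg[of K]]) (auto intro!: AE_I2 mult_nonneg_nonneg)
  have "emeasure \<mu> A \<le> emeasure \<mu> (?U \<union> (A - ?U))"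
    by (rule emeasure_mono[OF _ sets.Un[OF S1 S2]]) blast
  also have "\<dots> \<le> emeasure \<mu> ?U + emeasure \<mu> (A - ?U)"
    by (rule emeasure_subadditive[OF S1 S2])
  also have "\<dots> \<le> ennreal (t * (Q + 1)) + ennreal ?\<eta>" by (rule add_mono[OF \<mu>UU \<mu>B])
  also have "\<dots> = ennreal (t * (Q + 1) + ?\<eta>)"
    using t Q0 \<eta>0 by (intro ennreal_plus[symmetric]) auto
  finally show ?thesis by (simp add: Q_def c_def)
qed

end

text \<open>On a closed ball, the points of density 0 lie for every t > 0 in a union of sets on
  which balls have mass at most t r^d at small scales. Their measure is at most t \<open>Q k\<close>
  + \<open>\<eta> k\<close>. As \<open>Q k\<close> depends on k, first t tends to 0 with k fixed,
  then k tends to infinity.\<close>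

lemma AE_density_not_zero:
  fixes \<Omega> :: "'a::euclidean_space set" and \<mu> :: "'a measure" and g :: "'a \<Rightarrow> real" and d :: nat
  assumes open_\<Omega>: "open \<Omega>" and sets_\<mu>: "sets \<mu> = sets (restrict_space borel \<Omega>)"
    and fin_\<mu>: "\<And>K. compact K \<Longrightarrow> K \<subseteq> \<Omega> \<Longrightarrow> emeasure \<mu> K < \<infinity>"
    and d: "d \<ge> 1"
    and int_g: "\<And>K. compact K \<Longrightarrow> K \<subseteq> \<Omega> \<Longrightarrow> integrable (hausdorff_measure d) (\<lambda>x. indicator K x * g x)"
    and g_nonneg: "AE x in hausdorff_measure d. g x \<ge> 0"
    and dom: "\<And>B. compact B \<Longrightarrow> B \<subseteq> \<Omega> \<Longrightarrow>
      emeasure \<mu> B \<le> ennreal (LINT x|hausdorff_measure d. indicator B x * g x)"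
  shows "AE x in \<mu>. \<not> ((\<lambda>r. measure \<mu> (cball x r) / r ^ d) \<longlongrightarrow> 0) (at_right 0)"
proof (rule AE_of_AE_balls[OF open_\<Omega>])
  show "space \<mu> = \<Omega>" using sets_eq_imp_space_eq[OF sets_\<mu>] by (simp add: space_restrict_space)
  fix a :: 'a and R :: real
  let ?H = "hausdorff_measure d :: 'a measure" and ?m = "\<lambda>x r. measure \<mu> (cball x r)"
  assume R: "R > 0" "cball a R \<subseteq> \<Omega>"
  define K where "K = cball a R"
  have K: "compact K" "K \<subseteq> \<Omega>" using R by (auto simp: K_def)
  have bs: "A \<in> sets \<mu>" if "A \<in> sets borel" "A \<subseteq> \<Omega>" for A
    by (rule borel_subset_in_sets[OF open_\<Omega> sets_\<mu> that])
  obtain \<delta> where \<delta>: "\<delta> > 0" "(\<Union>x\<in>K. cball x \<delta>) \<subseteq> \<Omega>"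
    using compact_subset_open_imp_cball_epsilon_subset[OF K(1) open_\<Omega> K(2)] by blast
  have cb: "cball x r \<subseteq> \<Omega>" if "x \<in> K" "r \<le> \<delta>" for x r
    using \<delta>(2) that subset_cball[of r \<delta> x] by blast
  have mono: "?m x r \<le> ?m y s" if "cball x r \<subseteq> cball y s" "y \<in> K" "s \<le> \<delta>" for x y r s
  proof (rule measure_mono_fmeasurable[OF that(1)])
    show "cball x r \<in> sets \<mu>" using that(1) cb[OF that(2,3)] by (intro bs) auto
    show "cball y s \<in> fmeasurable \<mu>"
      using cb[OF that(2,3)] fin_\<mu>[of "cball y s"] by (intro fmeasurableI bs) auto
  qed
  define A where "A t e = {x \<in> K. \<forall>r. 0 < r \<longrightarrow> r < e \<longrightarrow> ?m x r \<le> t * r ^ d}" for t e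
  \<comment> \<open>Closedness is upper semicontinuity of the mass of closed balls: for s > r the
    ball of radius r about the limit lies in a ball of radius s about some \<open>X n\<close>; then
    s decreases to r.\<close>
  have compact_A: "compact (A t e)" if e: "e \<le> \<delta>" for t e
  proof -
    have "closed (A t e)"
      unfolding closed_sequential_limits
    proof (intro allI impI, elim conjE)
      fix X x assume X: "\<forall>n. X n \<in> A t e" "X \<longlonglongrightarrow> x"
      have "closed K" using K(1) by (rule compact_imp_closed)
      then have xK: "x \<in> K" using X by (auto simp: closed_sequential_limits A_def)
      have "?m x r \<le> t * r ^ d" if r: "0 < r" "r < e" for r
      proof (rule tendsto_lowerbound)
        show "((\<lambda>s. t * s ^ d) \<longlongrightarrow> t * r ^ d) (at_right r)" by (intro tendsto_intros)
        have "?m x r \<le> t * s ^ d" if s: "r < s" "s < e" for s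
        proof -
          have "\<forall>\<^sub>F n in sequentially. dist (X n) x < s - r"
            using X(2) s by (intro tendstoD) auto
          then obtain n where n: "dist (X n) x < s - r" by (auto simp: eventually_sequentially)
          have "cball x r \<subseteq> cball (X n) s"
          proof
            fix y assume "y \<in> cball x r"
            then show "y \<in> cball (X n) s" using n dist_triangle[of "X n" y x] by simp
          qed
          then have "?m x r \<le> measure \<mu> (cball (X n) s)"
            using X(1) s e by (intro mono) (auto simp: A_def)
          also have "\<dots> \<le> t * s ^ d" using X(1) s r by (auto simp: A_def)
          finally show ?thesis .
        qed
        then show "\<forall>\<^sub>F s in at_right r. ?m x r \<le> t * s ^ d"
          unfolding eventually_at_right_field using r by blast
      qed simp
      then show "x \<in> A t e" using xK by (simp add: A_def)
    qed
    moreover have "A t e = K \<inter> A t e" by (auto simp: A_def)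
    ultimately show ?thesis using K(1) by (metis compact_Int_closed)
  qed
  have AK: "A t e \<subseteq> K" for t e by (auto simp: A_def)
  have A_sets: "A t e \<in> sets \<mu>" if "e \<le> \<delta>" for t e
    using compact_A[OF that] AK K(2) by (intro bs borel_closed compact_imp_closed) blast+
  define Q where "Q k = 2 ^ d / unit_ball_vol (real d) *
      (k * (LINT x|?H. indicator K x * g x) + 1) + 1" for k
  define \<eta> where "\<eta> k = (LINT x|?H. indicator {x. g x \<le> 1 / k} x * (indicator K x * g x))" for k
  have bound: "emeasure \<mu> (A t e) \<le> ennreal (t * Q k + \<eta> k)" if "0 < e" "e \<le> \<delta>" "t \<ge> 0" "k > 0" for t e k
    unfolding Q_def \<eta>_def
  proof (rule small_density_set_bound[OF open_\<Omega> sets_\<mu> fin_\<mu> d int_g g_nonneg dom K that(1) _ that(3,4)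
        compact_A[OF that(2)] AK])
    show "cball x e \<subseteq> \<Omega>" if "x \<in> K" for x using that \<open>e \<le> \<delta>\<close> by (rule cb)
    show "?m x r \<le> t * r ^ d" if "x \<in> A t e" "0 < r" "r < e" for x r
      using that by (simp add: A_def)
  qed
  have Q0: "Q k \<ge> 0" if "k > 0" for k
  proof -
    have "(LINT x|?H. indicator K x * g x) \<ge> 0"
      by (rule integral_nonneg_AE, rule AE_mp[OF g_nonneg]) (auto intro!: AE_I2 mult_nonneg_nonneg)
    then show ?thesis unfolding Q_def using that
      by (intro add_nonneg_nonneg mult_nonneg_nonneg divide_nonneg_pos) auto
  qed
  \<comment> \<open>The scale below which the mass bound holds depends on the point, so the union
    runs over the scales \<delta> / (j + 1).\<close>
  define N where "N t = (\<Union>j. A t (\<delta> / Suc j))" for t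
  have dj: "0 < \<delta> / Suc j" "\<delta> / Suc j \<le> \<delta>" for j using \<delta>(1) by (auto simp: field_simps)
  have N_sets: "N t \<in> sets \<mu>" for t unfolding N_def using A_sets dj(2) by blast
  have N_bound: "emeasure \<mu> (N t) \<le> ennreal (t * Q k + \<eta> k)" if "t \<ge> 0" "k > 0" for t k
  proof -
    have "incseq (\<lambda>j. A t (\<delta> / Suc j))"
    proof (rule incseq_SucI, rule subsetI)
      fix j x assume x: "x \<in> A t (\<delta> / Suc j)"
      have "\<delta> / Suc (Suc j) \<le> \<delta> / Suc j" using \<delta>(1) by (intro divide_left_mono) auto
      then show "x \<in> A t (\<delta> / Suc (Suc j))" using x by (force simp: A_def)
    qed
    then have "emeasure \<mu> (N t) = (SUP j. emeasure \<mu> (A t (\<delta> / Suc j)))"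
      unfolding N_def using A_sets dj(2) by (intro SUP_emeasure_incseq[symmetric]) auto
    also have "\<dots> \<le> ennreal (t * Q k + \<eta> k)"
      by (intro SUP_least bound dj that)
    finally show ?thesis .
  qed
  define N0 where "N0 = (\<Inter>i. N (1 / Suc i))"
  have N0_sets: "N0 \<in> sets \<mu>" unfolding N0_def using N_sets by blast
  \<comment> \<open>At each point \<open>q\<close> is either 0 or eventually above 1 / (k + 1), so
    the truncated integrands tend to 0 and are dominated by |q|.\<close>
  have \<eta>_lim: "(\<lambda>k. \<eta> (Suc k)) \<longlonglongrightarrow> 0"
  proof -
    define q where "q x = indicator K x * g x" for x
    have int_q: "integrable ?H q" unfolding q_def by (rule int_g[OF K])
    have [measurable]: "q \<in> borel_measurable ?H" using int_q by (rule borel_measurable_integrable)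
    have eq: "indicator {x. g x \<le> 1 / Suc k} x * (indicator K x * g x) = indicator {..1 / Suc k} (q x) * q x" for x k
      by (cases "x \<in> K") (auto simp: q_def split: split_indicator)
    have "(\<lambda>k. LINT x|?H. indicator {..1 / Suc k} (q x) * q x) \<longlonglongrightarrow> (LINT x|?H. 0)"
    proof (rule integral_dominated_convergence[where w="\<lambda>x. norm (q x)"])
      show "AE x in ?H. (\<lambda>k. indicator {..1 / Suc k} (q x) * q x) \<longlonglongrightarrow> 0"
        using g_nonneg
      proof eventually_elim
        case (elim x)
        then have "q x \<ge> 0" unfolding q_def by (intro mult_nonneg_nonneg) auto
        show ?case
        proof (cases "q x = 0")
          case False
          with \<open>q x \<ge> 0\<close> have "q x > 0" by simp
          then obtain n where n: "1 / Suc n < q x" using reals_Archimedean by (auto simp: inverse_eq_divide)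
          have "indicator {..1 / Suc k} (q x) * q x = 0" if "k \<ge> n" for k
          proof -
            have "1 / Suc k \<le> 1 / Suc n" using that by (intro divide_left_mono) auto
            then show ?thesis using n by (simp add: indicator_def)
          qed
          then show ?thesis by (intro tendsto_eventually) (auto simp: eventually_sequentially)
        qed simp
      qed
      show "integrable ?H (\<lambda>x. norm (q x))" using int_q by (rule integrable_norm)
      show "(\<lambda>x. indicator {..1 / Suc k} (q x) * q x) \<in> borel_measurable ?H" for k by measurable
      show "AE x in ?H. norm (indicator {..1 / Suc k} (q x) * q x) \<le> norm (q x)" for k
        by (intro AE_I2) (simp split: split_indicator)
    qed simp
    then show ?thesis unfolding \<eta>_def eq by simp
  qed
  have N0_le: "emeasure \<mu> N0 \<le> ennreal (\<eta> (Suc k))" for k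
  proof -
    have "(\<lambda>i. 1 / Suc i * Q (Suc k) + \<eta> (Suc k)) \<longlonglongrightarrow> 0 * Q (Suc k) + \<eta> (Suc k)"
      using LIMSEQ_inverse_real_of_nat by (intro tendsto_intros) (simp add: inverse_eq_divide)
    then have "(\<lambda>i. ennreal (1 / Suc i * Q (Suc k) + \<eta> (Suc k))) \<longlonglongrightarrow> ennreal (0 * Q (Suc k) + \<eta> (Suc k))"
      by (rule tendsto_ennrealI)
    moreover have "emeasure \<mu> N0 \<le> ennreal (1 / Suc i * Q (Suc k) + \<eta> (Suc k))" for i
    proof -
      have "emeasure \<mu> N0 \<le> emeasure \<mu> (N (1 / Suc i))"
        unfolding N0_def using N_sets by (intro emeasure_mono) auto
      also have "\<dots> \<le> ennreal (1 / Suc i * Q (Suc k) + \<eta> (Suc k))" by (rule N_bound) auto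
      finally show ?thesis .
    qed
    ultimately have "emeasure \<mu> N0 \<le> ennreal (0 * Q (Suc k) + \<eta> (Suc k))"
      by (intro LIMSEQ_le_const) auto
    then show ?thesis by simp
  qed
  have "emeasure \<mu> N0 \<le> ennreal 0"
    using tendsto_ennrealI[OF \<eta>_lim] N0_le by (intro LIMSEQ_le_const) auto
  then have N0_null: "N0 \<in> null_sets \<mu>" using N0_sets by (simp add: null_sets_def)
  show "AE x in \<mu>. x \<in> ball a R \<longrightarrow> \<not> ((\<lambda>r. ?m x r / r ^ d) \<longlongrightarrow> 0) (at_right 0)"
  proof (rule AE_I'[OF N0_null], rule subsetI)
    fix x assume "x \<in> {x \<in> space \<mu>. \<not> (x \<in> ball a R \<longrightarrow> \<not> ((\<lambda>r. ?m x r / r ^ d) \<longlongrightarrow> 0) (at_right 0))}"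
    then have x: "x \<in> K" and lim: "((\<lambda>r. ?m x r / r ^ d) \<longlongrightarrow> 0) (at_right 0)"
      by (auto simp: K_def)
    have "x \<in> N (1 / Suc i)" for i
    proof -
      have "\<forall>\<^sub>F r in at_right 0. ?m x r / r ^ d < 1 / Suc i" using lim by (rule order_tendstoD) simp
      then obtain b where b: "b > 0" "\<And>r. 0 < r \<Longrightarrow> r < b \<Longrightarrow> ?m x r / r ^ d < 1 / Suc i"
        unfolding eventually_at_right_field by blast
      obtain j where "\<delta> / b < real j" using reals_Archimedean2 by blast
      then have "\<delta> / b < Suc j" by simp
      then have "\<delta> / Suc j < b" using b(1) by (simp add: field_simps)
      have "?m x r \<le> 1 / Suc i * r ^ d" if r: "0 < r" "r < \<delta> / Suc j" for r
      proof -
        have "r < b" using r(2) \<open>\<delta> / Suc j < b\<close> by (rule less_trans)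
        from b(2)[OF r(1) this] show ?thesis
          using r(1) by (subst (asm) pos_divide_less_eq) (auto intro: less_imp_le)
      qed
      then have "x \<in> A (1 / Suc i) (\<delta> / Suc j)" using x unfolding A_def by blast
      then show ?thesis unfolding N_def by blast
    qed
    then show "x \<in> N0" unfolding N0_def by blast
  qed
qed

section \<open>Test fields\<close>

lemma spt_subset:
  fixes f :: "'a::t2_space \<Rightarrow> 'b::zero"
  assumes "compact C" "\<And>x. x \<notin> C \<Longrightarrow> f x = 0"
  shows "compact (spt f)" "spt f \<subseteq> C"
proof -
  have "closure {x. f x \<noteq> 0} \<subseteq> C"
    using assms by (intro closure_minimal compact_imp_closed) auto
  then show "spt f \<subseteq> C" by (simp add: spt_def)
  then have "spt f = C \<inter> spt f" by blast
  moreover have "compact (C \<inter> spt f)" using assms(1) by (intro compact_Int_closed) (simp_all add: spt_def)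
  ultimately show "compact (spt f)" by simp
qed

text \<open>In finite dimension, continuity of every directional derivative gives continuity in
  operator norm.\<close>

lemma C1I:
  fixes f :: "'a::euclidean_space \<Rightarrow> 'b::real_normed_vector"
  assumes der: "\<And>x. (f has_derivative f' x) (at x)"
    and cont: "\<And>h. continuous_on UNIV (\<lambda>x. f' x h)"
  shows "C1 f"
proof -
  have bl: "bounded_linear (f' x)" for x using der by (rule has_derivative_bounded_linear)
  have "continuous_on UNIV (\<lambda>x. Blinfun (f' x))"
    using cont by (intro continuous_on_blinfun_componentwise) (simp add: bounded_linear_Blinfun_apply[OF bl])
  then show ?thesis
    unfolding C1_def using der
    by (intro exI[of _ "\<lambda>x. Blinfun (f' x)"]) (simp add: bounded_linear_Blinfun_apply[OF bl])
qed

lemma C1E: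
  assumes "C1 f"
  obtains f' where "\<And>x. (f has_derivative f' x) (at x)" "\<And>h. continuous_on UNIV (\<lambda>x. f' x h)"
proof -
  obtain f' where "\<forall>x. (f has_derivative blinfun_apply (f' x)) (at x)" "continuous_on UNIV f'"
    using assms unfolding C1_def by blast
  then show ?thesis
    by (intro that[of "\<lambda>x. blinfun_apply (f' x)"]) (auto intro!: continuous_intros)
qed

lemma C1_compose_affine:
  fixes \<phi> :: "'a::euclidean_space \<Rightarrow> real"
  assumes "C1 \<phi>"
  shows "C1 (\<lambda>y. \<phi> (a *\<^sub>R (y - x)) *\<^sub>R v)"
proof -
  obtain \<phi>' where \<phi>': "\<And>x. (\<phi> has_derivative \<phi>' x) (at x)" "\<And>h. continuous_on UNIV (\<lambda>x. \<phi>' x h)"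
    using C1E[OF assms] by blast
  show ?thesis
  proof (rule C1I)
    fix y
    have "((\<lambda>y. a *\<^sub>R (y - x)) has_derivative (\<lambda>h. a *\<^sub>R h)) (at y)"
      by (auto intro!: derivative_eq_intros)
    from has_derivative_compose[OF this \<phi>'(1)]
    show "((\<lambda>y. \<phi> (a *\<^sub>R (y - x)) *\<^sub>R v) has_derivative (\<lambda>h. \<phi>' (a *\<^sub>R (y - x)) (a *\<^sub>R h) *\<^sub>R v)) (at y)"
      by (rule has_derivative_scaleR_left)
  next
    fix h
    show "continuous_on UNIV (\<lambda>y. \<phi>' (a *\<^sub>R (y - x)) (a *\<^sub>R h) *\<^sub>R v)"
      by (intro continuous_on_scaleR continuous_on_const continuous_on_compose2[OF \<phi>'(2)] continuous_intros) auto
  qed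
qed

text \<open>The norm is not differentiable at 0; evenness forces the derivative of
  \<open>\<rho>\<close> to vanish there, which removes the singularity of both the function and its
  gradient.\<close>

lemma C1_radial:
  assumes "C1 \<rho>" and even: "\<And>r. \<rho> (- r) = \<rho> r"
  shows "C1 (radial \<rho> :: real^'n \<Rightarrow> real)"
proof -
  obtain f' where f': "\<And>x. (\<rho> has_derivative f' x) (at x)" "\<And>h. continuous_on UNIV (\<lambda>x. f' x h)"
    using C1E[OF assms(1)] by blast
  define \<rho>' where "\<rho>' r = f' r 1" for r
  have der: "(\<rho> has_real_derivative \<rho>' r) (at r)" for r
  proof -
    have "f' r h = \<rho>' r * h" for h
      using linear_scale[OF has_derivative_linear[OF f'(1)], of r h 1] by (simp add: \<rho>'_def)
    then have "f' r = (*) (\<rho>' r)" by (rule ext)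
    then show ?thesis using f'(1)[of r] unfolding has_field_derivative_def by simp
  qed
  have cont: "continuous_on UNIV \<rho>'" unfolding \<rho>'_def by (rule f'(2))
  have "((\<lambda>r. \<rho> (- r)) has_real_derivative \<rho>' (- 0) * (- 1)) (at 0)"
    by (rule DERIV_chain2[OF der]) (auto intro!: derivative_eq_intros)
  then have "(\<rho> has_real_derivative - \<rho>' 0) (at 0)" by (simp add: even)
  from DERIV_unique[OF this der] have \<rho>'0: "\<rho>' 0 = 0" by simp
  show ?thesis
  proof (rule C1I)
    fix x :: "real^'n"
    show "(radial \<rho> has_derivative (\<lambda>h. \<rho>' (norm x) * (sgn x \<bullet> h))) (at x)"
    proof (cases "x = 0")
      case False
      have "(norm has_derivative (\<lambda>h. sgn x \<bullet> h)) (at x)"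
        using has_derivative_norm[OF False] by (simp add: inner_commute)
      from has_derivative_compose[OF this der[unfolded has_field_derivative_def]]
      show ?thesis unfolding radial_def[abs_def] .
    next
      case True
      have "((\<lambda>r. (\<rho> r - \<rho> 0) / r) \<longlongrightarrow> 0) (at 0)"
        using der[of 0] by (simp add: \<rho>'0 has_field_derivative_iff)
      moreover have "filterlim (norm :: real^'n \<Rightarrow> real) (at 0) (at 0)"
        unfolding filterlim_at using tendsto_norm_zero[OF tendsto_ident_at] by (auto simp: eventually_at_filter)
      ultimately have "((\<lambda>y :: real^'n. (\<rho> (norm y) - \<rho> 0) / norm y) \<longlongrightarrow> 0) (at 0)"
        by (rule filterlim_compose)
      then have "((\<lambda>y :: real^'n. norm (\<rho> (norm y) - \<rho> 0) / norm y) \<longlongrightarrow> 0) (at 0)"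
        by (drule_tac tendsto_norm) (simp add: norm_divide)
      then show ?thesis using True
        by (simp add: has_derivative_iff_norm \<rho>'0 radial_def)
    qed
  next
    fix h :: "real^'n"
    have "isCont (\<lambda>x :: real^'n. \<rho>' (norm x) * (sgn x \<bullet> h)) x" for x
    proof (cases "x = 0")
      case False
      have c: "isCont \<rho>' t" for t using cont by (simp add: continuous_on_eq_continuous_at)
      have "isCont (\<lambda>x :: real^'n. \<rho>' (norm x)) x"
        by (intro isCont_o2[OF _ c] continuous_intros)
      moreover have "isCont (\<lambda>x :: real^'n. sgn x \<bullet> h) x" using False by (intro continuous_intros)
      ultimately show ?thesis by (rule isCont_mult)
    next
      case True
      have "((\<lambda>x :: real^'n. \<rho>' (norm x) * (sgn x \<bullet> h)) \<longlongrightarrow> 0) (at 0)"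
      proof (rule Lim_null_comparison)
        show "\<forall>\<^sub>F x :: real^'n in at 0. norm (\<rho>' (norm x) * (sgn x \<bullet> h)) \<le> \<bar>\<rho>' (norm x)\<bar> * norm h"
        proof (intro always_eventually allI)
          fix x :: "real^'n"
          have "\<bar>sgn x \<bullet> h\<bar> \<le> norm (sgn x) * norm h" by (rule Cauchy_Schwarz_ineq2)
          also have "\<dots> \<le> 1 * norm h" by (intro mult_right_mono) (auto simp: norm_sgn)
          finally show "norm (\<rho>' (norm x) * (sgn x \<bullet> h)) \<le> \<bar>\<rho>' (norm x)\<bar> * norm h"
            by (simp add: abs_mult mult_left_mono)
        qed
        have c: "isCont \<rho>' 0" using cont by (simp add: continuous_on_eq_continuous_at)
        have "((\<lambda>x :: real^'n. \<rho>' (norm x)) \<longlongrightarrow> \<rho>' 0) (at 0)"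
          by (rule isCont_tendsto_compose[OF c]) (rule tendsto_norm_zero[OF tendsto_ident_at])
        then have "((\<lambda>x :: real^'n. \<bar>\<rho>' (norm x)\<bar> * norm h) \<longlongrightarrow> \<bar>\<rho>' 0\<bar> * norm h) (at 0)"
          by (intro tendsto_intros)
        then show "((\<lambda>x :: real^'n. \<bar>\<rho>' (norm x)\<bar> * norm h) \<longlongrightarrow> 0) (at 0)" by (simp add: \<rho>'0)
      qed
      then show ?thesis using True by (simp add: isCont_def \<rho>'0)
    qed
    then show "continuous_on UNIV (\<lambda>x :: real^'n. \<rho>' (norm x) * (sgn x \<bullet> h))"
      by (simp add: continuous_at_imp_continuous_on)
  qed
qed

lemma gradient_eq:
  assumes "(f has_derivative f') (at x)"
  shows "gradient f x = (\<chi> i. f' (axis i 1))"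
  unfolding gradient_def frechet_derivative_at[OF assms, symmetric] ..

lemma tangential_div_eq:
  fixes X :: "real^'n \<Rightarrow> real^'n"
  assumes X: "(X has_derivative X') (at y)"
  shows "tangential_div P X y = (\<Sum>j\<in>UNIV. \<Sum>i\<in>UNIV. P $ j $ i * X' (axis i 1) $ j)"
proof -
  have "gradient (\<lambda>y. X y $ j) y = (\<chi> i. X' (axis i 1) $ j)" for j
    by (rule gradient_eq) (rule bounded_linear.has_derivative[OF bounded_linear_vec_nth X])
  then show ?thesis
    by (simp add: tangential_div_def inner_axis matrix_vector_mult_def)
qed

text \<open>Identifies the coordinates of the mollified first variation with the first variation
  tested on the fields \<phi>(y - x) e_j.\<close>

lemma tangential_div_scaleR_axis:
  fixes \<phi> :: "real^'n \<Rightarrow> real"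
  assumes \<phi>: "(\<phi> has_derivative \<phi>') (at (y - x))"
  shows "tangential_div P (\<lambda>y. \<phi> (y - x) *\<^sub>R axis j 1) y = (P *v gradient \<phi> (y - x)) $ j"
proof -
  have "((\<lambda>y. y - x) has_derivative (\<lambda>h. h)) (at y)" by (auto intro!: derivative_eq_intros)
  from has_derivative_compose[OF this \<phi>]
  have "((\<lambda>y. \<phi> (y - x) *\<^sub>R (axis j 1 :: real^'n)) has_derivative (\<lambda>h. \<phi>' h *\<^sub>R axis j 1)) (at y)"
    by (rule has_derivative_scaleR_left)
  then have "tangential_div P (\<lambda>y. \<phi> (y - x) *\<^sub>R axis j 1) y
      = (\<Sum>k\<in>UNIV. \<Sum>i\<in>UNIV. P $ k $ i * (\<phi>' (axis i 1) *\<^sub>R axis j 1 :: real^'n) $ k)"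
    by (rule tangential_div_eq)
  also have "\<dots> = (\<Sum>k\<in>UNIV. if k = j then \<Sum>i\<in>UNIV. P $ k $ i * \<phi>' (axis i 1) else 0)"
    by (intro sum.cong) (auto simp: axis_def)
  also have "\<dots> = (P *v gradient \<phi> (y - x)) $ j"
    by (simp add: gradient_eq[OF \<phi>] matrix_vector_mult_def)
  finally show ?thesis .
qed

text \<open>Working with the squared norm keeps the field smooth at its centre x, whatever g is near
  0.\<close>

lemma C1_cutoff_field:
  fixes x :: "'a::euclidean_space"
  assumes g: "\<And>t. (g has_real_derivative g' t) (at t)" and g': "continuous_on UNIV g'"
  shows "((\<lambda>y. g ((norm (y - x) / r)\<^sup>2) *\<^sub>R (y - x)) has_derivative
     (\<lambda>h. g ((norm (y - x) / r)\<^sup>2) *\<^sub>R h + (g' ((norm (y - x) / r)\<^sup>2) * (2 * ((y - x) \<bullet> h) / r\<^sup>2)) *\<^sub>R (y - x))) (at y)"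
    and "C1 (\<lambda>y. g ((norm (y - x) / r)\<^sup>2) *\<^sub>R (y - x))"
proof -
  let ?t = "\<lambda>y. (norm (y - x) / r)\<^sup>2"
  have eq: "?t y = (y - x) \<bullet> (y - x) / r\<^sup>2" for y
    by (simp add: power_divide power2_norm_eq_inner)
  let ?X = "\<lambda>y. g (?t y) *\<^sub>R (y - x)"
  let ?X' = "\<lambda>y h. g (?t y) *\<^sub>R h + (g' (?t y) * (2 * ((y - x) \<bullet> h) / r\<^sup>2)) *\<^sub>R (y - x)"
  have 1: "(?X has_derivative ?X' y) (at y)" for y
  proof -
    have "((\<lambda>y. (y - x) \<bullet> (y - x) / r\<^sup>2) has_derivative (\<lambda>h. 2 * ((y - x) \<bullet> h) / r\<^sup>2)) (at y)"
    proof -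
      have "((\<lambda>y. inverse (r\<^sup>2) * ((y - x) \<bullet> (y - x))) has_derivative (\<lambda>h. inverse (r\<^sup>2) * (2 * ((y - x) \<bullet> h)))) (at y)"
        by (rule has_derivative_mult_right) (auto intro!: derivative_eq_intros simp: inner_commute)
      then show ?thesis by (simp add: divide_inverse mult.commute)
    qed
    from has_derivative_compose[OF this g[unfolded has_field_derivative_def]]
    have "((\<lambda>y. g ((y - x) \<bullet> (y - x) / r\<^sup>2)) has_derivative
        (\<lambda>h. g' ((y - x) \<bullet> (y - x) / r\<^sup>2) * (2 * ((y - x) \<bullet> h) / r\<^sup>2))) (at y)" .
    from has_derivative_scaleR[OF this, of "\<lambda>y. y - x" "\<lambda>h. h"]
    show ?thesis unfolding eq by (simp add: has_derivative_diff[OF has_derivative_ident has_derivative_const, simplified])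
  qed
  show "(?X has_derivative ?X' y) (at y)" by (rule 1)
  have gc: "continuous_on UNIV g" using g by (intro continuous_at_imp_continuous_on) (auto intro: DERIV_isCont)
  have sq: "continuous_on UNIV (\<lambda>y. ?t y)" unfolding eq divide_inverse by (intro continuous_intros)
  show "C1 ?X"
  proof (rule C1I[OF 1])
    fix h
    show "continuous_on UNIV (\<lambda>y. ?X' y h)"
      unfolding divide_inverse[of _ "r\<^sup>2"]
      by (intro continuous_on_add continuous_on_scaleR continuous_on_mult continuous_on_const
          continuous_on_compose2[OF gc sq] continuous_on_compose2[OF g' sq] continuous_intros) auto
  qed
qed

text \<open>The trace comes from differentiating the factor y - x, the quadratic form from
  differentiating the cutoff.\<close>

lemma tangential_div_cutoff_field:
  fixes x :: "real^'n"
  assumes g: "\<And>t. (g has_real_derivative g' t) (at t)" and g': "continuous_on UNIV g'"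
  shows "tangential_div P (\<lambda>y. g ((norm (y - x) / r)\<^sup>2) *\<^sub>R (y - x)) y =
    g ((norm (y - x) / r)\<^sup>2) * (\<Sum>k\<in>UNIV. P $ k $ k)
      + 2 * g' ((norm (y - x) / r)\<^sup>2) * ((P *v (y - x)) \<bullet> (y - x)) / r\<^sup>2"
proof -
  let ?g = "g ((norm (y - x) / r)\<^sup>2)" and ?g' = "g' ((norm (y - x) / r)\<^sup>2)" and ?z = "y - x"
  have ax: "axis i (1::real) $ j = (if i = j then 1 else 0)" for i j :: 'n by (simp add: axis_def)
  have key: "P $ j $ i * (G *\<^sub>R axis i 1 + (G' * (2 * (z \<bullet> axis i 1) / r\<^sup>2)) *\<^sub>R z) $ j
    = (if i = j then G * P $ j $ j else 0) + (2 * G' / r\<^sup>2) * (P $ j $ i * z $ i * z $ j)"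
    for G G' i j and z :: "real^'n"
    by (auto simp: inner_axis ax algebra_simps)
  have "tangential_div P (\<lambda>y. g ((norm (y - x) / r)\<^sup>2) *\<^sub>R (y - x)) y =
    (\<Sum>j\<in>UNIV. \<Sum>i\<in>UNIV. P $ j $ i * (?g *\<^sub>R axis i 1 + (?g' * (2 * (?z \<bullet> axis i 1) / r\<^sup>2)) *\<^sub>R ?z) $ j)"
    by (rule tangential_div_eq[OF C1_cutoff_field(1)[OF g g']])
  also have "\<dots> = (\<Sum>j\<in>UNIV. \<Sum>i\<in>UNIV. (if i = j then ?g * P $ j $ j else 0) + (2 * ?g' / r\<^sup>2) * (P $ j $ i * ?z $ i * ?z $ j))"
    by (intro sum.cong refl key)
  also have "\<dots> = ?g * (\<Sum>k\<in>UNIV. P $ k $ k) + (2 * ?g' / r\<^sup>2) * (\<Sum>j\<in>UNIV. \<Sum>i\<in>UNIV. P $ j $ i * ?z $ i * ?z $ j)"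
    by (simp add: sum.distrib sum_distrib_left)
  also have "(\<Sum>j\<in>UNIV. \<Sum>i\<in>UNIV. P $ j $ i * ?z $ i * ?z $ j) = (P *v ?z) \<bullet> ?z"
    by (simp add: inner_vec_def matrix_vector_mult_def sum_distrib_right)
  finally show ?thesis by simp
qed

section \<open>The mass of a rectifiable varifold\<close>

context
  fixes \<Omega> :: "(real^'n) set" and V :: "((real^'n) \<times> (real^'n^'n)) measure"
  assumes V: "varifold CARD('d::finite) \<Omega> V"
begin

lemma sets_varifold: "sets V = sets (restrict_space borel (\<Omega> \<times> grassmannian CARD('d)))"
  using V by (simp add: varifold_def radon_measure_on_def)

lemma space_varifold: "space V = \<Omega> \<times> grassmannian CARD('d)"
  using sets_eq_imp_space_eq[OF sets_varifold] by (simp add: space_restrict_space)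

lemma borel_measurable_varifold: "F \<in> borel_measurable (restrict_space borel (\<Omega> \<times> grassmannian CARD('d))) \<Longrightarrow> F \<in> borel_measurable V"
  using measurable_cong_sets[OF sets_varifold refl] by blast

lemma cylinder_varifold:
  assumes "compact C" "C \<subseteq> \<Omega>"
  shows "C \<times> grassmannian CARD('d) \<in> sets V" "emeasure V (C \<times> grassmannian CARD('d)) < \<infinity>"
proof -
  have c: "compact (C \<times> (grassmannian CARD('d) :: (real^'n^'n) set))"
    by (intro compact_Times compact_grassmannian assms)
  then show "emeasure V (C \<times> grassmannian CARD('d)) < \<infinity>"
    using V assms unfolding varifold_def radon_measure_on_def by (metis Sigma_mono subset_refl)
  have "C \<times> grassmannian CARD('d) = (\<Omega> \<times> grassmannian CARD('d)) \<inter> (C \<times> (grassmannian CARD('d) :: (real^'n^'n) set))"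
    using assms(2) by blast
  then show "C \<times> grassmannian CARD('d) \<in> sets V"
    unfolding sets_varifold sets_restrict_space using borel_compact[OF c] by blast
qed

lemma integrable_varifold:
  fixes F :: "(real^'n) \<times> (real^'n^'n) \<Rightarrow> 'b::{banach, second_countable_topology}"
  assumes F: "continuous_on (\<Omega> \<times> grassmannian CARD('d)) F"
    and C: "compact C" "C \<subseteq> \<Omega>" and zero: "\<And>y P. y \<notin> C \<Longrightarrow> F (y, P) = 0"
  shows "integrable V F"
proof -
  let ?G = "grassmannian CARD('d) :: (real^'n^'n) set"
  have "compact (C \<times> ?G)" by (intro compact_Times compact_grassmannian C)
  moreover have "continuous_on (C \<times> ?G) F" by (rule continuous_on_subset[OF F]) (use C(2) in blast)
  ultimately have "bounded (F ` (C \<times> ?G))" by (intro compact_imp_bounded compact_continuous_image)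
  then obtain B where B: "\<And>p. p \<in> C \<times> ?G \<Longrightarrow> norm (F p) \<le> B" unfolding bounded_iff by blast
  show ?thesis
  proof (rule Bochner_Integration.integrable_bound)
    show "integrable V (\<lambda>p. B * indicator (C \<times> ?G) p)"
      using cylinder_varifold[OF C] by (intro integrable_mult_right integrable_real_indicator)
    show "F \<in> borel_measurable V"
      by (intro borel_measurable_varifold borel_measurable_continuous_on_restrict F)
    show "AE p in V. norm (F p) \<le> norm (B * indicator (C \<times> ?G) p)"
    proof (rule AE_I2)
      fix p assume p: "p \<in> space V"
      show "norm (F p) \<le> norm (B * indicator (C \<times> ?G) p)"
      proof (cases "p \<in> C \<times> ?G")
        case True
        then show ?thesis using B[OF True] by auto
      next
        case False
        then have "fst p \<notin> C" using p by (auto simp: space_varifold)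
        then show ?thesis using zero[of "fst p" "snd p"] by simp
      qed
    qed
  qed
qed

lemma measurable_fst_varifold: "fst \<in> measurable V (restrict_space borel \<Omega>)"
proof (rule measurable_restrict_space2)
  show "fst \<in> space V \<rightarrow> \<Omega>" by (auto simp: space_varifold)
  show "fst \<in> borel_measurable V"
    by (intro borel_measurable_varifold borel_measurable_continuous_on_restrict continuous_intros)
qed

lemma sets_mass: "sets (mass \<Omega> V) = sets (restrict_space borel \<Omega>)"
  by (simp add: mass_def)

lemma space_mass: "space (mass \<Omega> V) = \<Omega>"
  by (simp add: mass_def space_restrict_space)

lemma emeasure_mass:
  assumes "A \<in> sets (mass \<Omega> V)"
  shows "emeasure (mass \<Omega> V) A = emeasure V (A \<times> grassmannian CARD('d))"
proof -
  have "A \<subseteq> \<Omega>" using sets.sets_into_space[OF assms] by (simp add: space_mass)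
  then have "fst -` A \<inter> space V = A \<times> grassmannian CARD('d)" by (auto simp: space_varifold)
  moreover have "A \<in> sets (restrict_space borel \<Omega>)" using assms sets_mass by simp
  ultimately show ?thesis
    unfolding mass_def using emeasure_distr[OF measurable_fst_varifold] by metis
qed

lemma compact_in_sets_mass:
  assumes "compact C" "C \<subseteq> \<Omega>"
  shows "C \<in> sets (mass \<Omega> V)"
  unfolding sets_mass sets_restrict_space using borel_compact[OF assms(1)] assms(2) by blast

lemma integral_mass:
  assumes "f \<in> borel_measurable (restrict_space borel \<Omega>)"
  shows "(LINT x|mass \<Omega> V. f x) = (LINT p|V. f (fst p) :: 'b::{banach, second_countable_topology})"
  unfolding mass_def by (rule integral_distr[OF measurable_fst_varifold assms])

lemma emeasure_mass_finite:
  assumes "compact C" "C \<subseteq> \<Omega>"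
  shows "emeasure (mass \<Omega> V) C < \<infinity>"
  using emeasure_mass[OF compact_in_sets_mass[OF assms]] cylinder_varifold(2)[OF assms] by simp

end

text \<open>Only an inequality: where the approximate tangent space does not exist, its value is arbitrary and need
  not project to the Grassmannian, in which case the test function below vanishes.\<close>

lemma mass_le_hausdorff:
  fixes \<Omega> M :: "(real^'n) set"
  assumes R: "rectifiable_varifold (D :: 'd::finite itself) \<Omega> M \<theta> V" and \<Omega>: "open \<Omega>"
    and B: "compact B" "B \<subseteq> \<Omega>"
  shows "emeasure (mass \<Omega> V) B
    \<le> ennreal (LINT x|hausdorff_measure CARD('d). indicator B x * (indicator M x * \<theta> x))"
proof (cases "B = {}")
  case False
  let ?G = "grassmannian CARD('d) :: (real^'n^'n) set" and ?H = "hausdorff_measure CARD('d) :: (real^'n) measure"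
  note V = R[unfolded rectifiable_varifold_def, THEN conjunct1]
  define g where "g x = indicator M x * \<theta> x" for x
  have g_int: "integrable ?H (\<lambda>x. indicator K x * g x)" if "compact K" "K \<subseteq> \<Omega>" for K
    using R that by (simp add: rectifiable_varifold_def L1_loc_def set_integrable_def g_def)
  have ae: "AE x in ?H. x \<in> M \<longrightarrow> \<theta> x > 0" using R by (simp add: rectifiable_varifold_def)
  have g_nonneg: "AE x in ?H. g x \<ge> 0"
    using ae by eventually_elim (auto simp: g_def indicator_def)
  obtain e where e: "e > 0" "(\<Union>x\<in>B. cball x e) \<subseteq> \<Omega>"
    using compact_subset_open_imp_cball_epsilon_subset[OF B(1) \<Omega> B(2)] by blast
  define K where "K j = {x. infdist x B \<le> e / Suc j}" for j
  \<comment> \<open>Tent functions of the distance to \<open>B\<close>: they are 1 on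
    \<open>B\<close> and vanish off the neighbourhoods \<open>K j\<close>, which shrink to
    \<open>B\<close>.\<close>
  define \<psi> where "\<psi> j x = max 0 (1 - Suc j / e * infdist x B)" for j x
  let ?f = "\<lambda>j x. indicator (K j) x * g x"
  have cK: "compact (K j)" for j unfolding K_def using e(1) by (intro compact_infdist_le False B) simp
  have K\<Omega>: "K j \<subseteq> \<Omega>" for j
  proof
    fix x assume x: "x \<in> K j"
    obtain b where b: "b \<in> B" "infdist x B = dist x b"
      using infdist_attains_inf[OF compact_imp_closed[OF B(1)] False] by blast
    have "e / Suc j \<le> e / 1" using e(1) by (intro divide_left_mono) auto
    then have "x \<in> cball b e" using x b(2) by (simp add: K_def dist_commute)
    then show "x \<in> \<Omega>" using e(2) b(1) by blast
  qed
  have \<psi>0: "\<psi> j x = 0" if "x \<notin> K j" for j x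
    using that e(1) by (simp add: \<psi>_def K_def field_simps)
  have \<psi>_bounds: "0 \<le> \<psi> j x" "\<psi> j x \<le> 1" for j x
    using e(1) infdist_nonneg[of x B] by (simp_all add: \<psi>_def)
  have \<psi>1: "\<psi> j x = 1" if "x \<in> B" for j x using that by (simp add: \<psi>_def)
  have \<psi>_cont: "continuous_on S (\<psi> j)" for j S unfolding \<psi>_def by (intro continuous_intros)
  \<comment> \<open>Test functions are total on all matrices. The indicator of the Grassmannian
    keeps the support inside \<Omega> \<times> G; being constant there, it leaves relative
    continuity intact.\<close>
  define \<phi> where "\<phi> j p = \<psi> j (fst p) * indicator ?G (snd p)" for j p
  have \<phi>_bounds: "0 \<le> \<phi> j p" "\<phi> j p \<le> 1" for j p
    by (cases "snd p \<in> ?G"; simp add: \<phi>_def \<psi>_bounds)+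
  have \<phi>_cont: "continuous_on (\<Omega> \<times> ?G) (\<phi> j)" for j
  proof -
    have "continuous_on (\<Omega> \<times> ?G) (\<lambda>p. \<psi> j (fst p))"
      by (rule continuous_on_compose2[OF \<psi>_cont[of UNIV] continuous_on_fst[OF continuous_on_id]]) simp
    then show ?thesis
    proof (rule continuous_on_eq)
      show "\<psi> j (fst p) = \<phi> j p" if "p \<in> \<Omega> \<times> ?G" for p
        using that by (simp add: \<phi>_def mem_Times_iff)
    qed
  qed
  have \<phi>_Cc0: "\<phi> j \<in> Cc0 (\<Omega> \<times> ?G)" for j
  proof -
    have c: "compact (K j \<times> ?G)" by (intro compact_Times compact_grassmannian cK)
    have z: "\<phi> j p = 0" if "p \<notin> K j \<times> ?G" for p
    proof (cases "fst p \<in> K j")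
      case True
      then have "snd p \<notin> ?G" using that by (simp add: mem_Times_iff)
      then show ?thesis by (simp add: \<phi>_def)
    next
      case False
      then show ?thesis by (simp add: \<phi>_def \<psi>0)
    qed
    have "compact (spt (\<phi> j))" "spt (\<phi> j) \<subseteq> K j \<times> ?G"
      by (rule spt_subset[OF c]; simp add: z del: mem_Sigma_iff)+
    moreover have "K j \<times> ?G \<subseteq> \<Omega> \<times> ?G" using K\<Omega> by blast
    ultimately show ?thesis using \<phi>_cont[of j] unfolding Cc0_def by (simp add: order_trans)
  qed
  let ?T = "\<lambda>x. orth_proj (approx_tangent_space CARD('d) M \<theta> x)"
  have le: "measure V (B \<times> ?G) \<le> (LINT x|?H. ?f j x)" for j
  proof -
    have cyl: "B \<times> ?G \<in> sets V" "emeasure V (B \<times> ?G) < \<infinity>" using cylinder_varifold[OF V B] .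
    have "measure V (B \<times> ?G) = (LINT p|V. indicator (B \<times> ?G) p)"
      using sets.sets_into_space[OF cyl(1)] by (simp add: Int_absorb2)
    also have "\<dots> \<le> (LINT p|V. \<phi> j p)"
    proof (rule integral_mono)
      show "integrable V (\<lambda>p. indicator (B \<times> ?G) p :: real)" using cyl by (rule integrable_real_indicator)
      show "integrable V (\<phi> j)"
        by (rule integrable_varifold[OF V \<phi>_cont cK[of j] K\<Omega>]) (simp add: \<phi>_def \<psi>0)
      show "indicator (B \<times> ?G) p \<le> \<phi> j p" for p
      proof (cases "p \<in> B \<times> ?G")
        case True
        then show ?thesis by (simp add: \<phi>_def \<psi>1 mem_Times_iff)
      next
        case False
        then show ?thesis using \<phi>_bounds[of j p] by simp
      qed
    qed
    also have "\<dots> = (LINT x:M|?H. \<phi> j (x, ?T x) * \<theta> x)"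
      using R \<phi>_Cc0[of j] by (simp add: rectifiable_varifold_def)
    \<comment> \<open>Nothing is known about measurability of the tangent plane map. The comparison
      with an integrable nonnegative majorant also covers a non-integrable left side, whose integral
      is 0 by convention.\<close>
    also have "\<dots> \<le> (LINT x|?H. ?f j x)"
      unfolding set_lebesgue_integral_def
    proof (rule integral_mono_AE')
      show "integrable ?H (\<lambda>x. ?f j x)" by (rule g_int[OF cK K\<Omega>])
      show "AE x in ?H. 0 \<le> ?f j x"
        using g_nonneg by eventually_elim (rule mult_nonneg_nonneg, simp_all)
      show "AE x in ?H. indicator M x *\<^sub>R (\<phi> j (x, ?T x) * \<theta> x) \<le> ?f j x"
        using ae
      proof eventually_elim
        case (elim x)
        have 1: "\<phi> j (x, ?T x) \<le> indicator (K j) x"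
        proof (cases "x \<in> K j")
          case True
          then show ?thesis using \<phi>_bounds(2) by simp
        next
          case False
          then show ?thesis by (simp add: \<phi>_def \<psi>0)
        qed
        show ?case
        proof (cases "x \<in> M")
          case True
          then have "\<phi> j (x, ?T x) * \<theta> x \<le> indicator (K j) x * \<theta> x"
            using elim 1 by (intro mult_right_mono) auto
          then show ?thesis using True by (simp add: g_def)
        qed (simp add: g_def)
      qed
    qed
    finally show ?thesis .
  qed
  have "(\<lambda>j. LINT x|?H. ?f j x) \<longlonglongrightarrow> (LINT x|?H. indicator B x * g x)"
  proof (rule integral_dominated_convergence[where w="\<lambda>x. norm (?f 0 x)"])
    show "(\<lambda>x. indicator B x * g x) \<in> borel_measurable ?H" using g_int[OF B] by (rule borel_measurable_integrable)
    show "(\<lambda>x. ?f j x) \<in> borel_measurable ?H" for j using g_int[OF cK K\<Omega>] by (rule borel_measurable_integrable)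
    show "integrable ?H (\<lambda>x. norm (?f 0 x))" using g_int[OF cK K\<Omega>] by (rule integrable_norm)
    show "AE x in ?H. norm (?f j x) \<le> norm (?f 0 x)" for j
    proof (rule AE_I2)
      fix x
      have "K j \<subseteq> K 0"
      proof
        fix x assume "x \<in> K j"
        moreover have "e / Suc j \<le> e / 1" using e(1) by (intro divide_left_mono) auto
        ultimately show "x \<in> K 0" by (simp add: K_def)
      qed
      then show "norm (?f j x) \<le> norm (?f 0 x)"
        by (cases "x \<in> K j") (use \<open>K j \<subseteq> K 0\<close> in auto)
    qed
    show "AE x in ?H. (\<lambda>j. ?f j x) \<longlonglongrightarrow> indicator B x * g x"
    proof (rule AE_I2)
      fix x
      show "(\<lambda>j. ?f j x) \<longlonglongrightarrow> indicator B x * g x"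
      proof (cases "x \<in> B")
        case True
        then have "x \<in> K j" for j using e(1) by (simp add: K_def)
        then show ?thesis using True by simp
      next
        case F: False
        then have pos: "infdist x B > 0"
          using in_closed_iff_infdist_zero[OF compact_imp_closed[OF B(1)] False, of x] infdist_nonneg[of x B] by auto
        obtain n where n: "e / infdist x B < real n" using reals_Archimedean2 by blast
        have "x \<notin> K j" if "j \<ge> n" for j
        proof -
          have "e / infdist x B < Suc j" using n that by simp
          then have "e / Suc j < infdist x B" using pos by (simp add: field_simps)
          then show ?thesis by (simp add: K_def)
        qed
        then have "\<forall>\<^sub>F j in sequentially. ?f j x = indicator B x * g x"
          unfolding eventually_sequentially using F by (intro exI[of _ n]) simp
        then show ?thesis by (rule tendsto_eventually)
      qed
    qed
  qed
  then have "measure V (B \<times> ?G) \<le> (LINT x|?H. indicator B x * g x)"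
    by (rule LIMSEQ_le_const) (use le in blast)
  moreover have "emeasure (mass \<Omega> V) B = ennreal (measure V (B \<times> ?G))"
    using emeasure_mass[OF V compact_in_sets_mass[OF V B]] cylinder_varifold(2)[OF V B]
    by (simp add: emeasure_eq_ennreal_measure less_top)
  ultimately show ?thesis unfolding g_def by (simp add: ennreal_leI)
qed simp

lemma AE_density_mass_not_zero:
  fixes \<Omega> M :: "(real^'n) set"
  assumes R: "rectifiable_varifold (D :: 'd::finite itself) \<Omega> M \<theta> V" and \<Omega>: "open \<Omega>"
  shows "AE x in mass \<Omega> V. \<not> ((\<lambda>r. measure (mass \<Omega> V) (cball x r) / r ^ CARD('d)) \<longlongrightarrow> 0) (at_right 0)"
proof (rule AE_density_not_zero[where g="\<lambda>x. indicator M x * \<theta> x", OF \<Omega>])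
  note V = R[unfolded rectifiable_varifold_def, THEN conjunct1]
  show "sets (mass \<Omega> V) = sets (restrict_space borel \<Omega>)" by (rule sets_mass[OF V])
  show "emeasure (mass \<Omega> V) K < \<infinity>" if "compact K" "K \<subseteq> \<Omega>" for K
    by (rule emeasure_mass_finite[OF V that])
  show "integrable (hausdorff_measure CARD('d)) (\<lambda>x. indicator K x * (indicator M x * \<theta> x))"
    if "compact K" "K \<subseteq> \<Omega>" for K
    using R that by (simp add: rectifiable_varifold_def L1_loc_def set_integrable_def)
  have "AE x in hausdorff_measure CARD('d). x \<in> M \<longrightarrow> \<theta> x > 0" using R by (simp add: rectifiable_varifold_def)
  then show "AE x in hausdorff_measure CARD('d). 0 \<le> indicator M x * \<theta> x"
    by eventually_elim (auto simp: indicator_def)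
  show "emeasure (mass \<Omega> V) B \<le> ennreal (LINT x|hausdorff_measure CARD('d). indicator B x * (indicator M x * \<theta> x))"
    if "compact B" "B \<subseteq> \<Omega>" for B
    by (rule mass_le_hausdorff[OF R \<Omega> that])
qed simp

section \<open>Localization and kernel estimates\<close>

text \<open>The \<open>distr\<close> along the identity only replaces the \<sigma>-algebra on
  \<Omega> by the Borel sets of the whole space, on which the differentiation lemmas are
  formulated.\<close>

definition localize :: "'a::euclidean_space measure \<Rightarrow> 'a set \<Rightarrow> 'a measure" where
  "localize m K = distr (density m (\<lambda>x. ennreal (indicator K x))) borel (\<lambda>x. x)"

lemma sets_localize: "sets (localize m K) = sets borel"
  by (simp add: localize_def)

context
  fixes m :: "'a::euclidean_space measure" and K \<Omega> :: "'a set"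
  assumes m: "sets m = sets (restrict_space borel \<Omega>)" and K: "compact K" "K \<subseteq> \<Omega>" and fin: "emeasure m K < \<infinity>"
begin

lemma space_eq: "space m = \<Omega>"
  using sets_eq_imp_space_eq[OF m] by (simp add: space_restrict_space)

lemma K_in_sets: "K \<in> sets m"
  unfolding m sets_restrict_space using borel_compact[OF K(1)] K(2) by blast

lemma measurable_ident_density: "(\<lambda>x. x) \<in> borel_measurable (density m (\<lambda>x. ennreal (indicator K x)))"
proof -
  have "(\<lambda>x. x) \<in> borel_measurable m"
    unfolding measurable_cong_sets[OF m refl] by (rule measurable_restrict_space1) simp
  then show ?thesis by simp
qed

lemma emeasure_localize:
  assumes A: "A \<in> sets borel"
  shows "emeasure (localize m K) A = emeasure m (A \<inter> K)"
proof -
  have A\<Omega>: "A \<inter> \<Omega> \<in> sets m" unfolding m sets_restrict_space using A by blast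
  have "emeasure (localize m K) A = emeasure (density m (\<lambda>x. ennreal (indicator K x))) (A \<inter> \<Omega>)"
    unfolding localize_def using emeasure_distr[OF measurable_ident_density A] by (simp add: space_eq)
  also have "\<dots> = (\<integral>\<^sup>+x. ennreal (indicator K x) * indicator (A \<inter> \<Omega>) x \<partial>m)"
    using A\<Omega> K_in_sets by (intro emeasure_density) auto
  also have "\<dots> = (\<integral>\<^sup>+x. indicator (A \<inter> K) x \<partial>m)"
    using K(2) by (intro nn_integral_cong) (auto simp: indicator_def)
  also have "A \<inter> K = (A \<inter> \<Omega>) \<inter> K" using K(2) by blast
  then have "(\<integral>\<^sup>+x. indicator (A \<inter> K) x \<partial>m) = emeasure m (A \<inter> K)"
    using A\<Omega> K_in_sets by (intro nn_integral_indicator) auto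
  finally show ?thesis .
qed

lemma finite_measure_localize: "finite_measure (localize m K)"
  using emeasure_localize[of UNIV] fin by (intro finite_measureI) (simp add: localize_def less_top)

lemma measure_localize: "A \<in> sets borel \<Longrightarrow> A \<subseteq> K \<Longrightarrow> measure (localize m K) A = measure m A"
  by (simp add: measure_def emeasure_localize Int_absorb2)

lemma AE_localizeD:
  assumes "AE x in localize m K. P x"
  shows "AE x in m. x \<in> K \<longrightarrow> P x"
proof -
  have "AE x in density m (\<lambda>x. ennreal (indicator K x)). P x"
    using AE_distrD[OF measurable_ident_density assms[unfolded localize_def]] .
  then have "AE x in m. 0 < ennreal (indicator K x) \<longrightarrow> P x"
    using K_in_sets by (subst (asm) AE_density) auto
  then show ?thesis by eventually_elim (auto simp: indicator_def)
qed

lemma AE_localizeI: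
  assumes P: "Measurable.pred borel P" and ae: "AE x in m. x \<in> K \<longrightarrow> P x"
  shows "AE x in localize m K. P x"
proof -
  have "AE x in m. 0 < ennreal (indicator K x) \<longrightarrow> P x"
    using ae by eventually_elim (auto simp: indicator_def)
  then have "AE x in density m (\<lambda>x. ennreal (indicator K x)). P x"
    using K_in_sets by (subst AE_density) auto
  then show ?thesis
    unfolding localize_def using P by (subst AE_distr_iff[OF measurable_ident_density]) (auto simp: pred_def)
qed

lemma indicator_scaleR_borel_measurable:
  fixes f :: "'a \<Rightarrow> 'b::euclidean_space"
  assumes "(\<lambda>x. indicator K x *\<^sub>R f x) \<in> borel_measurable m" and "open \<Omega>"
  shows "(\<lambda>x. indicator K x *\<^sub>R f x) \<in> borel_measurable borel"
proof -
  have "(\<lambda>x. indicator K x *\<^sub>R f x) \<in> borel_measurable (restrict_space borel \<Omega>)"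
    using assms(1) measurable_cong_sets[OF m refl] by blast
  then have "(\<lambda>x. indicator \<Omega> x *\<^sub>R (indicator K x *\<^sub>R f x)) \<in> borel_measurable borel"
    using assms(2) by (subst (asm) borel_measurable_restrict_space_iff) auto
  moreover have "(\<lambda>x. indicator \<Omega> x *\<^sub>R (indicator K x *\<^sub>R f x)) = (\<lambda>x. indicator K x *\<^sub>R f x)"
    by (rule ext) (use K(2) in \<open>auto split: split_indicator\<close>)
  ultimately show ?thesis by metis
qed

lemma integral_localize:
  fixes f :: "'a \<Rightarrow> 'b::{banach, second_countable_topology}"
  assumes f: "f \<in> borel_measurable borel"
  shows "(LINT x|localize m K. f x) = (LINT x|m. indicator K x *\<^sub>R f x)"
    and "integrable (localize m K) f \<longleftrightarrow> integrable m (\<lambda>x. indicator K x *\<^sub>R f x)"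
proof -
  have fm: "f \<in> borel_measurable m"
    using measurable_compose[OF measurable_ident_density f] by simp
  have k: "(\<lambda>x. indicator K x :: real) \<in> borel_measurable m" using K_in_sets by simp
  show "(LINT x|localize m K. f x) = (LINT x|m. indicator K x *\<^sub>R f x)"
    unfolding localize_def integral_distr[OF measurable_ident_density f]
    by (rule integral_density[OF fm k]) simp
  show "integrable (localize m K) f \<longleftrightarrow> integrable m (\<lambda>x. indicator K x *\<^sub>R f x)"
    unfolding localize_def integrable_distr_eq[OF measurable_ident_density f]
    by (rule integrable_density[OF fm k]) simp
qed

end

section \<open>Kernel averages and their limits\<close>

lemma abs_integral_supported_le:
  fixes f w :: "'a::euclidean_space \<Rightarrow> real"
  assumes w: "integrable \<mu> w" and \<mu>: "sets \<mu> = sets borel" and w0: "\<And>y. w y \<ge> 0" and b: "b \<ge> 0"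
    and le: "AE y in \<mu>. \<bar>f y\<bar> \<le> b * (indicator (cball x s) y *\<^sub>R w y)"
  shows "\<bar>LINT y|\<mu>. f y\<bar> \<le> b * (LINT y:cball x s|\<mu>. w y)"
proof -
  have int: "integrable \<mu> (\<lambda>y. indicator (cball x s) y *\<^sub>R w y)"
    using w \<mu> by (intro integrable_mult_indicator) auto
  have "\<bar>LINT y|\<mu>. f y\<bar> \<le> (LINT y|\<mu>. \<bar>f y\<bar>)"
    using integral_norm_bound[of \<mu> f] by simp
  also have "\<dots> \<le> (LINT y|\<mu>. b * (indicator (cball x s) y *\<^sub>R w y))"
    by (rule integral_mono_AE'[OF integrable_mult_right[OF int] le]) (simp add: b w0)
  finally show ?thesis by (simp add: set_lebesgue_integral_def)
qed

lemma abs_integral_supported_mult_le: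
  fixes w :: "'a::euclidean_space \<Rightarrow> real"
  assumes w: "integrable \<mu> w" and \<mu>: "sets \<mu> = sets borel"
    and \<phi>: "\<And>y. \<bar>\<phi> y\<bar> \<le> b" "\<And>y. y \<notin> cball x s \<Longrightarrow> \<phi> y = 0"
  shows "\<bar>LINT y|\<mu>. \<phi> y * w y\<bar> \<le> b * (LINT y:cball x s|\<mu>. \<bar>w y\<bar>)"
proof (rule abs_integral_supported_le[OF integrable_abs[OF w] \<mu>])
  show "b \<ge> 0" using \<phi>(1)[of x] abs_ge_zero[of "\<phi> x"] by linarith
  show "AE y in \<mu>. \<bar>\<phi> y * w y\<bar> \<le> b * (indicator (cball x s) y *\<^sub>R \<bar>w y\<bar>)"
  proof (rule AE_I2)
    fix y
    show "\<bar>\<phi> y * w y\<bar> \<le> b * (indicator (cball x s) y *\<^sub>R \<bar>w y\<bar>)"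
      by (cases "y \<in> cball x s") (simp_all add: \<phi> abs_mult mult_right_mono)
  qed
qed simp

lemma kernel_profile_eq_0:
  assumes "kernel_profile \<rho>" "\<bar>t\<bar> > 1"
  shows "\<rho> t = 0"
proof (rule ccontr)
  assume "\<rho> t \<noteq> 0"
  then have "t \<in> spt \<rho>" unfolding spt_def by (intro closure_subset[THEN subsetD]) simp
  then have "t \<in> {-1..1}" using assms(1) unfolding kernel_profile_def by blast
  then show False using assms(2) by auto
qed

text \<open>A vanishing moment would make the continuous nonnegative profile zero on (0, 1], hence
  the radial kernel zero almost everywhere, against its integral 1.\<close>

lemma kernel_moment_pos:
  assumes \<rho>: "kernel_profile \<rho>" "continuous_on UNIV \<rho>"
    and int: "(LINT x|lborel. radial \<rho> (x :: real^'n)) = 1"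
  shows "(LBINT r:{0..1}. \<rho> r * r ^ k) > 0"
proof -
  let ?f = "\<lambda>r. \<rho> r * r ^ k"
  have cont: "continuous_on {0..1} ?f"
    by (intro continuous_intros continuous_on_subset[OF \<rho>(2)]) auto
  have nonneg: "?f r \<ge> 0" if "r \<in> {0..1}" for r using that \<rho>(1) by (auto simp: kernel_profile_def)
  have eq: "(LBINT r:{0..1}. ?f r) = integral {0..1} ?f"
    using borel_integrable_compact[OF compact_Icc cont]
    by (intro set_borel_integral_eq_integral) (simp add: set_integrable_def)
  have "integral {0..1} ?f \<ge> 0"
    using nonneg cont by (intro integral_nonneg integrable_continuous_real) auto
  moreover have "integral {0..1} ?f \<noteq> 0"
  proof
    assume "integral {0..1} ?f = 0"
    then have z: "?f r = 0" if "r \<in> {0..1}" for r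
      using integral_eq_0_iff[OF cont _ nonneg] that by simp
    have "radial \<rho> x = 0" if "x \<noteq> 0" for x :: "real^'n"
    proof (cases "norm x \<le> 1")
      case True
      then show ?thesis using z[of "norm x"] that by (auto simp: radial_def)
    qed (simp add: radial_def kernel_profile_eq_0[OF \<rho>(1)])
    then have "(LINT x|lborel. radial \<rho> (x :: real^'n)) = 0"
      using AE_lborel_singleton[of "0 :: real^'n"] by (intro Bochner_Integration.integral_eq_zero_AE) (auto elim: eventually_mono)
    then show False using int by simp
  qed
  ultimately show ?thesis unfolding eq by simp
qed

text \<open>Once a positive density exists, m(5e) / m(e) tends to 5^d, so the dilation in the
  covering estimates costs only a constant.\<close>

lemma tendsto_0_of_dilated_bound:
  fixes m :: "real \<Rightarrow> real"
  assumes dens: "((\<lambda>r. m r / r ^ d) \<longlongrightarrow> \<Theta>) (at_right 0)" "\<Theta> > 0"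
    and small: "\<And>c. c > 0 \<Longrightarrow> \<forall>\<^sub>F e in at_right 0. \<bar>E e\<bar> \<le> c * m (5 * e)"
  shows "((\<lambda>e. E e / m e) \<longlongrightarrow> 0) (at_right 0)"
proof (rule tendstoI)
  fix \<eta> :: real assume \<eta>: "\<eta> > 0"
  have lim5: "filterlim (\<lambda>e. 5 * e) (at_right 0) (at_right (0::real))"
    unfolding filterlim_at by (auto intro!: tendsto_eq_intros eventually_mono[OF eventually_at_right_less])
  have pos: "\<forall>\<^sub>F e in at_right 0. m e / e ^ d > 0" using dens by (rule order_tendstoD)
  have "((\<lambda>e. (m (5 * e) / (5 * e) ^ d) / (m e / e ^ d) * 5 ^ d) \<longlongrightarrow> \<Theta> / \<Theta> * 5 ^ d) (at_right 0)"
    using dens(2) by (intro tendsto_intros filterlim_compose[OF dens(1) lim5] dens(1)) auto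
  then have up: "\<forall>\<^sub>F e in at_right 0. (m (5 * e) / (5 * e) ^ d) / (m e / e ^ d) * 5 ^ d < 5 ^ d + 1"
    using dens(2) by (intro order_tendstoD) auto
  define c :: real where "c = \<eta> / (2 * (5 ^ d + 1))"
  have p5: "(5::real) ^ d + 1 > 0" by (intro add_pos_pos) auto
  have c: "c > 0" using \<eta> p5 by (simp add: c_def)
  show "\<forall>\<^sub>F e in at_right 0. dist (E e / m e) 0 < \<eta>"
    using pos up small[OF c] eventually_at_right_less[of 0]
  proof eventually_elim
    case (elim e)
    have me: "m e > 0" using elim(1,4) by (simp add: zero_less_divide_iff)
    have eq: "m (5 * e) / m e = (m (5 * e) / (5 * e) ^ d) / (m e / e ^ d) * 5 ^ d"
      using elim(4) by (simp add: power_mult_distrib)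
    have "m (5 * e) / m e < 5 ^ d + 1" by (rule ord_eq_less_trans[OF eq elim(2)])
    then have "m (5 * e) < (5 ^ d + 1) * m e" using me by (simp add: pos_divide_less_eq)
    then have "c * m (5 * e) < c * ((5 ^ d + 1) * m e)" using c by (rule mult_strict_left_mono)
    also have "\<dots> = \<eta> / 2 * m e" using p5 by (simp add: c_def field_simps)
    finally have "\<bar>E e\<bar> < \<eta> / 2 * m e" using elim(3) by linarith
    then have "\<bar>E e\<bar> / m e < \<eta> / 2" using me by (simp add: pos_divide_less_eq)
    moreover have "dist (E e / m e) 0 = \<bar>E e\<bar> / m e" using me by (simp add: dist_real_def abs_divide)
    ultimately show ?case using \<eta> by linarith
  qed
qed

text \<open>Used for each coordinate of the curvature. The average of h is split into h x times the
  average of 1 and a Lebesgue error; after division by the mass of the ball, this error and the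
  singular term vanish, and the kernel averages tend to the moments, which cancel the
  prefactor.\<close>

lemma approx_limit:
  fixes \<mu> \<nu> :: "'a::euclidean_space measure" and h s \<rho> \<xi> :: "_ \<Rightarrow> real"
  assumes \<mu>: "finite_measure \<mu>" "sets \<mu> = sets borel" and \<nu>: "finite_measure \<nu>" "sets \<nu> = sets borel"
    and h: "integrable \<mu> h" and s: "s \<in> borel_measurable borel" "AE y in \<nu>. \<bar>s y\<bar> \<le> 1"
    and d: "d \<ge> 1"
    and dens: "((\<lambda>r. measure \<mu> (cball x r) / r ^ d) \<longlongrightarrow> \<Theta>) (at_right 0)" "\<Theta> > 0"
    and leb: "\<And>c. c > 0 \<Longrightarrow> \<forall>\<^sub>F r in at_right 0. (LINT y:cball x r|\<mu>. \<bar>h y - h x\<bar>) \<le> c * measure \<mu> (cball x (5 * r))"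
    and sing: "\<And>c. c > 0 \<Longrightarrow> \<forall>\<^sub>F r in at_right 0. measure \<nu> (cball x r) \<le> c * measure \<mu> (cball x (5 * r))"
    and \<rho>: "continuous_on UNIV \<rho>" "\<And>t. t > 1 \<Longrightarrow> \<rho> t = 0" "(LBINT r:{0..1}. \<rho> r * r ^ (d - 1)) > 0"
    and \<xi>: "continuous_on UNIV \<xi>" "\<And>t. t > 1 \<Longrightarrow> \<xi> t = 0" "(LBINT r:{0..1}. \<xi> r * r ^ (d - 1)) > 0"
  shows "((\<lambda>e. (LBINT r:{0..1}. \<xi> r * r ^ (d - 1)) / (LBINT r:{0..1}. \<rho> r * r ^ (d - 1)) *
      (((LINT y|\<mu>. \<rho> (norm (y - x) / e) * h y) - (LINT y|\<nu>. \<rho> (norm (y - x) / e) * s y))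
        / (LINT y|\<mu>. \<xi> (norm (y - x) / e)))) \<longlongrightarrow> h x) (at_right 0)" (is ?L)
    and "\<forall>\<^sub>F e in at_right 0. (LINT y|\<mu>. \<xi> (norm (y - x) / e)) > 0" (is ?P)
proof -
  interpret \<mu>: finite_measure \<mu> by fact
  interpret \<nu>: finite_measure \<nu> by fact
  note [measurable_cong] = \<mu>(2) \<nu>(2)
  note [measurable] = s(1)
  let ?r = "\<lambda>e y. \<rho> (norm (y - x) / e)"
  have [measurable]: "\<rho> \<in> borel_measurable borel" using \<rho>(1) by (rule borel_measurable_continuous_onI)
  define m where "m r = measure \<mu> (cball x r)" for r
  define I where "I \<phi> = (LBINT r:{0..1}. \<phi> r * r ^ (d - 1))" for \<phi> :: "real \<Rightarrow> real"
  define A where "A \<phi> e = (LINT y|\<mu>. \<phi> (norm (y - x) / e))" for \<phi> :: "real \<Rightarrow> real" and e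
  define E1 where "E1 e = (LINT y|\<mu>. ?r e y * (h y - h x))" for e
  define E2 where "E2 e = (LINT y|\<nu>. ?r e y * s y)" for e
  have limA: "((\<lambda>e. A \<phi> e / m e) \<longlongrightarrow> d * I \<phi>) (at_right 0)"
    if "continuous_on UNIV \<phi>" "\<And>t. t > 1 \<Longrightarrow> \<phi> t = 0" for \<phi>
    unfolding A_def m_def I_def by (rule radial_integral_asymptotics[OF \<mu> d dens that])
  have mpos: "\<forall>\<^sub>F e in at_right 0. m e > 0"
  proof -
    have "\<forall>\<^sub>F e in at_right 0. m e / e ^ d > 0" unfolding m_def using dens by (rule order_tendstoD)
    then show ?thesis using eventually_at_right_less[of 0] by eventually_elim (simp add: zero_less_divide_iff)
  qed
  have dI\<xi>: "d * I \<xi> > 0" and dI\<rho>: "d * I \<rho> > 0" using d \<xi>(3) \<rho>(3) by (simp_all add: I_def)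
  have "\<forall>\<^sub>F e in at_right 0. A \<xi> e / m e > 0" using limA[OF \<xi>(1,2)] dI\<xi> by (rule order_tendstoD)
  then have A\<xi>: "\<forall>\<^sub>F e in at_right 0. A \<xi> e > 0"
    using mpos by eventually_elim (simp add: zero_less_divide_iff)
  then show ?P by (simp add: A_def)
  have "compact (\<rho> ` {0..1})" using \<rho>(1) by (intro compact_continuous_image) (auto intro: continuous_on_subset)
  then obtain B0 where B0: "\<And>t. t \<in> {0..1} \<Longrightarrow> norm (\<rho> t) \<le> B0" by (meson bounded_iff compact_imp_bounded imageI)
  define B where "B = max 1 B0"
  have B: "\<bar>?r e y\<bar> \<le> B" if "e > 0" for y e
    using B0[of "norm (y - x) / e"] \<rho>(2)[of "norm (y - x) / e"] that
    by (cases "norm (y - x) / e \<le> 1") (auto simp: B_def)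
  have Bpos: "B > 0" by (simp add: B_def)
  have supp: "?r e y = 0" if "e > 0" "y \<notin> cball x e" for y e
    using that by (intro \<rho>(2)) (simp add: dist_norm norm_minus_commute)
  have int\<rho>: "integrable \<mu> (\<lambda>y. ?r e y)" if "e > 0" for e
    using B[OF that] by (intro \<mu>.integrable_const_bound[where B=B]) auto
  have inth: "integrable \<mu> (\<lambda>y. h y - h x)" using h by simp
  have int1: "integrable \<mu> (\<lambda>y. ?r e y * (h y - h x))" if "e > 0" for e
  proof (rule Bochner_Integration.integrable_bound)
    show "integrable \<mu> (\<lambda>y. B * (h y - h x))" using inth by (rule integrable_mult_right)
    show "(\<lambda>y. ?r e y * (h y - h x)) \<in> borel_measurable \<mu>"
      using borel_measurable_integrable[OF inth] by measurable
    show "AE y in \<mu>. norm (?r e y * (h y - h x)) \<le> norm (B * (h y - h x))"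
      using B[OF that] Bpos by (intro AE_I2) (simp add: abs_mult mult_right_mono)
  qed
  have E1_le: "\<bar>E1 e\<bar> \<le> B * (LINT y:cball x e|\<mu>. \<bar>h y - h x\<bar>)" if "e > 0" for e
    unfolding E1_def using B[OF that] supp[OF that]
    by (intro abs_integral_supported_mult_le inth \<mu>(2))
  have E2_le: "\<bar>E2 e\<bar> \<le> B * measure \<nu> (cball x e)" if "e > 0" for e
  proof -
    have ints: "integrable \<nu> s" using s(2) by (intro \<nu>.integrable_const_bound[where B=1]) auto
    have "\<bar>E2 e\<bar> \<le> B * (LINT y:cball x e|\<nu>. \<bar>s y\<bar>)"
      unfolding E2_def using B[OF that] supp[OF that]
      by (intro abs_integral_supported_mult_le ints \<nu>(2))
    also have "(LINT y:cball x e|\<nu>. \<bar>s y\<bar>) \<le> (LINT y:cball x e|\<nu>. 1)"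
      unfolding set_lebesgue_integral_def
    proof (rule integral_mono_AE)
      show "integrable \<nu> (\<lambda>y. indicator (cball x e) y *\<^sub>R \<bar>s y\<bar>)"
        using ints \<nu>(2) by (intro integrable_mult_indicator integrable_abs) auto
      show "integrable \<nu> (\<lambda>y. indicator (cball x e) y *\<^sub>R (1::real))"
        using \<nu>(2) by (intro integrable_mult_indicator) auto
      show "AE y in \<nu>. indicator (cball x e) y *\<^sub>R \<bar>s y\<bar> \<le> indicator (cball x e) y *\<^sub>R 1"
        using s(2) by eventually_elim (auto split: split_indicator)
    qed
    also have "(LINT y:cball x e|\<nu>. 1) = measure \<nu> (cball x e)"
      using \<nu>(2) by (simp add: set_lebesgue_integral_def sets_eq_imp_space_eq)
    finally show ?thesis using Bpos by (simp add: mult_left_mono)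
  qed
  have lim0: "((\<lambda>e. E e / m e) \<longlongrightarrow> 0) (at_right 0)"
    if le: "\<And>e. e > 0 \<Longrightarrow> \<bar>E e\<bar> \<le> B * G e"
      and small: "\<And>c. c > 0 \<Longrightarrow> \<forall>\<^sub>F r in at_right 0. G r \<le> c * m (5 * r)" for E G
  proof (rule tendsto_0_of_dilated_bound[OF dens[folded m_def]])
    fix c :: real assume "c > 0"
    then have "\<forall>\<^sub>F r in at_right 0. G r \<le> c / B * m (5 * r)"
      using Bpos by (intro small) simp
    then show "\<forall>\<^sub>F e in at_right 0. \<bar>E e\<bar> \<le> c * m (5 * e)"
      using eventually_at_right_less[of 0]
    proof eventually_elim
      case (elim e)
      have "\<bar>E e\<bar> \<le> B * (c / B * m (5 * e))"
        using le[OF elim(2)] mult_left_mono[OF elim(1), of B] Bpos by linarith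
      then show ?case using Bpos by simp
    qed
  qed
  note lim1 = lim0[OF E1_le leb[folded m_def]] and lim2 = lim0[OF E2_le sing[folded m_def]]
  have "((\<lambda>e. I \<xi> / I \<rho> * ((h x * (A \<rho> e / m e) + E1 e / m e - E2 e / m e) / (A \<xi> e / m e)))
      \<longlongrightarrow> I \<xi> / I \<rho> * ((h x * (d * I \<rho>) + 0 - 0) / (d * I \<xi>))) (at_right 0)"
    using d \<xi>(3) by (intro tendsto_intros limA \<rho>(1,2) \<xi>(1,2) lim1 lim2) (auto simp: I_def)
  also have "I \<xi> / I \<rho> * ((h x * (d * I \<rho>) + 0 - 0) / (d * I \<xi>)) = h x"
    using d \<xi>(3) \<rho>(3) by (simp add: I_def)
  finally have "((\<lambda>e. I \<xi> / I \<rho> * (((LINT y|\<mu>. ?r e y * h y) - E2 e) / A \<xi> e)) \<longlongrightarrow> h x) (at_right 0)"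
  proof (rule Lim_transform_eventually)
    show "\<forall>\<^sub>F e in at_right 0. I \<xi> / I \<rho> * ((h x * (A \<rho> e / m e) + E1 e / m e - E2 e / m e) / (A \<xi> e / m e))
        = I \<xi> / I \<rho> * (((LINT y|\<mu>. ?r e y * h y) - E2 e) / A \<xi> e)"
      using mpos A\<xi> eventually_at_right_less[of 0]
    proof eventually_elim
      case (elim e)
      have "(LINT y|\<mu>. ?r e y * h y)
          = (LINT y|\<mu>. h x * ?r e y + ?r e y * (h y - h x))"
        by (intro Bochner_Integration.integral_cong refl) (simp add: algebra_simps)
      also have "\<dots> = h x * A \<rho> e + E1 e"
        unfolding A_def E1_def using int\<rho>[OF elim(3)] int1[OF elim(3)] by simp
      finally have e1: "(LINT y|\<mu>. ?r e y * h y) = h x * A \<rho> e + E1 e" .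
      have "h x * (A \<rho> e / m e) + E1 e / m e - E2 e / m e = (h x * A \<rho> e + E1 e - E2 e) / m e"
        by (simp add: diff_divide_distrib add_divide_distrib)
      then show ?case unfolding e1 using elim(1) by simp
    qed
  qed
  then show ?L
    by (simp add: I_def A_def E2_def)
qed

section \<open>First variation of the test fields\<close>

lemma continuous_on_matrix_vector_mult [continuous_intros]:
  fixes A :: "'a::topological_space \<Rightarrow> real^'n^'m"
  assumes "continuous_on S A" "continuous_on S z"
  shows "continuous_on S (\<lambda>p. A p *v z p)"
  unfolding matrix_vector_mult_def by (intro continuous_intros assms)

lemma C1_continuous_on: "C1 f \<Longrightarrow> continuous_on S f"
  unfolding C1_def by (meson continuous_at_imp_continuous_on has_derivative_continuous)

context
  fixes \<Omega> :: "(real^'n) set" and V :: "((real^'n) \<times> (real^'n^'n)) measure"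
    and \<rho> :: "real \<Rightarrow> real" and x :: "real^'n" and e :: real
  assumes V: "varifold CARD('d::finite) \<Omega> V" and \<rho>: "kernel_profile \<rho>" "C1 \<rho>"
    and e: "e > 0" "cball x e \<subseteq> \<Omega>"
begin

lemma scaled_radial: "scaled e (radial \<rho>) (z :: real^'n) = \<rho> (norm z / e) / e ^ CARD('n)"
  using e(1) by (simp add: scaled_def radial_def)

lemma scaled_radial_eq_0: "norm (z :: real^'n) > e \<Longrightarrow> scaled e (radial \<rho>) z = 0"
  using e(1) by (simp add: scaled_radial kernel_profile_eq_0[OF \<rho>(1)])

lemma C1_scaled_radial: "C1 (\<lambda>y :: real^'n. scaled e (radial \<rho>) (y - z) *\<^sub>R (v :: 'b::real_normed_vector))"
proof -
  have "C1 (radial \<rho> :: real^'n \<Rightarrow> real)" using \<rho> by (intro C1_radial) (auto simp: kernel_profile_def)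
  from C1_compose_affine[OF this, of "1 / e" z "(1 / e ^ CARD('n)) *\<^sub>R v"]
  show ?thesis by (simp add: scaled_def)
qed

lemma mollifier_field_Cc1: "(\<lambda>y. scaled e (radial \<rho>) (y - x) *\<^sub>R (v :: real^'n)) \<in> Cc1 \<Omega>"
proof -
  have "compact (cball x e)" by simp
  then have "compact (spt (\<lambda>y. scaled e (radial \<rho>) (y - x) *\<^sub>R v))"
      "spt (\<lambda>y. scaled e (radial \<rho>) (y - x) *\<^sub>R v) \<subseteq> cball x e"
    by (rule spt_subset; simp add: scaled_radial_eq_0 dist_norm norm_minus_commute)+
  then show ?thesis using C1_scaled_radial e(2) unfolding Cc1_def by blast
qed

text \<open>The gradient of the kernel vanishes outside the closed ball, so the vector-valued
  integrand is integrable and taking a coordinate commutes with the integral.\<close>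

lemma first_variation_conv_nth:
  "first_variation_conv \<rho> e V x $ j = first_variation V (\<lambda>y. scaled e (radial \<rho>) (y - x) *\<^sub>R axis j 1)"
proof -
  let ?s = "scaled e (radial \<rho>) :: real^'n \<Rightarrow> real"
  have "C1 ?s" using C1_scaled_radial[of 0 "1::real"] by simp
  then obtain s' where s': "\<And>z. (?s has_derivative s' z) (at z)" "\<And>h. continuous_on UNIV (\<lambda>z. s' z h)"
    using C1E by blast
  have grad: "gradient ?s z = (\<chi> i. s' z (axis i 1))" for z by (rule gradient_eq[OF s'(1)])
  have grad0: "gradient ?s z = 0" if "norm z > e" for z
  proof -
    have "open {z :: real^'n. norm z > e}" by (intro open_Collect_less continuous_intros)
    from has_derivative_transform_within_open[OF _ this, of "\<lambda>_. 0" "\<lambda>_. 0" z UNIV ?s]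
    have "(?s has_derivative (\<lambda>_. 0)) (at z)" using that by (simp add: scaled_radial_eq_0)
    from gradient_eq[OF this] show ?thesis by (simp add: vec_eq_iff)
  qed
  have "continuous_on UNIV (gradient ?s)" unfolding grad[abs_def] by (intro continuous_on_vec_lambda s'(2))
  then have "continuous_on (\<Omega> \<times> grassmannian CARD('d)) (\<lambda>p :: (real^'n) \<times> (real^'n^'n). gradient ?s (fst p - x))"
    by (rule continuous_on_compose2) (auto intro!: continuous_intros)
  then have int: "integrable V (\<lambda>p. snd p *v gradient ?s (fst p - x))"
    using e(2) grad0
    by (intro integrable_varifold[OF V _ compact_cball e(2)] continuous_intros)
      (auto simp: dist_norm norm_minus_commute)
  have "first_variation_conv \<rho> e V x $ j = (LINT p|V. (snd p *v gradient ?s (fst p - x)) $ j)"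
    unfolding first_variation_conv_def case_prod_beta
    by (rule integral_bounded_linear[OF bounded_linear_vec_nth int, symmetric])
  also have "\<dots> = first_variation V (\<lambda>y. ?s (y - x) *\<^sub>R axis j 1)"
    unfolding first_variation_def case_prod_beta by (simp add: tangential_div_scaleR_axis[OF s'(1)])
  finally show ?thesis .
qed

end

text \<open>Because the cutoff is nonincreasing, replacing <Pz, z> by the larger |z|^2 in the
  divergence of \<open>X\<close> can only lower it. This is the monotonicity inequality; the bound a
  r on |X| supplies the decisive factor r of its error.\<close>

lemma first_variation_cutoff_field_ge:
  fixes \<Omega> :: "(real^'n) set" and V :: "((real^'n) \<times> (real^'n^'n)) measure"
  assumes V: "varifold CARD('d::finite) \<Omega> V" and a: "a > 1" and r: "r > 0" and sub: "cball x (a * r) \<subseteq> \<Omega>"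
  defines "X \<equiv> \<lambda>y. cutoff (a\<^sup>2) ((norm (y - x) / r)\<^sup>2) *\<^sub>R (y - x)"
  shows "X \<in> Cc1 \<Omega>" and "\<And>y. y \<notin> cball x (a * r) \<Longrightarrow> X y = 0" and "\<And>y. norm (X y) \<le> a * r"
    and "real CARD('d) * (LINT y|mass \<Omega> V. cutoff (a\<^sup>2) ((norm (y - x) / r)\<^sup>2))
        + 2 * (LINT y|mass \<Omega> V. cutoff' (a\<^sup>2) ((norm (y - x) / r)\<^sup>2) * (norm (y - x) / r)\<^sup>2)
      \<le> first_variation V X" (is ?I)
proof -
  have a2: "a\<^sup>2 > 1" using a by simp
  define \<tau> where "\<tau> y = (norm (y - x) / r)\<^sup>2" for y
  note der = has_real_derivative_cutoff[OF a2] and cont' = continuous_cutoff'[OF a2]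
  have \<tau>_ge: "\<tau> y \<ge> a\<^sup>2" if "y \<notin> cball x (a * r)" for y
  proof -
    have "norm (y - x) / r \<ge> a" using that r by (simp add: dist_norm norm_minus_commute field_simps)
    then show ?thesis unfolding \<tau>_def using a by (intro power_mono) auto
  qed
  show X0: "X y = 0" if "y \<notin> cball x (a * r)" for y
    using \<tau>_ge[OF that] unfolding X_def \<tau>_def by (simp add: cutoff_eq_0[OF a2])
  show "norm (X y) \<le> a * r" for y
  proof (cases "y \<in> cball x (a * r)")
    case True
    have "norm (X y) = cutoff (a\<^sup>2) (\<tau> y) * norm (y - x)"
      unfolding X_def \<tau>_def using cutoff_bounds[OF a2] by simp
    also have "\<dots> \<le> 1 * (a * r)"
      using True cutoff_bounds[OF a2] by (intro mult_mono) (auto simp: dist_norm norm_minus_commute)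
    finally show ?thesis by simp
  next
    case False
    then show ?thesis using X0 a r by simp
  qed
  have "compact (spt X)" "spt X \<subseteq> cball x (a * r)"
    by (rule spt_subset[OF compact_cball X0]; assumption)+
  then show "X \<in> Cc1 \<Omega>"
    using C1_cutoff_field(2)[OF der cont', of x r] sub unfolding Cc1_def X_def by blast
  have contc: "continuous_on UNIV (cutoff (a\<^sup>2))"
    using der by (intro continuous_at_imp_continuous_on) (auto intro: DERIV_isCont)
  have cont\<tau>: "continuous_on S \<tau>" for S
    unfolding \<tau>_def divide_inverse by (intro continuous_intros)
  have cont1: "continuous_on S (\<lambda>y. cutoff (a\<^sup>2) (\<tau> y))" for S
    by (rule continuous_on_compose2[OF contc cont\<tau>]) simp
  have cont2: "continuous_on S (\<lambda>y. cutoff' (a\<^sup>2) (\<tau> y))" for S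
    by (rule continuous_on_compose2[OF cont' cont\<tau>]) simp
  have cfst: "continuous_on S (\<lambda>p :: (real^'n) \<times> (real^'n^'n). f (fst p))" if "continuous_on UNIV f" for S and f :: "real^'n \<Rightarrow> real"
    by (rule continuous_on_compose2[OF that continuous_on_fst[OF continuous_on_id]]) simp
  define F1 where "F1 p = cutoff (a\<^sup>2) (\<tau> (fst p))" for p :: "(real^'n) \<times> (real^'n^'n)"
  define F2 where "F2 p = cutoff' (a\<^sup>2) (\<tau> (fst p)) * \<tau> (fst p)" for p :: "(real^'n) \<times> (real^'n^'n)"
  define F3 where "F3 p = 2 * cutoff' (a\<^sup>2) (\<tau> (fst p)) * ((snd p *v (fst p - x)) \<bullet> (fst p - x)) * inverse (r\<^sup>2)"
    for p :: "(real^'n) \<times> (real^'n^'n)"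
  have int1: "integrable V F1"
    by (rule integrable_varifold[OF V _ compact_cball sub])
      (auto simp: F1_def cutoff_eq_0[OF a2] \<tau>_ge intro!: cfst cont1)
  have int2: "integrable V F2"
    by (rule integrable_varifold[OF V _ compact_cball sub])
      (auto simp: F2_def cutoff'_eq_0[OF a2] \<tau>_ge intro!: continuous_on_mult cfst cont2 cont\<tau>)
  have int3: "integrable V F3"
  proof (rule integrable_varifold[OF V _ compact_cball sub])
    show "continuous_on (\<Omega> \<times> grassmannian CARD('d)) F3"
      unfolding F3_def by (intro continuous_intros cfst cont2)
    show "F3 (y, P) = 0" if "y \<notin> cball x (a * r)" for y P
      using \<tau>_ge[OF that] by (simp add: F3_def cutoff'_eq_0[OF a2])
  qed
  have mass_int: "(LINT y|mass \<Omega> V. f y) = (LINT p|V. f (fst p))" if "continuous_on UNIV f" for f :: "real^'n \<Rightarrow> real"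
    using that by (intro integral_mass[OF V] borel_measurable_continuous_on_restrict) (rule continuous_on_subset, auto)
  have m1: "(LINT y|mass \<Omega> V. cutoff (a\<^sup>2) (\<tau> y)) = (LINT p|V. F1 p)"
    unfolding F1_def by (rule mass_int[OF cont1])
  have m2: "(LINT y|mass \<Omega> V. cutoff' (a\<^sup>2) (\<tau> y) * \<tau> y) = (LINT p|V. F2 p)"
    unfolding F2_def by (rule mass_int) (intro continuous_on_mult cont2 cont\<tau>)
  have "real CARD('d) * (LINT y|mass \<Omega> V. cutoff (a\<^sup>2) (\<tau> y)) + 2 * (LINT y|mass \<Omega> V. cutoff' (a\<^sup>2) (\<tau> y) * \<tau> y)
      = (LINT p|V. real CARD('d) * F1 p + 2 * F2 p)"
    using int1 int2 by (simp add: m1 m2)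
  also have "\<dots> \<le> (LINT p|V. real CARD('d) * F1 p + F3 p)"
  proof (rule integral_mono)
    fix p assume "p \<in> space V"
    then have P: "snd p \<in> grassmannian CARD('d)" by (auto simp: space_varifold[OF V])
    have "(snd p *v (fst p - x)) \<bullet> (fst p - x) * inverse (r\<^sup>2) \<le> (norm (fst p - x))\<^sup>2 * inverse (r\<^sup>2)"
      using grassmannianD(2)[OF P] by (intro mult_right_mono) auto
    also have "\<dots> = \<tau> (fst p)" by (simp add: \<tau>_def power_mult_distrib divide_inverse power_inverse)
    finally have "cutoff' (a\<^sup>2) (\<tau> (fst p)) * \<tau> (fst p)
        \<le> cutoff' (a\<^sup>2) (\<tau> (fst p)) * ((snd p *v (fst p - x)) \<bullet> (fst p - x) * inverse (r\<^sup>2))"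
      using cutoff'_nonpos[OF a2] by (rule mult_left_mono_neg)
    then show "real CARD('d) * F1 p + 2 * F2 p \<le> real CARD('d) * F1 p + F3 p"
      by (simp add: F2_def F3_def mult.assoc)
  qed (use int1 int2 int3 in auto)
  also have "\<dots> = first_variation V X"
    unfolding first_variation_def case_prod_beta
  proof (rule Bochner_Integration.integral_cong[OF refl])
    fix p assume "p \<in> space V"
    then have P: "snd p \<in> grassmannian CARD('d)" by (auto simp: space_varifold[OF V])
    show "real CARD('d) * F1 p + F3 p = tangential_div (snd p) X (fst p)"
      unfolding X_def tangential_div_cutoff_field[OF der cont'] grassmannianD(1)[OF P]
      by (simp add: F1_def F3_def \<tau>_def divide_inverse mult_ac)
  qed
  finally show ?I
    unfolding \<tau>_def .
qed

section \<open>Convergence\<close>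

text \<open>The pointwise half of the argument: the last three assumptions describe a good point x,
  and only balls inside \<open>K\<close> matter as the scale tends to 0.\<close>

lemma approx_mean_curvature_tendsto:
  fixes \<Omega> :: "(real^'n) set" and V :: "((real^'n) \<times> (real^'n^'n)) measure"
    and H \<sigma> :: "real^'n \<Rightarrow> real^'n"
  assumes \<rho>: "kernel_profile \<rho>" "C1 \<rho>" "(LINT x|lborel. radial \<rho> (x :: real^'n)) = 1"
    and \<xi>: "kernel_profile \<xi>" "continuous_on UNIV \<xi>" "(LINT x|lborel. radial \<xi> (x :: real^'n)) = 1"
    and \<Omega>: "open \<Omega>" and V: "varifold CARD('d::finite) \<Omega> V"
    and H: "L1_loc \<Omega> (mass \<Omega> V) H" and \<nu>: "radon_measure_on \<Omega> \<nu>"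
    and \<sigma>: "\<sigma> \<in> borel_measurable \<nu>" "AE x in \<nu>. norm (\<sigma> x) = 1"
    and rep: "\<And>X. X \<in> Cc1 \<Omega> \<Longrightarrow>
      first_variation V X + (LINT x|mass \<Omega> V. X x \<bullet> H x) = (LINT x|\<nu>. X x \<bullet> \<sigma> x)"
    and K: "K = cball a R" "K \<subseteq> \<Omega>" and x: "x \<in> ball a R"
    and leb: "\<And>c. c > 0 \<Longrightarrow> \<forall>\<^sub>F r in at_right 0.
      (LINT y:cball x r|localize (mass \<Omega> V) K. norm (indicator K y *\<^sub>R H y - indicator K x *\<^sub>R H x))
        \<le> c * measure (localize (mass \<Omega> V) K) (cball x (5 * r))"
    and sing: "\<And>c. c > 0 \<Longrightarrow> \<forall>\<^sub>F r in at_right 0.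
      measure (localize \<nu> K) (cball x r) \<le> c * measure (localize (mass \<Omega> V) K) (cball x (5 * r))"
    and nz: "\<not> ((\<lambda>r. measure (mass \<Omega> V) (cball x r) / r ^ CARD('d)) \<longlongrightarrow> 0) (at_right 0)"
  shows "\<forall>\<^sub>F e in at_right 0. cball x e \<subseteq> \<Omega> \<and> mass_conv \<xi> e \<Omega> V x > 0" (is ?P)
    and "((\<lambda>e. approx_mean_curvature CARD('d) \<rho> \<xi> e \<Omega> V x) \<longlongrightarrow> H x) (at_right 0)" (is ?L)
proof -
  define \<mu> where "\<mu> = localize (mass \<Omega> V) K"
  define \<nu>' where "\<nu>' = localize \<nu> K"
  define h where "h y = indicator K y *\<^sub>R H y" for y
  define s where "s y = indicator K y *\<^sub>R \<sigma> y" for y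
  let ?m = "\<lambda>r. measure \<mu> (cball x r)" and ?n = "\<lambda>r. measure \<nu>' (cball x r)"
  let ?h = "\<lambda>r. LINT y:cball x r|\<mu>. norm (h y)"
  let ?t = "\<lambda>r y. (norm (y - x) / r)\<^sup>2"
  let ?r = "\<lambda>e y. \<rho> (norm (y - x) / e)"
  let ?a = "\<lambda>e. approx_mean_curvature CARD('d) \<rho> \<xi> e \<Omega> V x"
  have cK: "compact K" using K(1) by simp
  have xK: "x \<in> K" using x K(1) by auto
  note mass_loc = sets_mass[OF V] cK K(2) emeasure_mass_finite[OF V cK K(2)]
  have sets_\<nu>: "sets \<nu> = sets (restrict_space borel \<Omega>)" and fin_\<nu>: "emeasure \<nu> K < \<infinity>"
    using \<nu> cK K(2) by (auto simp: radon_measure_on_def)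
  note \<nu>_loc = sets_\<nu> cK K(2) fin_\<nu>
  have \<mu>: "finite_measure \<mu>" "sets \<mu> = sets borel"
    unfolding \<mu>_def by (rule finite_measure_localize[OF mass_loc], rule sets_localize)
  have \<nu>': "finite_measure \<nu>'" "sets \<nu>' = sets borel"
    unfolding \<nu>'_def by (rule finite_measure_localize[OF \<nu>_loc], rule sets_localize)
  interpret \<mu>: finite_measure \<mu> by fact
  interpret \<nu>': finite_measure \<nu>' by fact
  have int_H: "integrable (mass \<Omega> V) (\<lambda>y. indicator K y *\<^sub>R H y)"
    using H cK K(2) by (simp add: L1_loc_def set_integrable_def)
  have h_borel: "h \<in> borel_measurable borel"
    unfolding h_def[abs_def] by (rule indicator_scaleR_borel_measurable[OF mass_loc borel_measurable_integrable[OF int_H] \<Omega>])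
  have s_borel: "s \<in> borel_measurable borel"
    unfolding s_def[abs_def] using \<sigma>(1) K_in_sets[OF \<nu>_loc]
    by (intro indicator_scaleR_borel_measurable[OF \<nu>_loc _ \<Omega>] borel_measurable_scaleR) auto
  note [measurable] = h_borel s_borel
  note [measurable_cong] = \<mu>(2) \<nu>'(2)
  have int_h: "integrable \<mu> h"
  proof -
    have "(\<lambda>y. indicator K y *\<^sub>R h y) = (\<lambda>y. indicator K y *\<^sub>R H y)"
      by (auto simp: h_def split: split_indicator)
    then show ?thesis unfolding \<mu>_def integral_localize(2)[OF mass_loc h_borel] using int_H by simp
  qed
  have s_le: "AE y in \<nu>'. norm (s y) \<le> 1"
    unfolding \<nu>'_def
  proof (rule AE_localizeI[OF \<nu>_loc])
    show "Measurable.pred borel (\<lambda>y. norm (s y) \<le> 1)" by measurable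
    show "AE y in \<nu>. y \<in> K \<longrightarrow> norm (s y) \<le> 1" using \<sigma>(2) by eventually_elim (simp add: s_def)
  qed
  \<comment> \<open>Closed balls about x of radius up to \<open>R0\<close> stay in \<open>K\<close>,
    so the localized measures and the original ones agree on them.\<close>
  define R0 where "R0 = R - dist a x"
  have R0: "R0 > 0" using x by (simp add: R0_def)
  have sub: "cball x r \<subseteq> K" if "r \<le> R0" for r
  proof
    fix y assume "y \<in> cball x r"
    then show "y \<in> K" using that dist_triangle[of a y x] by (simp add: K(1) R0_def)
  qed
  have fv: "first_variation V X = (LINT y|\<nu>'. X y \<bullet> s y) - (LINT y|\<mu>. X y \<bullet> h y)"
    if X: "X \<in> Cc1 \<Omega>" and X0: "\<And>y. y \<notin> K \<Longrightarrow> X y = 0" for X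
  proof -
    have [measurable]: "X \<in> borel_measurable borel"
      using X by (intro borel_measurable_continuous_onI C1_continuous_on) (simp add: Cc1_def)
    have "(LINT y|\<nu>'. X y \<bullet> s y) = (LINT y|\<nu>. indicator K y *\<^sub>R (X y \<bullet> s y))"
      unfolding \<nu>'_def by (rule integral_localize(1)[OF \<nu>_loc]) measurable
    also have "\<dots> = (LINT y|\<nu>. X y \<bullet> \<sigma> y)"
      using X0 by (intro Bochner_Integration.integral_cong refl) (auto simp: s_def split: split_indicator)
    finally have 1: "(LINT y|\<nu>'. X y \<bullet> s y) = (LINT y|\<nu>. X y \<bullet> \<sigma> y)" .
    have "(LINT y|\<mu>. X y \<bullet> h y) = (LINT y|mass \<Omega> V. indicator K y *\<^sub>R (X y \<bullet> h y))"
      unfolding \<mu>_def by (rule integral_localize(1)[OF mass_loc]) measurable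
    also have "\<dots> = (LINT y|mass \<Omega> V. X y \<bullet> H y)"
      using X0 by (intro Bochner_Integration.integral_cong refl) (auto simp: h_def split: split_indicator)
    finally show ?thesis using 1 rep[OF X] by simp
  qed
  \<comment> \<open>The first variation is bounded by the sup norm of the field times its total
    variation on the ball, the latter split into singular part and curvature part.\<close>
  have fv_le: "first_variation V X
      \<le> b * (?n r + ?h r)"
    if X: "X \<in> Cc1 \<Omega>" and X0: "\<And>y. y \<notin> cball x r \<Longrightarrow> X y = 0" and b: "\<And>y. norm (X y) \<le> b" and r: "r \<le> R0" for X b r
  proof -
    have b0: "b \<ge> 0" using b[of x] norm_ge_zero[of "X x"] by linarith
    have XK: "X y = 0" if "y \<notin> K" for y using that X0 sub[OF r] by blast
    have "\<bar>LINT y|\<nu>'. X y \<bullet> s y\<bar> \<le> b * (LINT y:cball x r|\<nu>'. 1)"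
    proof (rule abs_integral_supported_le)
      show "AE y in \<nu>'. \<bar>X y \<bullet> s y\<bar> \<le> b * (indicator (cball x r) y *\<^sub>R 1)"
        using s_le
      proof eventually_elim
        case (elim y)
        show ?case
        proof (cases "y \<in> cball x r")
          case True
          have "\<bar>X y \<bullet> s y\<bar> \<le> norm (X y) * norm (s y)" by (rule Cauchy_Schwarz_ineq2)
          also have "\<dots> \<le> b * 1" using b elim b0 by (intro mult_mono) auto
          finally show ?thesis using True by simp
        qed (simp add: X0)
      qed
    qed (use b0 \<nu>' in auto)
    also have "(LINT y:cball x r|\<nu>'. 1) = ?n r"
      using \<nu>'(2) by (simp add: set_lebesgue_integral_def sets_eq_imp_space_eq)
    finally have 1: "\<bar>LINT y|\<nu>'. X y \<bullet> s y\<bar> \<le> b * ?n r" .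
    have 2: "\<bar>LINT y|\<mu>. X y \<bullet> h y\<bar> \<le> b * ?h r"
    proof (rule abs_integral_supported_le)
      show "AE y in \<mu>. \<bar>X y \<bullet> h y\<bar> \<le> b * (indicator (cball x r) y *\<^sub>R norm (h y))"
      proof (rule AE_I2)
        fix y
        show "\<bar>X y \<bullet> h y\<bar> \<le> b * (indicator (cball x r) y *\<^sub>R norm (h y))"
        proof (cases "y \<in> cball x r")
          case True
          have "\<bar>X y \<bullet> h y\<bar> \<le> norm (X y) * norm (h y)" by (rule Cauchy_Schwarz_ineq2)
          also have "\<dots> \<le> b * norm (h y)" using b by (intro mult_right_mono) auto
          finally show ?thesis using True by simp
        qed (simp add: X0)
      qed
    qed (use b0 \<mu> int_h in \<open>auto intro: integrable_norm\<close>)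
    have "first_variation V X = (LINT y|\<nu>'. X y \<bullet> s y) - (LINT y|\<mu>. X y \<bullet> h y)"
      by (rule fv[OF X]) (rule XK)
    then show ?thesis using 1 2 unfolding distrib_left by linarith
  qed
  note leb' = leb[folded \<mu>_def h_def] and sing' = sing[folded \<mu>_def \<nu>'_def]
  have int_h': "integrable \<mu> (\<lambda>y. norm (h y - h x))"
    using int_h by (intro integrable_norm Bochner_Integration.integrable_diff) auto
  have ind_int: "integrable \<mu> (\<lambda>y. indicator (cball x r) y *\<^sub>R f y)" if "integrable \<mu> f" for r and f :: "_ \<Rightarrow> real"
    using that \<mu>(2) by (intro integrable_mult_indicator) auto
  \<comment> \<open>The 2 counts the singular part and the Lebesgue error, both estimated with
    constant 1; |h x| comes from the constant part of h.\<close>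
  define C where "C = 2 + norm (h x)"
  have C: "C \<ge> 0" by (simp add: C_def)
  have "\<forall>\<^sub>F r in at_right 0. ?n r + ?h r \<le> C * ?m (5 * r)"
    using leb'[OF zero_less_one] sing'[OF zero_less_one] eventually_at_right_less[of 0]
  proof eventually_elim
    case (elim r)
    have "?h r \<le> (LINT y:cball x r|\<mu>. norm (h y - h x) + norm (h x))"
      unfolding set_lebesgue_integral_def
    proof (rule integral_mono)
      show "integrable \<mu> (\<lambda>y. indicator (cball x r) y *\<^sub>R norm (h y))"
        using int_h by (intro ind_int integrable_norm)
      show "integrable \<mu> (\<lambda>y. indicator (cball x r) y *\<^sub>R (norm (h y - h x) + norm (h x)))"
        using int_h' by (intro ind_int Bochner_Integration.integrable_add) auto
      fix y
      have "norm (h y) \<le> norm (h y - h x) + norm (h x)" by norm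
      then show "indicator (cball x r) y *\<^sub>R norm (h y) \<le> indicator (cball x r) y *\<^sub>R (norm (h y - h x) + norm (h x))"
        by (intro scaleR_left_mono) auto
    qed
    also have "\<dots> = (LINT y:cball x r|\<mu>. norm (h y - h x)) + (LINT y:cball x r|\<mu>. norm (h x))"
      using ind_int[OF int_h'] ind_int[of "\<lambda>_. norm (h x)"] by (intro set_integral_add) (auto simp: set_integrable_def)
    also have "(LINT y:cball x r|\<mu>. norm (h x)) = norm (h x) * ?m r"
      using \<mu>(2) by (simp add: set_lebesgue_integral_def sets_eq_imp_space_eq)
    also have "\<dots> \<le> norm (h x) * ?m (5 * r)"
      using elim(3) \<mu>(2) by (intro mult_left_mono \<mu>.finite_measure_mono) auto
    finally show ?case using elim(1,2) by (simp add: C_def algebra_simps)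
  qed
  then obtain R1 where R1: "R1 > 0" "\<And>r. 0 < r \<Longrightarrow> r < R1 \<Longrightarrow>
      ?n r + ?h r \<le> C * ?m (5 * r)"
    unfolding eventually_at_right_field by blast
  have mass_eq: "(LINT y|mass \<Omega> V. f y) = (LINT y|\<mu>. f y)"
    if "f \<in> borel_measurable borel" "\<And>y. y \<notin> K \<Longrightarrow> f y = 0" for f :: "real^'n \<Rightarrow> real"
    unfolding \<mu>_def integral_localize(1)[OF mass_loc that(1)]
    using that(2) by (intro Bochner_Integration.integral_cong refl) (auto split: split_indicator)
  obtain \<Theta> where \<Theta>: "((\<lambda>r. ?m r / r ^ CARD('d)) \<longlongrightarrow> \<Theta>) (at_right 0)"
  proof (rule ball_density_converges[OF \<mu>, of "min R0 R1" C "CARD('d)" x])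
    show "min R0 R1 > 0" using R0 R1 by simp
    fix b r :: real
    assume b: "1 < b" "b \<le> 2" and r: "0 < r" "b * r < min R0 R1"
    have b2: "b\<^sup>2 > 1" using b by simp
    have "cball x (b * r) \<subseteq> \<Omega>" using sub[of "b * r"] r K(2) by auto
    note X = first_variation_cutoff_field_ge[OF V b(1) r(1) this]
    define X where "X y = cutoff (b\<^sup>2) (?t r y) *\<^sub>R (y - x)" for y
    have \<tau>_ge: "(?t r y) \<ge> b\<^sup>2" if "y \<notin> K" for y
    proof -
      have "y \<notin> cball x (b * r)" using that sub[of "b * r"] r(2) by auto
      then have "norm (y - x) / r \<ge> b" using r(1) by (simp add: dist_norm norm_minus_commute field_simps)
      then show ?thesis using b by (intro power_mono) auto
    qed
    note [measurable] = borel_measurable_cutoff[OF b2]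
    have m1: "(LINT y|mass \<Omega> V. cutoff (b\<^sup>2) (?t r y)) = (LINT y|\<mu>. cutoff (b\<^sup>2) (?t r y))"
      by (rule mass_eq) (measurable, simp add: cutoff_eq_0[OF b2 \<tau>_ge])
    have m2: "(LINT y|mass \<Omega> V. cutoff' (b\<^sup>2) (?t r y) * (?t r y))
        = (LINT y|\<mu>. cutoff' (b\<^sup>2) (?t r y) * (?t r y))"
      by (rule mass_eq) (measurable, simp add: cutoff'_eq_0[OF b2 \<tau>_ge])
    let ?I = "\<lambda>b r. real CARD('d) * (LINT y|\<mu>. cutoff (b\<^sup>2) (?t r y))
        + 2 * (LINT y|\<mu>. cutoff' (b\<^sup>2) (?t r y) * ?t r y)"
    have "?I b r \<le> first_variation V X"
      using X(4) unfolding m1 m2 X_def .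
    also have "\<dots> \<le> b * r * (?n (b * r) + ?h (b * r))"
      unfolding X_def[abs_def] using X(1-3) r(2) by (intro fv_le) auto
    also have "\<dots> \<le> b * r * (C * ?m (5 * (b * r)))"
      using b r by (intro mult_left_mono R1) auto
    finally show "?I b r \<le> b * r * C * ?m (5 * (b * r))"
      by (simp only: mult.assoc)
  qed (use C in auto)
  have \<Theta>_nonneg: "\<Theta> \<ge> 0"
    using \<Theta> by (rule tendsto_lowerbound) (auto intro!: eventually_mono[OF eventually_at_right_less[of 0]])
  have ev_R0: "\<forall>\<^sub>F r in at_right 0. 0 < r \<and> r < R0"
    unfolding eventually_at_right_field using R0 by blast
  have "\<Theta> \<noteq> 0"
  proof
    assume "\<Theta> = 0"
    have "((\<lambda>r. measure (mass \<Omega> V) (cball x r) / r ^ CARD('d)) \<longlongrightarrow> 0) (at_right 0)"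
      using \<Theta>[unfolded \<open>\<Theta> = 0\<close>]
    proof (rule Lim_transform_eventually)
      show "\<forall>\<^sub>F r in at_right 0. ?m r / r ^ CARD('d) = measure (mass \<Omega> V) (cball x r) / r ^ CARD('d)"
        using ev_R0
      proof eventually_elim
        case (elim r)
        then show ?case unfolding \<mu>_def using measure_localize[OF mass_loc _ sub] by simp
      qed
    qed
    then show False using nz by blast
  qed
  then have \<Theta>_pos: "\<Theta> > 0" using \<Theta>_nonneg by simp
  have d1: "CARD('d) \<ge> 1" by (simp add: Suc_leI)
  have \<rho>c: "continuous_on UNIV \<rho>" by (rule C1_continuous_on[OF \<rho>(2)])
  define I where "I \<phi> = (LBINT r:{0..1}. \<phi> r * r ^ (CARD('d) - 1))" for \<phi> :: "real \<Rightarrow> real"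
  have I\<rho>: "I \<rho> > 0" unfolding I_def by (rule kernel_moment_pos[OF \<rho>(1) \<rho>c \<rho>(3)])
  have I\<xi>: "I \<xi> > 0" unfolding I_def by (rule kernel_moment_pos[OF \<xi>])
  have leb_nth: "\<forall>\<^sub>F r in at_right 0. (LINT y:cball x r|\<mu>. \<bar>h y $ j - h x $ j\<bar>) \<le> c * ?m (5 * r)"
    if "c > 0" for c j
    using leb'[OF that]
  proof eventually_elim
    case (elim r)
    have "(LINT y:cball x r|\<mu>. \<bar>h y $ j - h x $ j\<bar>) \<le> (LINT y:cball x r|\<mu>. norm (h y - h x))"
      unfolding set_lebesgue_integral_def
    proof (rule integral_mono_AE'[OF ind_int[OF int_h']])
      show "AE y in \<mu>. indicator (cball x r) y *\<^sub>R \<bar>h y $ j - h x $ j\<bar> \<le> indicator (cball x r) y *\<^sub>R norm (h y - h x)"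
        using component_le_norm_cart[of "h y - h x" j for y] by (intro AE_I2 scaleR_left_mono) auto
    qed simp
    then show ?case using elim by simp
  qed
  have int_nth: "integrable \<mu> (\<lambda>y. h y $ j)" for j
    by (rule integrable_bounded_linear[OF bounded_linear_vec_nth int_h])
  have s_nth: "AE y in \<nu>'. \<bar>s y $ j\<bar> \<le> 1" for j
    using s_le by eventually_elim (rule order_trans[OF component_le_norm_cart])
  have s_nth_borel: "(\<lambda>y. s y $ j) \<in> borel_measurable borel" for j
    by (rule measurable_compose[OF s_borel]) (intro borel_measurable_continuous_onI continuous_intros)
  have \<rho>1: "\<rho> t = 0" if "t > 1" for t using that by (intro kernel_profile_eq_0[OF \<rho>(1)]) simp
  have \<xi>1: "\<xi> t = 0" if "t > 1" for t using that by (intro kernel_profile_eq_0[OF \<xi>(1)]) simp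
  note lim = approx_limit[OF \<mu> \<nu>' int_nth s_nth_borel s_nth d1 \<Theta> \<Theta>_pos leb_nth sing'
      \<rho>c \<rho>1 I\<rho>[unfolded I_def] \<xi>(2) \<xi>1 I\<xi>[unfolded I_def]]
  define A where "A e = (LINT y|\<mu>. \<xi> (norm (y - x) / e))" for e
  have [measurable]: "\<xi> \<in> borel_measurable borel" "\<rho> \<in> borel_measurable borel"
    using \<xi>(2) \<rho>c by (auto intro: borel_measurable_continuous_onI)
  have mc: "mass_conv \<xi> e \<Omega> V x = A e / e ^ CARD('n)" if e: "0 < e" "e < R0" for e
  proof -
    have sc: "scaled e (radial \<xi>) (y - x) = \<xi> (norm (y - x) / e) / e ^ CARD('n)" for y
      using e(1) by (simp add: scaled_def radial_def)
    have out: "\<xi> (norm (y - x) / e) = 0" if "y \<notin> K" for y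
    proof -
      have "y \<notin> cball x e" using that sub[of e] e(2) by auto
      then show ?thesis using e(1) by (intro \<xi>1) (simp add: dist_norm norm_minus_commute)
    qed
    have "mass_conv \<xi> e \<Omega> V x = (LINT y|\<mu>. \<xi> (norm (y - x) / e) / e ^ CARD('n))"
      unfolding mass_conv_def sc by (rule mass_eq) (measurable, simp add: out)
    then show ?thesis by (simp add: A_def)
  qed
  have A_pos: "\<forall>\<^sub>F e in at_right 0. A e > 0" unfolding A_def by (rule lim(2))
  show ?P
    using ev_R0 A_pos
  proof eventually_elim
    case (elim e)
    then show ?case using sub[of e] K(2) by (auto simp: mc)
  qed
  show ?L
  proof (rule vec_tendstoI)
    fix j
    have "((\<lambda>e. I \<xi> / I \<rho> * (((LINT y|\<mu>. ?r e y * h y $ j)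
        - (LINT y|\<nu>'. ?r e y * s y $ j)) / A e)) \<longlongrightarrow> h x $ j) (at_right 0)"
      unfolding I_def A_def by (rule lim(1))
    then show "((\<lambda>e. ?a e $ j) \<longlongrightarrow> H x $ j) (at_right 0)"
      unfolding h_def indicator_simps(1)[OF xK] scaleR_one
    proof (rule Lim_transform_eventually)
      show "\<forall>\<^sub>F e in at_right 0. I \<xi> / I \<rho> * (((LINT y|\<mu>. ?r e y * (indicator K y *\<^sub>R H y) $ j)
          - (LINT y|\<nu>'. ?r e y * s y $ j)) / A e) = ?a e $ j"
        using ev_R0
      proof eventually_elim
        case (elim e)
        then have e: "0 < e" "e < R0" by auto
        have sub\<Omega>: "cball x e \<subseteq> \<Omega>" using sub[of e] e K(2) by auto
        let ?X = "\<lambda>y. scaled e (radial \<rho>) (y - x) *\<^sub>R (axis j 1 :: real^'n)"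
        have X0: "?X y = 0" if "y \<notin> K" for y
        proof -
          have "y \<notin> cball x e" using that sub[of e] e(2) by auto
          then show ?thesis
            using scaled_radial_eq_0[OF V \<rho>(1,2) e(1) sub\<Omega>, of "y - x"] by (simp add: dist_norm norm_minus_commute)
        qed
        have sc: "?X y \<bullet> w = ?r e y * w $ j / e ^ CARD('n)" for y w
          by (simp add: scaled_radial[OF V \<rho>(1,2) e(1) sub\<Omega>] inner_axis')
        have "first_variation_conv \<rho> e V x $ j = first_variation V ?X"
          by (rule first_variation_conv_nth[OF V \<rho>(1,2) e(1) sub\<Omega>])
        also have "\<dots> = (LINT y|\<nu>'. ?X y \<bullet> s y) - (LINT y|\<mu>. ?X y \<bullet> h y)"
          using mollifier_field_Cc1[OF V \<rho>(1,2) e(1) sub\<Omega>] X0 by (rule fv)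
        also have "\<dots> = ((LINT y|\<nu>'. ?r e y * s y $ j) - (LINT y|\<mu>. ?r e y * h y $ j)) / e ^ CARD('n)"
          unfolding sc by (simp add: diff_divide_distrib)
        finally have fvc: "first_variation_conv \<rho> e V x $ j = \<dots>" .
        \<comment> \<open>The common factor d \<omega>_d cancels, so the normalizing quotient is the
          ratio of the two moments.\<close>
        have "unit_ball_vol (real CARD('d)) \<noteq> 0" using unit_ball_vol_pos[of "real CARD('d)"] by linarith
        then have kc: "kernel_const CARD('d) \<xi> / kernel_const CARD('d) \<rho> = I \<xi> / I \<rho>"
          by (simp add: kernel_const_def I_def)
        \<comment> \<open>The powers e^n of both mollifications cancel, and the minus sign of the
          definition reverses the difference found for the first variation.\<close>
        have "?a e $ j
            = - (I \<xi> / I \<rho>) * (first_variation_conv \<rho> e V x $ j / (A e / e ^ CARD('n)))"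
          unfolding approx_mean_curvature_def kc mc[OF e] by (simp add: divide_inverse mult_ac)
        also have "\<dots> = I \<xi> / I \<rho> * (((LINT y|\<mu>. ?r e y * h y $ j)
            - (LINT y|\<nu>'. ?r e y * s y $ j)) / A e)"
          unfolding fvc using e(1) by (simp add: minus_divide_left[symmetric] flip: minus_mult_right)
            (simp add: minus_divide_left right_diff_distrib diff_divide_distrib)
        finally show ?case unfolding h_def by simp
      qed
    qed
  qed
qed

theorem theorem4p3:
  fixes \<Omega> M :: "(real^'n) set"
    and \<theta> :: "real^'n \<Rightarrow> real"
    and V :: "((real^'n) \<times> (real^'n^'n)) measure"
    and H :: "real^'n \<Rightarrow> real^'n"
    and \<rho> \<xi> :: "real \<Rightarrow> real"
  assumes "CARD('d::finite) < CARD('n)"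
    and "kernel_profile \<rho>" and "C1 \<rho>"
    and "(LINT x|lborel. radial \<rho> (x :: real^'n)) = 1"
    and "kernel_profile \<xi>" and "continuous_on UNIV \<xi>"
    and "(LINT x|lborel. radial \<xi> (x :: real^'n)) = 1"
    and "open \<Omega>"
    and "rectifiable_varifold TYPE('d) \<Omega> M \<theta> V"
    and "locally_bounded_first_variation \<Omega> V"
    and "generalized_mean_curvature \<Omega> V H"
  shows "AE x in mass \<Omega> V.
    (\<forall>\<^sub>F \<epsilon> in at_right 0. cball x \<epsilon> \<subseteq> \<Omega> \<and> mass_conv \<xi> \<epsilon> \<Omega> V x > 0) \<and>
    ((\<lambda>\<epsilon>. approx_mean_curvature CARD('d) \<rho> \<xi> \<epsilon> \<Omega> V x) \<longlongrightarrow> H x) (at_right 0)"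
proof -
  let ?P = "\<lambda>x. \<forall>\<^sub>F \<epsilon> in at_right 0. cball x \<epsilon> \<subseteq> \<Omega> \<and> mass_conv \<xi> \<epsilon> \<Omega> V x > 0"
  let ?L = "\<lambda>x. ((\<lambda>\<epsilon>. approx_mean_curvature CARD('d) \<rho> \<xi> \<epsilon> \<Omega> V x) \<longlongrightarrow> H x) (at_right 0)"
  note V = assms(9)[unfolded rectifiable_varifold_def, THEN conjunct1]
  obtain \<nu> \<sigma> where H: "L1_loc \<Omega> (mass \<Omega> V) H" and sing: "mutually_singular (mass \<Omega> V) \<nu>"
    and rep: "vector_radon_rep \<Omega> (\<lambda>X. first_variation V X + (LINT x|mass \<Omega> V. X x \<bullet> H x)) \<nu> \<sigma>"
    using assms(11) unfolding generalized_mean_curvature_def by blast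
  have \<nu>: "radon_measure_on \<Omega> \<nu>" "\<sigma> \<in> borel_measurable \<nu>" "AE x in \<nu>. norm (\<sigma> x) = 1"
    "\<And>X. X \<in> Cc1 \<Omega> \<Longrightarrow> first_variation V X + (LINT x|mass \<Omega> V. X x \<bullet> H x) = (LINT x|\<nu>. X x \<bullet> \<sigma> x)"
    using rep unfolding vector_radon_rep_def by blast+
  have sets_\<nu>: "sets \<nu> = sets (restrict_space borel \<Omega>)" using \<nu>(1) by (simp add: radon_measure_on_def)
  obtain N where N: "N \<in> sets (mass \<Omega> V)" "N \<in> sets \<nu>" "emeasure (mass \<Omega> V) N = 0" "emeasure \<nu> (space \<nu> - N) = 0"
    using sing unfolding mutually_singular_def by blast
  have "N \<in> null_sets (mass \<Omega> V)" using N(1,3) by (simp add: null_sets_def)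
  then have ae_N: "AE x in mass \<Omega> V. x \<notin> N" by (rule AE_not_in)
  show ?thesis
  proof (rule AE_of_AE_balls[OF assms(8) space_mass[OF V]])
    fix a :: "real^'n" and R :: real
    assume R: "R > 0" "cball a R \<subseteq> \<Omega>"
    define K where "K = cball a R"
    have K: "compact K" "K \<subseteq> \<Omega>" using R(2) by (simp_all add: K_def)
    note mass_loc = sets_mass[OF V] K emeasure_mass_finite[OF V K]
  let ?\<mu> = "localize (mass \<Omega> V) K" and ?\<nu> = "localize \<nu> K"
    have "emeasure \<nu> K < \<infinity>" using \<nu>(1) K by (simp add: radon_measure_on_def)
    note \<nu>_loc = sets_\<nu> K this
    note fin = finite_measure_localize[OF mass_loc] sets_localize finite_measure_localize[OF \<nu>_loc] sets_localize
    have int_H: "integrable (mass \<Omega> V) (\<lambda>y. indicator K y *\<^sub>R H y)"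
      using H K by (simp add: L1_loc_def set_integrable_def)
    have "integrable ?\<mu> (\<lambda>y. indicator K y *\<^sub>R H y)"
    proof -
      have b: "(\<lambda>y. indicator K y *\<^sub>R H y) \<in> borel_measurable borel"
        by (rule indicator_scaleR_borel_measurable[OF mass_loc borel_measurable_integrable[OF int_H] assms(8)])
      have "(\<lambda>y. indicator K y *\<^sub>R (indicator K y *\<^sub>R H y)) = (\<lambda>y. indicator K y *\<^sub>R H y)"
        by (auto split: split_indicator)
      then show ?thesis unfolding integral_localize(2)[OF mass_loc b] using int_H by simp
    qed
    note leb = AE_localizeD[OF mass_loc AE_Lebesgue_point[OF fin(1,2) this]]
    \<comment> \<open>This set has full \<open>mass \<Omega> V\<close>-measure and is null for
      \<nu>, which is the situation of the covering estimate.\<close>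
    define E where "E = \<Omega> - N"
    have E: "E \<in> sets borel" "emeasure ?\<nu> E = 0"
    proof -
      have "\<Omega> - N \<in> sets (restrict_space borel \<Omega>)"
        using sets.compl_sets[OF N(2)] unfolding space_eq[OF \<nu>_loc] sets_\<nu> .
      then show Eb: "E \<in> sets borel" using assms(8) by (auto simp: E_def sets_restrict_space)
      have "emeasure ?\<nu> E = emeasure \<nu> (E \<inter> K)" by (rule emeasure_localize[OF \<nu>_loc Eb])
      also have "\<dots> \<le> emeasure \<nu> (space \<nu> - N)"
        by (rule emeasure_mono[OF _ sets.compl_sets[OF N(2)]]) (auto simp: E_def space_eq[OF \<nu>_loc])
      finally show "emeasure ?\<nu> E = 0" using N(4) by simp
    qed
    \<comment> \<open>The exceptional null set depends on the constant, so countably many constants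
      1 / (k + 1) are treated at once and then compared with an arbitrary c > 0.\<close>
    have "AE x in ?\<mu>. \<forall>k::nat. x \<in> E \<longrightarrow> (\<forall>\<^sub>F r in at_right 0.
        measure ?\<nu> (cball x r) \<le> 1 / Suc k * measure ?\<mu> (cball x (5 * r)))"
      by (intro AE_all_countable[THEN iffD2] allI AE_Vitali_differentiation fin E) simp
    note sing = AE_localizeD[OF mass_loc this]
    show "AE x in mass \<Omega> V. x \<in> ball a R \<longrightarrow> ?P x \<and> ?L x"
      using leb sing ae_N AE_density_mass_not_zero[OF assms(9,8)]
    proof eventually_elim
      case (elim x)
      show ?case
      proof (intro impI)
        assume x: "x \<in> ball a R"
        then have xK: "x \<in> K" by (simp add: K_def)
        then have xE: "x \<in> E" using K(2) elim(3) by (auto simp: E_def)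
        have s: "\<forall>\<^sub>F r in at_right 0.
            measure ?\<nu> (cball x r) \<le> c * measure ?\<mu> (cball x (5 * r))"
          if "c > 0" for c
        proof -
          obtain k where "inverse (real (Suc k)) < c" using reals_Archimedean[OF \<open>c > 0\<close>] by blast
          then have k: "1 / Suc k \<le> c" by (simp add: inverse_eq_divide)
          have "\<forall>\<^sub>F r in at_right 0. measure ?\<nu> (cball x r)
              \<le> 1 / Suc k * measure ?\<mu> (cball x (5 * r))"
            using elim(2) xK xE by blast
          then show ?thesis
            by (rule eventually_mono) (use mult_right_mono[OF k measure_nonneg] in \<open>blast intro: order_trans\<close>)
        qed
        have l: "\<forall>\<^sub>F r in at_right 0.
          (LINT y:cball x r|?\<mu>. norm (indicator K y *\<^sub>R H y - indicator K x *\<^sub>R H x))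
            \<le> c * measure ?\<mu> (cball x (5 * r))" if "c > 0" for c
          using elim(1) xK that by blast
        note conv = approx_mean_curvature_tendsto[OF assms(2-4) assms(5-8) V H \<nu> K_def K(2) x l s elim(4)]
        show "?P x \<and> ?L x" using conv by blast
      qed
    qed
  qed
qed

end
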